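(* Let $\Phi,\Psi:[0,+\infty)\to(0,+\infty)$ be strictly increasing functions with $\lim_{t\to\infty}\Phi(t)=\lim_{t\to\infty}\Psi(t)=+\infty$, where $\Phi$ maps $[0,\infty)$ onto $[\Phi(0),\infty)$, and let $V:\mathbb{R}\to\mathbb{R}$ be a measurable potential with $\Phi(|x|)\le V(x)\le\Psi(|x|)$ for all $x\in\mathbb{R}$. Let $H=-\partial_x^2+V(x)$ and let $\kappa>0$. Suppose that (a) $\Phi$ has sub-exponential growth: for every $\beta>0$ there is a constant $C_\beta$ such that $\Phi(|x|)\le C_\beta e^{\beta|x|}$ for all $x\in\mathbb{R}$; (b) $\Psi\big(\Phi^{-1}(\lambda)(1+o(1))\big)=O(\lambda^{2\kappa})$ as $\lambda\to\infty$; that is, for every real function $\eta$ with $\eta(\lambda)\to0$ as $\lambda\to\infty$, one has $\Psi\big(\Phi^{-1}(\lambda)(1+\eta(\lambda))\big)=O(\lambda^{2\kappa})$ as $\lambda\to\infty$. Let $\omega\subset\mathbb{R}$ be a thick set, i.e. a measurable set for which there exist $a>0$ and $\delta>0$ with $|\omega\cap I|\ge\delta|I|$ for every interval $I$ of length $a$. Then there is a constant $C$, not depending on $\lambda$ or $\phi$, such that for every $\lambda>0$ $$\|\phi\|_{L^2(\mathbb{R})}\le e^{C\lambda^{\kappa}}\|\phi\|_{L^2(\omega)}\qquad\text{for all }\phi\in Ran(P_\lambda(H)).$$ Moreover, one can choose $C=C_0\,a\,|\log\delta|$, where $C_0$ is a positive constant not depending on $\lambda$ or $\phi$.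
   Context: $|S|$ denotes the Lebesgue measure of $S\subset\mathbb{R}$. Since $V(x)\to+\infty$ as $|x|\to\infty$, the self-adjoint operator $H=-\partial_x^2+V$ on $L^2(\mathbb{R})$ has discrete spectrum, with eigenvalues $\lambda_0\le\lambda_1\le\dots\to\infty$ (counted with multiplicity) and eigenfunctions $\phi_k\in L^2(\mathbb{R})$, $-\phi_k''+V\phi_k=\lambda_k\phi_k$, forming an orthonormal basis of $L^2(\mathbb{R})$. $Ran(P_\lambda(H))$ denotes the linear span of the eigenfunctions $\phi_k$ with $\lambda_k\le\lambda$. $\Phi^{-1}:[\Phi(0),\infty)\to[0,\infty)$ is the inverse function of $\Phi$. *)

theory Defs
  imports "HOL-Analysis.Analysis" "HOL-Library.Landau_Symbols"
begin

definition square_integrable :: "(real \<Rightarrow> complex) \<Rightarrow> bool" where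
  "square_integrable f \<longleftrightarrow>
     f \<in> borel_measurable lebesgue \<and> integrable lebesgue (\<lambda>x. (cmod (f x))\<^sup>2)"

definition L2norm_on :: "real set \<Rightarrow> (real \<Rightarrow> complex) \<Rightarrow> real" where
  "L2norm_on S f = sqrt (LINT x:S|lebesgue. (cmod (f x))\<^sup>2)"

text \<open>
  \<open>g\<close> is the second derivative of \<open>f\<close> in the sense of distributions, with \<open>g\<close> locally integrable:
  \<open>f\<close> is continuously differentiable, and \<open>f'\<close> is locally absolutely continuous with a.e.
  derivative \<open>g\<close>. As the potential is only measurable, second derivatives need not exist
  everywhere.
\<close>
definition has_second_derivative :: "(real \<Rightarrow> complex) \<Rightarrow> (real \<Rightarrow> complex) \<Rightarrow> bool" where
  "has_second_derivative f g \<longleftrightarrow>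
     (\<exists>f'. (\<forall>x. (f has_vector_derivative f' x) (at x)) \<and>
           (\<forall>s t. s \<le> t \<longrightarrow> g absolutely_integrable_on {s..t} \<and>
                            (g has_integral (f' t - f' s)) {s..t}))"

text \<open>
  The graph of the operator \<open>H = - d\<^sup>2/dx\<^sup>2 + V\<close> on its maximal domain in complex
  \<open>L\<^sup>2\<close>. For \<open>V\<close> bounded below and locally bounded, this is the self-adjoint
  realisation of \<open>- d\<^sup>2/dx\<^sup>2 + V\<close>. An element of the domain is represented by its
  continuous representative.
\<close>
definition schroedinger_graph ::
    "(real \<Rightarrow> real) \<Rightarrow> ((real \<Rightarrow> complex) \<times> (real \<Rightarrow> complex)) set" where
  "schroedinger_graph V =
     {(f, h). square_integrable f \<and> square_integrable h \<and>
        (\<exists>g. has_second_derivative f g \<and>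
             (AE x in lebesgue. h x = - g x + complex_of_real (V x) * f x))}"

definition eigenspace :: "(real \<Rightarrow> real) \<Rightarrow> real \<Rightarrow> (real \<Rightarrow> complex) set" where
  "eigenspace V \<mu> = {f. (f, \<lambda>x. complex_of_real \<mu> * f x) \<in> schroedinger_graph V}"

text \<open>
  The range of the spectral projector: the complex linear span of all eigenfunctions with
  eigenvalue at most \<open>E\<close>. This is also the span of those members of any given orthonormal
  eigenbasis whose eigenvalue is at most \<open>E\<close>.
\<close>
definition spectral_range :: "(real \<Rightarrow> real) \<Rightarrow> real \<Rightarrow> (real \<Rightarrow> complex) set" where
  "spectral_range V E =
     {\<phi>. \<exists>F c. finite F \<and> F \<subseteq> (\<Union>\<mu>\<in>{..E}. eigenspace V \<mu>) \<and>
               \<phi> = (\<lambda>x. \<Sum>f\<in>F. c f * f x)}"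

definition thick_set :: "real \<Rightarrow> real \<Rightarrow> real set \<Rightarrow> bool" where
  "thick_set a \<delta> \<omega> \<longleftrightarrow>
     a > 0 \<and> \<delta> > 0 \<and> \<omega> \<in> sets lebesgue \<and>
     (\<forall>s. measure lebesgue (\<omega> \<inter> {s..s + a}) \<ge> \<delta> * measure lebesgue {s..s + a})"

end

(*
  Let r be the inverse image of E under Phi and let phi be a combination of eigenfunctions with
  eigenvalues at most E. The energy inequality controls phi' in L2 by sqrt E times the mass of phi in
  [-r, r], because V >= E outside. By the growth condition V is at most M^2, with M of order E^kappa,
  even on a slightly larger interval. On an interval I of length a meeting [-r, r] put
    W(x, y) = sum cosh (sqrt mu y) g_mu(x) + i sum (sinh (sqrt mu y) / sqrt mu) (g_mu' - q g_mu)(x),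
  where phi = sum g_mu and q = w'/w for a positive solution w of w'' = V w, so that 0 <= q <= M. Then
  W = phi on the real axis and W_zbar = (q / 2) conj W with a bounded coefficient although V is only
  measurable. By the similarity principle W is exp beta times a holomorphic function, beta of size
  O(M), and a Remez inequality for holomorphic functions bounds phi on I by exp (C M) times its size
  on the thick set, unless phi is much larger near I than on I. A pigeonhole argument over the
  intervals, in which all sum mu^m g_mu enter with weights (2 E)^(-2 m), disposes of the exceptional
  intervals. Bounded energies are covered by the monotonicity of the spectral subspaces, and the
  constant C0 a |ln delta| is any large constant rescaled, as delta < 1 unless omega has full measure.
*)
theory Submission
  imports Defs "HOL-Complex_Analysis.Complex_Analysis" "HOL-Probability.Sinc_Integral"
begin

text \<open>The cost must be exponential in \<open>M\<close>, and \<open>M\<close> is of order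
  \<open>E powr \<kappa>\<close>; this shapes the construction. Extending phi by cosh (sqrt mu y)
  alone gives a second order equation whose coefficient \<open>V\<close> has size
  \<open>M\<^sup>2\<close>. The similarity principle costs the exponential of the coefficient of a
  first order system, and q = w' / w, of size \<open>M\<close>, is a square root of \<open>V\<close>
  in the sense that q' + q^2 = V. No derivative of q enters, because g' - q g is a Wronskian divided
  by w and hence continuously differentiable even though \<open>V\<close> is only measurable.

  Off the real axis the extension is not controlled by phi, since components that cancel on the axis
  recombine with different weights. Its Taylor coefficients in y involve all the sums of mu^m g_mu,
  so every interval needs bounds for all m at once. Globally these sums have norm at most E^m times
  that of phi. Dividing by (2 E)^m leaves a convergent geometric series, so that one number per
  interval dominates all m and the numbers have a finite total. The price is cosh (sqrt (2 E) y) in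
  place of cosh (sqrt E y), which is still exponential in \<open>M\<close>.\<close>

section \<open>Integration by parts with a bounded measurable second factor\<close>

text \<open>Second order increments force the derivative to vanish. The product rule below is
  reduced to this criterion because its second factor is differentiable only almost
  everywhere.\<close>

lemma quadratic_increments_constant:
  fixes J :: "real \<Rightarrow> real"
  assumes q: "\<And>x y. s \<le> x \<Longrightarrow> x \<le> y \<Longrightarrow> y \<le> t \<Longrightarrow> \<bar>J y - J x\<bar> \<le> C * (y - x)\<^sup>2" and st: "s \<le> t"
  shows "J t = J s"
proof -
  have q': "\<bar>J y - J x\<bar> \<le> C * \<bar>y - x\<bar> * \<bar>y - x\<bar>" if "x \<in> {s..t}" "y \<in> {s..t}" for x y
    using q[of x y] q[of y x] that by (cases "x \<le> y") (auto simp: power2_eq_square abs_minus_commute algebra_simps)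
  have d: "(J has_real_derivative 0) (at x within {s..t})" if x: "x \<in> {s..t}" for x
    unfolding has_field_derivative_iff
  proof (rule Lim_null_comparison)
    show "\<forall>\<^sub>F y in at x within {s..t}. norm ((J y - J x) / (y - x)) \<le> C * \<bar>y - x\<bar>"
      unfolding eventually_at_filter
    proof (rule always_eventually, intro allI impI)
      fix y assume "y \<noteq> x" "y \<in> {s..t}"
      then show "norm ((J y - J x) / (y - x)) \<le> C * \<bar>y - x\<bar>"
        using q'[OF x, of y] by (simp add: divide_simps)
    qed
    have "((\<lambda>y. C * \<bar>y - x\<bar>) \<longlongrightarrow> C * \<bar>x - x\<bar>) (at x within {s..t})" by (intro tendsto_intros)
    then show "((\<lambda>y. C * \<bar>y - x\<bar>) \<longlongrightarrow> 0) (at x within {s..t})" by simp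
  qed
  have "\<exists>c. \<forall>x\<in>{s..t}. J x = c"
    by (rule has_field_derivative_zero_constant) (use d in auto)
  then show ?thesis using st by auto
qed

text \<open>\<open>K\<close> is only an indefinite integral of a bounded \<open>k\<close>, so the
  product of \<open>p\<close> and \<open>K\<close> has no pointwise derivative to integrate. Instead
  the defect of the formula is shown to have increments of second order.\<close>

lemma integration_by_parts_bounded:
  fixes p p' K k :: "real \<Rightarrow> real"
  assumes st: "s \<le> t"
    and p: "\<And>x. x \<in> {s..t} \<Longrightarrow> (p has_real_derivative p' x) (at x within {s..t})" "continuous_on {s..t} p'"
    and k: "k integrable_on {s..t}" "\<And>x. x \<in> {s..t} \<Longrightarrow> \<bar>k x\<bar> \<le> C"
    and K: "\<And>x. x \<in> {s..t} \<Longrightarrow> K x = K s + integral {s..x} k"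
  shows "((\<lambda>x. p' x * K x + p x * k x) has_integral (p t * K t - p s * K s)) {s..t}"
proof -
  have cp: "continuous_on {s..t} p"
    by (rule DERIV_continuous_on[OF p(1)])
  have cK: "continuous_on {s..t} K"
  proof -
    have "continuous_on {s..t} (\<lambda>x. K s + integral {s..x} k)"
      by (intro continuous_intros indefinite_integral_continuous_1 k)
    then show ?thesis by (rule continuous_on_eq) (rule K[symmetric])
  qed
  have C: "C \<ge> 0" using k(2)[of s] st by auto
  obtain P where P: "\<And>x. x \<in> {s..t} \<Longrightarrow> \<bar>p' x\<bar> \<le> P" "P \<ge> 0"
  proof -
    have "compact (p' ` {s..t})" by (intro compact_continuous_image p) auto
    then obtain P where "P > 0" "\<forall>x\<in>p' ` {s..t}. norm x \<le> P" using compact_imp_bounded bounded_pos by metis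
    then show ?thesis using that[of P] by auto
  qed
  have ik: "k integrable_on {x..y}" if "s \<le> x" "y \<le> t" for x y
    by (rule integrable_on_subinterval[OF k(1)]) (use that in auto)
  have Kd: "K y - K x = integral {x..y} k" if "s \<le> x" "x \<le> y" "y \<le> t" for x y
  proof -
    have "integral {s..x} k + integral {x..y} k = integral {s..y} k"
      by (rule Henstock_Kurzweil_Integration.integral_combine) (use that ik in auto)
    then show ?thesis using K[of x] K[of y] that by auto
  qed
  have Kd_le: "\<bar>K y - K x\<bar> \<le> C * (y - x)" if "s \<le> x" "x \<le> y" "y \<le> t" for x y
  proof -
    have "norm (integral {x..y} k) \<le> C * (y - x)"
      using has_integral_bound_real[OF C finite.emptyI integrable_integral[OF ik[OF that(1,3)]]] that k(2) by auto
    then show ?thesis using Kd[OF that] by simp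
  qed
  have pd: "(p' has_integral (p y - p x)) {x..y}" if "s \<le> x" "x \<le> y" "y \<le> t" for x y
    by (rule fundamental_theorem_of_calculus)
       (use that in \<open>auto simp flip: has_real_derivative_iff_has_vector_derivative intro!: DERIV_subset[OF p(1)]\<close>)
  have pd_le: "\<bar>p y - p x\<bar> \<le> P * (y - x)" if "s \<le> x" "x \<le> y" "y \<le> t" for x y
    using has_integral_bound_real[OF P(2) finite.emptyI pd[OF that]] P(1) that by auto
  have ak: "k absolutely_integrable_on {s..t}"
    by (rule absolutely_integrable_integrable_bound[where g = "\<lambda>_. C"]) (use k in auto)
  have ipk: "(\<lambda>x. p x * k x) integrable_on {s..t}"
  proof (rule set_lebesgue_integral_eq_integral(1), rule absolutely_integrable_bounded_measurable_product_real)
    show "p \<in> borel_measurable (lebesgue_on {s..t})"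
      by (rule continuous_imp_measurable_on_sets_lebesgue[OF cp]) auto
    show "bounded (p ` {s..t})" using cp compact_continuous_image compact_imp_bounded by blast
  qed (use ak in auto)
  define f where "f x = p' x * K x + p x * k x" for x
  have if_: "f integrable_on {s..t}" unfolding f_def
    by (intro integrable_add ipk integrable_continuous_interval continuous_intros p cK)
  have iff: "f integrable_on {x..y}" if "s \<le> x" "y \<le> t" for x y
    by (rule integrable_on_subinterval[OF if_]) (use that in auto)
  \<comment> \<open>The increment of this defect over \<open>{x..y}\<close> is the integral of
    \<open>p' u * (K y - K u) + (p x - p u) * k u\<close>. Each summand is a bounded factor times an
    oscillation of order \<open>y - x\<close>, since \<open>P\<close> and \<open>C\<close> are
    Lipschitz constants of \<open>p\<close> and \<open>K\<close>; hence the constant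
    \<open>2 * P * C\<close>.\<close>
  define J where "J x = p x * K x - integral {s..x} f" for x
  have "J t = J s"
  proof (rule quadratic_increments_constant[OF _ st, where C = "2 * P * C"])
    fix x y assume xy: "s \<le> x" "x \<le> y" "y \<le> t"
    have ip: "(\<lambda>u. p' u * (K y - K u)) integrable_on {x..y}"
      by (intro integrable_continuous_interval continuous_intros continuous_on_subset[OF p(2)] continuous_on_subset[OF cK]) (use xy in auto)
    have ipk': "(\<lambda>u. p u * k u) integrable_on {x..y}"
      by (rule integrable_on_subinterval[OF ipk]) (use xy in auto)
    have ik': "(\<lambda>u. (p x - p u) * k u) integrable_on {x..y}"
      using integrable_diff[OF integrable_on_cmult_left[OF ik[OF xy(1,3)], of "p x"] ipk'] by (simp add: left_diff_distrib)
    have "integral {s..x} f + integral {x..y} f = integral {s..y} f"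
      by (rule Henstock_Kurzweil_Integration.integral_combine) (use xy iff in auto)
    then have "J y - J x = p y * K y - p x * K x - integral {x..y} f" by (simp add: J_def)
    also have "p y * K y - p x * K x = integral {x..y} (\<lambda>u. p' u * K y + p x * k u)"
    proof -
      have "((\<lambda>u. p' u * K y + p x * k u) has_integral ((p y - p x) * K y + p x * (K y - K x))) {x..y}"
        using integrable_integral[OF ik[OF xy(1,3)]] Kd[OF xy]
        by (intro has_integral_add has_integral_mult_left has_integral_mult_right pd[OF xy]) simp
      then show ?thesis by (simp add: integral_unique algebra_simps)
    qed
    also have "integral {x..y} (\<lambda>u. p' u * K y + p x * k u) - integral {x..y} f
        = integral {x..y} (\<lambda>u. (p' u * K y + p x * k u) - f u)"
      by (rule Henstock_Kurzweil_Integration.integral_diff[symmetric])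
         (intro integrable_add integrable_on_mult_left integrable_on_mult_right ik iff has_integral_integrable[OF pd]; use xy in simp)+
    also have "(\<lambda>u. (p' u * K y + p x * k u) - f u) = (\<lambda>u. p' u * (K y - K u) + (p x - p u) * k u)"
      by (simp add: f_def fun_eq_iff algebra_simps)
    finally have e: "J y - J x = integral {x..y} (\<lambda>u. p' u * (K y - K u) + (p x - p u) * k u)" .
    have "norm (integral {x..y} (\<lambda>u. p' u * (K y - K u) + (p x - p u) * k u)) \<le> (2 * P * C * (y - x)) * (y - x)"
    proof (rule has_integral_bound_real[OF _ finite.emptyI integrable_integral[OF integrable_add[OF ip ik']], THEN order_trans])
      show "0 \<le> 2 * P * C * (y - x)" using P C xy by simp
      fix u assume "u \<in> {x..y} - {}"
      then have u: "x \<le> u" "u \<le> y" by auto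
      have "\<bar>p' u * (K y - K u)\<bar> \<le> P * (C * (y - x))"
        unfolding abs_mult using P(1)[of u] Kd_le[of u y] u xy C P(2) mult_left_mono[of "y - u" "y - x" C]
        by (intro mult_mono) auto
      moreover have "\<bar>(p x - p u) * k u\<bar> \<le> (P * (y - x)) * C"
        unfolding abs_mult using pd_le[of x u] k(2)[of u] u xy C P(2) mult_left_mono[of "u - x" "y - x" P]
        by (intro mult_mono) (auto simp: abs_minus_commute)
      ultimately show "norm (p' u * (K y - K u) + (p x - p u) * k u) \<le> 2 * P * C * (y - x)"
        by (simp add: algebra_simps)
    qed (use xy in auto)
    then show "\<bar>J y - J x\<bar> \<le> 2 * P * C * (y - x)\<^sup>2"
      unfolding e by (simp add: power2_eq_square mult_ac)
  qed
  then have "integral {s..t} f = p t * K t - p s * K s" by (simp add: J_def)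
  then show ?thesis using integrable_integral[OF if_] by (simp add: f_def[abs_def])
qed

section \<open>A positive solution of w'' = V w\<close>

text \<open>The initial value problem w'' = V w, w(s) = 1, w'(s) = 0 is the fixed point equation
  \<open>w = 1 + I2 w\<close>. In the supremum norm weighted by \<open>exp (- N * (x - s))\<close>
  each integration gains a factor \<open>1 / N\<close>, so the interval may have any length.\<close>

lemma positive_solution_exists:
  fixes V :: "real \<Rightarrow> real"
  assumes se: "s \<le> e" and V: "V \<in> borel_measurable lebesgue" and M: "M > 0"
    and Vb: "\<And>x. x \<in> {s..e} \<Longrightarrow> 0 \<le> V x" "\<And>x. x \<in> {s..e} \<Longrightarrow> V x \<le> M\<^sup>2"
  obtains w w' where
    "\<And>x. x \<in> {s..e} \<Longrightarrow> (w has_real_derivative w' x) (at x within {s..e})"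
    "\<And>x. x \<in> {s..e} \<Longrightarrow> w' x = integral {s..x} (\<lambda>t. V t * w t)"
    "continuous_on {s..e} w" "w s = 1"
proof -
  \<comment> \<open>With this weight the double integral of \<open>V\<close> times a function gains
    \<open>M\<^sup>2 / N\<^sup>2 = 1 / 4\<close>, the contraction constant used below.\<close>
  define N where "N = 2 * M"
  have N: "N > 0" using M by (simp add: N_def)
  \<comment> \<open>Clamping to \<open>{s..e}\<close> makes the iterates bounded continuous
    functions on the whole line, the complete space in which the fixed point is taken.\<close>
  define c where "c x = max s (min x e)" for x
  have c_mem: "c x \<in> {s..e}" for x using se by (auto simp: c_def)
  have c_id: "c x = x" if "x \<in> {s..e}" for x using that by (auto simp: c_def)
  have c_cont: "continuous_on A c" for A unfolding c_def[abs_def] by (intro continuous_intros)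
  have int: "(\<lambda>t. V t * u t) integrable_on {x..y}" if "continuous_on {s..e} u" "s \<le> x" "y \<le> e" for u x y
  proof -
    have "u absolutely_integrable_on {s..e}" using absolutely_integrable_continuous_real that by blast
    moreover have "bounded (V ` {s..e})" unfolding bounded_iff using Vb by (intro exI[of _ "M\<^sup>2"]) auto
    ultimately have "(\<lambda>t. V t * u t) absolutely_integrable_on {s..e}"
      using V by (intro absolutely_integrable_bounded_measurable_product_real measurable_restrict_space1) auto
    then show ?thesis
      by (intro integrable_on_subinterval[OF set_lebesgue_integral_eq_integral(1)]) (use that in auto)
  qed
  define I1 where "I1 u x = integral {s..x} (\<lambda>t. V t * u t)" for u x
  define I2 where "I2 u x = integral {s..x} (I1 u)" for u x
  have cI1: "continuous_on {s..e} (I1 u)" if "continuous_on {s..e} u" for u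
    unfolding I1_def by (rule indefinite_integral_continuous_1) (use int that in auto)
  have cI2: "continuous_on {s..e} (I2 u)" if "continuous_on {s..e} u" for u
    unfolding I2_def by (intro indefinite_integral_continuous_1 integrable_continuous_interval cI1 that)
  have expint: "((\<lambda>t. exp (N * (t - s))) has_integral (exp (N * (x - s)) - 1) / N) {s..x}" if "s \<le> x" for x
  proof -
    have "((\<lambda>t. exp (N * (t - s))) has_integral exp (N * (x - s)) / N - exp (N * (s - s)) / N) {s..x}"
      by (rule fundamental_theorem_of_calculus[OF that])
         (use N in \<open>auto intro!: derivative_eq_intros simp flip: has_real_derivative_iff_has_vector_derivative\<close>)
    then show ?thesis by (simp add: diff_divide_distrib)
  qed
  have growth: "\<bar>integral {s..x} f\<bar> \<le> B / N * exp (N * (x - s))"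
    if f: "f integrable_on {s..x}" and b: "\<And>t. t \<in> {s..x} \<Longrightarrow> \<bar>f t\<bar> \<le> B * exp (N * (t - s))" and x: "s \<le> x" and B: "B \<ge> 0" for f x B
  proof -
    have "norm (integral {s..x} f) \<le> integral {s..x} (\<lambda>t. B * exp (N * (t - s)))"
      by (rule Henstock_Kurzweil_Integration.integral_norm_bound_integral[OF f])
         (use b has_integral_integrable[OF has_integral_mult_right[OF expint[OF x], of B]] in auto)
    also have "\<dots> = B * ((exp (N * (x - s)) - 1) / N)"
      using expint[OF x] by (intro integral_unique has_integral_mult_right)
    also have "\<dots> \<le> B / N * exp (N * (x - s))" using N B by (simp add: field_simps)
    finally show ?thesis by simp
  qed
  have I2_bound: "\<bar>I2 u x\<bar> \<le> D / 4 * exp (N * (x - s))"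
    if u: "continuous_on {s..e} u" and b: "\<And>t. t \<in> {s..e} \<Longrightarrow> \<bar>u t\<bar> \<le> D * exp (N * (t - s))" and D: "D \<ge> 0" and x: "x \<in> {s..e}" for u D x
  proof -
    have 1: "\<bar>I1 u y\<bar> \<le> (M\<^sup>2 * D / N) * exp (N * (y - s))" if y: "y \<in> {s..e}" for y
      unfolding I1_def
    proof (rule growth)
      fix t assume t: "t \<in> {s..y}"
      then have "\<bar>V t * u t\<bar> \<le> M\<^sup>2 * (D * exp (N * (t - s)))"
        unfolding abs_mult using Vb[of t] b[of t] y by (intro mult_mono) auto
      then show "\<bar>V t * u t\<bar> \<le> M\<^sup>2 * D * exp (N * (t - s))" by (simp add: mult_ac)
    qed (use y int u D in auto)
    have "\<bar>I2 u x\<bar> \<le> (M\<^sup>2 * D / N) / N * exp (N * (x - s))"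
      unfolding I2_def
      by (rule growth) (use 1 x D N in \<open>auto intro!: integrable_continuous_interval continuous_on_subset[OF cI1[OF u]]\<close>)
    also have "(M\<^sup>2 * D / N) / N = D / 4" using M by (simp add: N_def power2_eq_square)
    finally show ?thesis .
  qed
  \<comment> \<open>The fixed point is sought for the weighted function \<open>v\<close>;
    \<open>E v\<close> is the unweighted candidate for \<open>w\<close>.\<close>
  define E where "E v t = exp (N * (t - s)) * apply_bcontfun v t" for v t
  have cE: "continuous_on {s..e} (E v)" for v :: "real \<Rightarrow>\<^sub>C real" unfolding E_def[abs_def] by (intro continuous_intros) auto
  define T where "T v x = exp (- N * (c x - s)) * (1 + I2 (E v) (c x))" for v x
  have E_le: "\<bar>E v t\<bar> \<le> norm v * exp (N * (t - s))" for v t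
    using norm_bounded[of v t] by (simp add: E_def abs_mult)
  have T_bcont: "T v \<in> bcontfun" for v
  proof (rule bcontfun_normI)
    show "continuous_on UNIV (T v)" unfolding T_def[abs_def]
      by (intro continuous_intros c_cont continuous_on_compose2[OF cI2[OF cE]]) (use c_mem in auto)
    show "norm (T v x) \<le> 1 + norm v / 4" for x
    proof -
      have "\<bar>I2 (E v) (c x)\<bar> \<le> norm v / 4 * exp (N * (c x - s))"
        by (rule I2_bound[OF cE E_le]) (use c_mem in auto)
      moreover have "1 \<le> exp (N * (c x - s))" using N c_mem[of x] by simp
      ultimately have "\<bar>1 + I2 (E v) (c x)\<bar> \<le> (1 + norm v / 4) * exp (N * (c x - s))"
        unfolding distrib_right using abs_triangle_ineq[of 1 "I2 (E v) (c x)"] by linarith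
      then have "exp (- N * (c x - s)) * \<bar>1 + I2 (E v) (c x)\<bar> \<le> exp (- N * (c x - s)) * ((1 + norm v / 4) * exp (N * (c x - s)))"
        by (intro mult_left_mono) auto
      also have "\<dots> = 1 + norm v / 4" by (simp add: mult_ac exp_minus)
      finally show ?thesis by (simp add: T_def abs_mult)
    qed
  qed
  define TT where "TT v = Bcontfun (T v)" for v
  have TT_apply: "apply_bcontfun (TT v) = T v" for v by (simp add: TT_def Bcontfun_inverse T_bcont)
  have "\<exists>!v. v \<in> UNIV \<and> TT v = v"
  proof (rule Banach_fix[of UNIV "1/4"])
    show "dist (TT v1) (TT v2) \<le> 1/4 * dist v1 v2" for v1 v2
    proof (rule dist_bound)
      fix x
      have "I2 (E v1) (c x) - I2 (E v2) (c x) = I2 (E (v1 - v2)) (c x)"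
      proof -
        have i1: "I1 (E v1) y - I1 (E v2) y = I1 (E (v1 - v2)) y" if "y \<in> {s..e}" for y
          unfolding I1_def
          by (subst Henstock_Kurzweil_Integration.integral_diff[symmetric])
             (use int[OF cE] that in \<open>auto simp: E_def algebra_simps\<close>)
        have "I2 (E v1) (c x) - I2 (E v2) (c x) = integral {s..c x} (\<lambda>y. I1 (E v1) y - I1 (E v2) y)"
          unfolding I2_def
          by (rule Henstock_Kurzweil_Integration.integral_diff[symmetric])
             (use c_mem[of x] in \<open>auto intro!: integrable_continuous_interval continuous_on_subset[OF cI1[OF cE]]\<close>)
        also have "\<dots> = I2 (E (v1 - v2)) (c x)"
          unfolding I2_def using c_mem[of x] by (intro integral_cong i1) auto
        finally show ?thesis .
      qed
      moreover have "\<bar>I2 (E (v1 - v2)) (c x)\<bar> \<le> norm (v1 - v2) / 4 * exp (N * (c x - s))"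
        by (rule I2_bound[OF cE E_le]) (use c_mem in auto)
      ultimately have "exp (- N * (c x - s)) * \<bar>I2 (E v1) (c x) - I2 (E v2) (c x)\<bar>
          \<le> exp (- N * (c x - s)) * (norm (v1 - v2) / 4 * exp (N * (c x - s)))"
        by (intro mult_left_mono) auto
      also have "\<dots> = 1 / 4 * dist v1 v2" by (simp add: mult_ac exp_minus dist_norm)
      finally show "dist (apply_bcontfun (TT v1) x) (apply_bcontfun (TT v2) x) \<le> 1 / 4 * dist v1 v2"
        unfolding TT_apply T_def dist_real_def by (simp add: abs_mult flip: right_diff_distrib)
    qed
  qed (auto simp: complete_UNIV)
  then obtain v where v: "TT v = v" by auto
  define w where "w = E v"
  have w: "w x = 1 + I2 w x" if "x \<in> {s..e}" for x
  proof -
    have "apply_bcontfun v x = T v x" using TT_apply[of v] v by simp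
    then show ?thesis using c_id[OF that] by (simp add: w_def E_def T_def exp_minus)
  qed
  have cw: "continuous_on {s..e} w" unfolding w_def by (rule cE)
  show ?thesis
  proof (rule that[of w "I1 w"])
    fix x assume x: "x \<in> {s..e}"
    have "((\<lambda>x. 1 + I2 w x) has_real_derivative I1 w x) (at x within {s..e})"
      unfolding I2_def
      using integral_has_real_derivative[OF cI1[OF cw] x] by (auto intro!: derivative_eq_intros)
    then show "(w has_real_derivative I1 w x) (at x within {s..e})"
      by (rule has_field_derivative_transform_within[where d = 1]) (use x w in auto)
  next
    show "w s = 1" using w[of s] se by (simp add: I2_def)
  qed (auto simp: I1_def cw)
qed

text \<open>Two monotone quantities. Since (w w')' = w'^2 + V w^2 is nonnegative and w w' starts at
  0, w^2 never falls below 1 and w cannot change sign. Then exp (M t) (w' - M w) has derivative exp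
  (M t) (V - M^2) w, which is not positive, and it starts below 0. This is the Riccati comparison of
  w' / w with the constant solution \<open>M\<close> for the potential
  \<open>M\<^sup>2\<close>.\<close>

lemma positive_solution_bounds:
  fixes V :: "real \<Rightarrow> real"
  assumes se: "s \<le> e" and V: "V \<in> borel_measurable lebesgue" and M: "M > 0"
    and Vb: "\<And>x. x \<in> {s..e} \<Longrightarrow> 0 \<le> V x" "\<And>x. x \<in> {s..e} \<Longrightarrow> V x \<le> M\<^sup>2"
    and dw: "\<And>x. x \<in> {s..e} \<Longrightarrow> (w has_real_derivative w' x) (at x within {s..e})"
    and w': "\<And>x. x \<in> {s..e} \<Longrightarrow> w' x = integral {s..x} (\<lambda>t. V t * w t)"
    and cw: "continuous_on {s..e} w" and ws: "w s = 1" and x: "x \<in> {s..e}"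
  shows "w x > 0" "0 \<le> w' x" "w' x \<le> M * w x"
proof -
  obtain A where A: "\<And>x. x \<in> {s..e} \<Longrightarrow> \<bar>w x\<bar> \<le> A"
  proof -
    have "compact (w ` {s..e})" by (intro compact_continuous_image cw) auto
    then obtain A where "A > 0" "\<forall>x\<in>w ` {s..e}. norm x \<le> A" using compact_imp_bounded bounded_pos by metis
    then show ?thesis using that[of A] by auto
  qed
  have k_le: "\<bar>V t * w t\<bar> \<le> M\<^sup>2 * A" if "t \<in> {s..e}" for t
    unfolding abs_mult using Vb[OF that] A[OF that] by (intro mult_mono) auto
  have int: "(\<lambda>t. V t * w t) integrable_on {s..e}"
  proof -
    have "bounded (V ` {s..e})" unfolding bounded_iff using Vb by (intro exI[of _ "M\<^sup>2"]) auto
    then have "(\<lambda>t. V t * w t) absolutely_integrable_on {s..e}"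
      using V cw by (intro absolutely_integrable_bounded_measurable_product_real measurable_restrict_space1 absolutely_integrable_continuous_real) auto
    then show ?thesis by (rule set_lebesgue_integral_eq_integral(1))
  qed
  have w's: "w' s = 0" using w'[of s] se by simp
  have cw': "continuous_on {s..e} w'"
    using indefinite_integral_continuous_1[OF int] by (rule continuous_on_eq) (simp add: w')
  have ww': "w y * w' y \<ge> 0" if y: "y \<in> {s..e}" for y
  proof -
    have "((\<lambda>t. w' t * w' t + w t * (V t * w t)) has_integral (w y * w' y - w s * w' s)) {s..y}"
    proof (rule integration_by_parts_bounded[where C = "M\<^sup>2 * A"])
      show "w' t = w' s + integral {s..t} (\<lambda>t. V t * w t)" if "t \<in> {s..y}" for t
        using w'[of t] w's that y by simp
      show "(w has_real_derivative w' t) (at t within {s..y})" if "t \<in> {s..y}" for t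
        by (rule DERIV_subset[OF dw]) (use that y in auto)
    qed (use y k_le in \<open>auto intro!: continuous_on_subset[OF cw'] integrable_on_subinterval[OF int]\<close>)
    then have "0 \<le> w y * w' y - w s * w' s"
    proof (rule has_integral_nonneg)
      fix t assume "t \<in> {s..y}"
      then have Vw: "0 \<le> V t * (w t * w t)"
        using mult_nonneg_nonneg[OF Vb(1)[of t] zero_le_square[of "w t"]] y by simp
      have e: "w' t * w' t + w t * (V t * w t) = w' t * w' t + V t * (w t * w t)" by (simp add: algebra_simps)
      show "0 \<le> w' t * w' t + w t * (V t * w t)" unfolding e by (rule add_nonneg_nonneg[OF zero_le_square Vw])
    qed
    then show ?thesis using w's by simp
  qed
  have w2: "(w y)\<^sup>2 \<ge> 1" if y: "y \<in> {s..e}" for y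
  proof -
    have "((\<lambda>t. 2 * (w t * w' t)) has_integral (w y)\<^sup>2 - (w s)\<^sup>2) {s..y}"
      by (rule fundamental_theorem_of_calculus)
         (use y in \<open>auto intro!: derivative_eq_intros DERIV_subset[OF dw] simp flip: has_real_derivative_iff_has_vector_derivative\<close>)
    then have "0 \<le> (w y)\<^sup>2 - (w s)\<^sup>2" by (rule has_integral_nonneg) (use ww' y in auto)
    then show ?thesis using ws by simp
  qed
  have pos: "w y > 0" if y: "y \<in> {s..e}" for y
  proof (rule ccontr)
    assume "\<not> w y > 0"
    then obtain z where "s \<le> z" "z \<le> y" "w z = 0"
      using IVT2'[of w y 0 s] ws y continuous_on_subset[OF cw, of "{s..y}"] by auto
    then show False using w2[of z] y by simp
  qed
  show "w x > 0" by (rule pos[OF x])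
  then show "0 \<le> w' x" using ww'[OF x] by (simp add: zero_le_mult_iff)
    obtain B where B: "\<And>x. x \<in> {s..e} \<Longrightarrow> \<bar>w' x\<bar> \<le> B"
    proof -
      have "compact (w' ` {s..e})" by (intro compact_continuous_image cw') auto
      then obtain A where "A > 0" "\<forall>x\<in>w' ` {s..e}. norm x \<le> A" using compact_imp_bounded bounded_pos by metis
      then show ?thesis using that[of A] by auto
    qed
  have "((\<lambda>t. (M * exp (M * t)) * (w' t - M * w t) + exp (M * t) * (V t * w t - M * w' t)) has_integral
     (exp (M * x) * (w' x - M * w x) - exp (M * s) * (w' s - M * w s))) {s..x}"
  proof (rule integration_by_parts_bounded[where C = "M\<^sup>2 * A + M * B"])
    have iw': "(\<lambda>t. M * w' t) integrable_on {s..y}" if "y \<in> {s..e}" for y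
      using that by (intro integrable_continuous_interval continuous_intros continuous_on_subset[OF cw']) auto
    show "(\<lambda>t. V t * w t - M * w' t) integrable_on {s..x}"
      using x by (intro integrable_diff iw' integrable_on_subinterval[OF int]) auto
    show "\<bar>V t * w t - M * w' t\<bar> \<le> M\<^sup>2 * A + M * B" if "t \<in> {s..x}" for t
    proof -
      have "\<bar>M * w' t\<bar> \<le> M * B" using mult_left_mono[OF B[of t], of M] that x M by (simp add: abs_mult)
      then show ?thesis using k_le[of t] that x abs_triangle_ineq4[of "V t * w t" "M * w' t"] by simp
    qed
    show "w' y - M * w y = (w' s - M * w s) + integral {s..y} (\<lambda>t. V t * w t - M * w' t)" if y: "y \<in> {s..x}" for y
    proof -
      have ye: "y \<in> {s..e}" using x y by auto
      have "((\<lambda>t. w' t) has_integral w y - w s) {s..y}"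
        by (rule fundamental_theorem_of_calculus)
           (use ye in \<open>auto intro!: DERIV_subset[OF dw] simp flip: has_real_derivative_iff_has_vector_derivative\<close>)
      then have "((\<lambda>t. V t * w t - M * w' t) has_integral w' y - M * (w y - w s)) {s..y}"
        using ye unfolding w'[OF ye]
        by (intro has_integral_diff has_integral_mult_right integrable_integral integrable_on_subinterval[OF int]) auto
      then show ?thesis using w's by (simp add: integral_unique algebra_simps)
    qed
  qed (use x in \<open>auto intro!: derivative_eq_intros continuous_intros\<close>)
  then have "0 \<le> - (exp (M * x) * (w' x - M * w x) - exp (M * s) * (w' s - M * w s))"
  proof (rule has_integral_nonneg[OF has_integral_neg])
    fix t assume t: "t \<in> {s..x}"
    have "(M * exp (M * t)) * (w' t - M * w t) + exp (M * t) * (V t * w t - M * w' t) = exp (M * t) * ((V t - M\<^sup>2) * w t)"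
      by (simp add: algebra_simps power2_eq_square)
    also have "\<dots> \<le> 0"
      using Vb(2)[of t] pos[of t] t x by (auto simp: mult_le_0_iff)
    finally show "0 \<le> - ((M * exp (M * t)) * (w' t - M * w t) + exp (M * t) * (V t * w t - M * w' t))" by simp
  qed
  moreover have "exp (M * s) * (w' s - M * w s) \<le> 0" using w's ws M by (simp add: mult_le_0_iff)
  ultimately have "exp (M * x) * (w' x - M * w x) \<le> 0" by linarith
  then show "w' x \<le> M * w x" by (simp add: mult_le_0_iff)
qed

section \<open>Analysis in the plane, up to the similarity principle\<close>

section \<open>Integrability of the Cauchy kernel\<close>

lemma nn_integral_inverse_sqrt_abs:
  assumes "b \<ge> 0"
  shows "(\<integral>\<^sup>+x. ennreal (indicator {-b..b} x * \<bar>x::real\<bar> powr (-1/2)) \<partial>lborel) < \<infinity>"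
proof -
  have 1: "((\<lambda>x. \<bar>x\<bar> powr (-1/2)) has_integral b powr (1/2) / (1/2)) {0..b}"
    using has_integral_powr_from_0[of "-1/2" b] assms
    by (subst has_integral_cong[where g = "\<lambda>x. x powr (-1/2)"]) auto
  have 2: "((\<lambda>x. \<bar>x\<bar> powr (-1/2)) has_integral b powr (1/2) / (1/2)) {-b..0}"
    using 1 has_integral_reflect_real[of "\<lambda>x. \<bar>x\<bar> powr (-1/2)" "b powr (1/2) / (1/2)" b 0] by simp
  have 3: "((\<lambda>x. \<bar>x\<bar> powr (-1/2)) has_integral b powr (1/2) / (1/2) + b powr (1/2) / (1/2)) {-b..b}"
    by (rule has_integral_combine[OF _ _ 2 1]) (use assms in auto)
  have "(\<integral>\<^sup>+x. ennreal (indicator {-b..b} x * \<bar>x::real\<bar> powr (-1/2)) \<partial>lborel)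
     = ennreal (b powr (1/2) / (1/2) + b powr (1/2) / (1/2))"
    by (rule nn_integral_has_integral_lebesgue[OF _ 3]) auto
  then show ?thesis by simp
qed

text \<open>By the inequality of arithmetic and geometric means the planar singularity splits into a
  product of integrable one-dimensional ones, so that Fubini can replace polar coordinates.\<close>

lemma inverse_norm_pair_le:
  "inverse (norm (x::real, y::real)) \<le> \<bar>x\<bar> powr (-1/2) * \<bar>y\<bar> powr (-1/2)"
  if "x \<noteq> 0" "y \<noteq> 0"
proof -
  have "\<bar>x\<bar> * \<bar>y\<bar> \<le> x\<^sup>2 + y\<^sup>2"
  proof -
    have "2 * (\<bar>x\<bar> * \<bar>y\<bar>) \<le> \<bar>x\<bar>\<^sup>2 + \<bar>y\<bar>\<^sup>2"
      using sum_squares_bound[of "\<bar>x\<bar>" "\<bar>y\<bar>"] by simp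
    moreover have "0 \<le> \<bar>x\<bar> * \<bar>y\<bar>" by simp
    ultimately show ?thesis unfolding power2_abs by linarith
  qed
  then have "sqrt (\<bar>x\<bar> * \<bar>y\<bar>) \<le> norm (x,y)"
    by (simp add: norm_Pair)
  moreover have "sqrt (\<bar>x\<bar> * \<bar>y\<bar>) > 0" using that by simp
  ultimately have "inverse (norm (x,y)) \<le> inverse (sqrt (\<bar>x\<bar> * \<bar>y\<bar>))"
    by (intro le_imp_inverse_le) auto
  also have "\<dots> = \<bar>x\<bar> powr (-1/2) * \<bar>y\<bar> powr (-1/2)"
    using that by (simp add: real_sqrt_mult powr_minus powr_half_sqrt)
  finally show ?thesis .
qed

lemma integrable_inverse_norm:
  fixes S :: "(real \<times> real) set"
  assumes "bounded S" "S \<in> sets borel"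
  shows "integrable lborel (\<lambda>u. indicator S u * inverse (norm u) :: real)"
proof -
  obtain b where b: "\<And>u. u \<in> S \<Longrightarrow> norm u \<le> b" "b > 0"
    using assms(1) by (metis bounded_pos)
  define F where "F x = ennreal (indicator {-b..b} x * \<bar>x\<bar> powr (-1/2))" for x :: real
  have Fm [measurable]: "F \<in> borel_measurable borel" unfolding F_def by measurable
  \<comment> \<open>\<open>0 powr (-1/2)\<close> is 0, so the product bound fails on the two
    coordinate axes; these are null.\<close>
  have AEx: "AE u in lborel. fst u \<noteq> (0::real) \<and> snd u \<noteq> (0::real)"
  proof -
    have "AE x in lborel. AE y in lborel. fst (x,y) \<noteq> (0::real) \<and> snd (x,y) \<noteq> (0::real)"
      using AE_lborel_singleton[of "0::real"] by (auto elim: eventually_mono)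
    moreover have "{u \<in> space (lborel \<Otimes>\<^sub>M lborel). fst u \<noteq> (0::real) \<and> snd u \<noteq> (0::real)} \<in> sets (lborel \<Otimes>\<^sub>M lborel)"
      by measurable
    ultimately have "AE u in lborel \<Otimes>\<^sub>M lborel. fst u \<noteq> (0::real) \<and> snd u \<noteq> (0::real)"
      by (subst lborel_pair.AE_pair_iff[symmetric]) auto
    then show ?thesis unfolding lborel_prod by simp
  qed
  have "(\<integral>\<^sup>+u. ennreal (norm (indicator S u * inverse (norm u) :: real)) \<partial>lborel)
      \<le> (\<integral>\<^sup>+u. F (fst u) * F (snd u) \<partial>lborel)"
  proof (rule nn_integral_mono_AE, use AEx in eventually_elim)
    fix u :: "real \<times> real"
    assume u: "fst u \<noteq> 0 \<and> snd u \<noteq> 0"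
    show "ennreal (norm (indicator S u * inverse (norm u) :: real)) \<le> F (fst u) * F (snd u)"
    proof (cases "u \<in> S")
      case True
      have "fst u \<in> {-b..b}" "snd u \<in> {-b..b}"
        using b(1)[OF True] norm_fst_le[of "fst u" "snd u"] norm_snd_le[of "snd u" "fst u"] by auto
      then have "F (fst u) * F (snd u) = ennreal (\<bar>fst u\<bar> powr (-1/2) * \<bar>snd u\<bar> powr (-1/2))"
        by (simp add: F_def ennreal_mult)
      then show ?thesis using True u inverse_norm_pair_le[of "fst u" "snd u"]
        by (auto intro!: ennreal_leI)
    qed auto
  qed
  also have "\<dots> = (\<integral>\<^sup>+x. \<integral>\<^sup>+y. F x * F y \<partial>lborel \<partial>lborel)"
    unfolding lborel_prod[symmetric]
    by (subst lborel.nn_integral_fst[symmetric]) auto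
  also have "\<dots> = (\<integral>\<^sup>+x. F x \<partial>lborel) * (\<integral>\<^sup>+x. F x \<partial>lborel)"
    by (simp add: nn_integral_cmult nn_integral_multc)
  also have "\<dots> < \<infinity>"
    using nn_integral_inverse_sqrt_abs[of b] b(2) by (auto simp: F_def ennreal_mult_less_top)
  finally have fin: "(\<integral>\<^sup>+u. ennreal (norm (indicator S u * inverse (norm u) :: real)) \<partial>lborel) < \<infinity>" .
  show ?thesis
    by (rule integrableI_bounded[OF _ fin]) (use assms(2) in measurable)
qed

text \<open>The denominator dominates (1 + x^2)(1 + y^2), and 1 / (1 + x^2) is integrable on the
  line. The function is the profile of the approximate identity that arises from the regularised
  Cauchy kernel.\<close>

lemma integrable_smoothing_kernel:
  "integrable lborel (\<lambda>u::real \<times> real. 1 / (1 + (norm u)\<^sup>2)\<^sup>2)"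
proof -
  define F :: "real \<Rightarrow> real" where "F x = inverse (1 + x\<^sup>2)" for x
  have I: "integrable lborel F"
    using integrable_inverse_1_plus_square by (simp add: set_integrable_def F_def[abs_def])
  have F0: "F x \<ge> 0" for x by (simp add: F_def)
  have Fm: "F \<in> borel_measurable borel" unfolding F_def[abs_def] by measurable
  have "integrable (lborel \<Otimes>\<^sub>M lborel) (\<lambda>(x, y). F x * F y)"
  proof (rule lborel_pair.Fubini_integrable)
    show "(\<lambda>(x, y). F x * F y) \<in> borel_measurable (lborel \<Otimes>\<^sub>M lborel)"
      using Fm by simp
    show "integrable lborel (\<lambda>x. LINT y|lborel. norm (case (x, y) of (x, y) \<Rightarrow> F x * F y))"
      using I F0 by simp
    show "AE x in lborel. integrable lborel (\<lambda>y. case (x, y) of (x, y) \<Rightarrow> F x * F y)"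
      using I by simp
  qed
  then have 1: "integrable lborel (\<lambda>u. F (fst u) * F (snd u))"
    by (simp add: lborel_prod case_prod_beta')
  show ?thesis
  proof (rule Bochner_Integration.integrable_bound[OF 1])
    show "AE u::real\<times>real in lborel. norm (1 / (1 + (norm u)\<^sup>2)\<^sup>2) \<le> norm (F (fst u) * F (snd u))"
    proof (rule AE_I2)
      fix u :: "real \<times> real"
      obtain x y where u: "u = (x, y)" by force
      have "(1 + x\<^sup>2) * (1 + y\<^sup>2) \<le> (1 + (x\<^sup>2 + y\<^sup>2)) * (1 + (x\<^sup>2 + y\<^sup>2))"
        by (rule mult_mono) auto
      then have "1 / (1 + (x\<^sup>2 + y\<^sup>2))\<^sup>2 \<le> 1 / ((1 + x\<^sup>2) * (1 + y\<^sup>2))"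
        by (intro divide_left_mono mult_pos_pos)
           (auto simp: power2_eq_square add_pos_nonneg)
      then show "norm (1 / (1 + (norm u)\<^sup>2)\<^sup>2) \<le> norm (F (fst u) * F (snd u))"
        by (simp add: u norm_Pair F_def abs_mult field_simps)
    qed
  qed measurable
qed

lemma smoothing_kernel_mass_pos:
  "(LINT u::real \<times> real|lborel. 1 / (1 + (norm u)\<^sup>2)\<^sup>2) > 0"
proof -
  have "(LINT u::real \<times> real|lborel. 1 / (1 + (norm u)\<^sup>2)\<^sup>2) \<noteq> 0"
  proof
    assume "(LINT u::real \<times> real|lborel. 1 / (1 + (norm u)\<^sup>2)\<^sup>2) = 0"
    then have "AE u::real \<times> real in lborel. 1 / (1 + (norm u)\<^sup>2)\<^sup>2 = 0"
      by (subst (asm) integral_nonneg_eq_0_iff_AE[OF integrable_smoothing_kernel]) auto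
    then have "AE u::real \<times> real in lborel. False"
    proof eventually_elim
      case (elim u)
      then show ?case using zero_le_power2[of "norm u"] by simp
    qed
    then show False by (simp add: AE_iff_null emeasure_lborel_UNIV null_sets_def)
  qed
  moreover have "(LINT u::real \<times> real|lborel. 1 / (1 + (norm u)\<^sup>2)\<^sup>2) \<ge> 0"
    by (intro Bochner_Integration.integral_nonneg) auto
  ultimately show ?thesis by linarith
qed

section \<open>Convolution with bounded functions of bounded support\<close>

lemma has_vector_derivative_at_0_iff:
  fixes f :: "real \<Rightarrow> 'a::real_normed_vector"
  shows "(f has_vector_derivative D) (at 0) \<longleftrightarrow> ((\<lambda>h. (f h - f 0) /\<^sub>R h) \<longlongrightarrow> D) (at 0)"
proof -
  have eq: "norm (f h - f 0 - h *\<^sub>R D) / \<bar>h\<bar> = norm ((f h - f 0) /\<^sub>R h - D)" if "h \<noteq> 0" for h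
  proof -
    have "(f h - f 0) /\<^sub>R h - D = (f h - f 0 - h *\<^sub>R D) /\<^sub>R h"
      using that by (simp add: scaleR_diff_right)
    then show ?thesis by (simp add: divide_inverse mult.commute)
  qed
  have "((\<lambda>h. norm (f h - f 0 - h *\<^sub>R D) / \<bar>h\<bar>) \<longlongrightarrow> 0) (at 0)
      \<longleftrightarrow> ((\<lambda>h. norm ((f h - f 0) /\<^sub>R h - D)) \<longlongrightarrow> 0) (at 0)"
    by (rule filterlim_cong) (auto simp: eventually_at_filter eq)
  then show ?thesis
    by (simp add: has_vector_derivative_def has_derivative_at bounded_linear_scaleR_left
        tendsto_norm_zero_iff LIM_zero_iff)
qed

text \<open>The plane is \<open>real \<times> real\<close> so that Lebesgue measure is a product
  measure, partial derivatives are directional, and rectangles are boxes.\<close>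

definition plane_conv :: "(real \<times> real \<Rightarrow> complex) \<Rightarrow> (real \<times> real \<Rightarrow> complex) \<Rightarrow> real \<times> real \<Rightarrow> complex" where
  "plane_conv g k z = (LINT \<zeta>|lborel. g \<zeta> * k (z - \<zeta>))"

text \<open>A multiple of the indicator of \<open>S\<close> is the dominating function whenever the
  kernels are uniformly bounded. \<open>g\<close> is merely measurable because the coefficient in
  the application is set to 0 at the zeros of the extension and may jump there.\<close>

locale bounded_support =
  fixes g :: "real \<times> real \<Rightarrow> complex" and m :: real and S :: "(real \<times> real) set"
  assumes g_meas [measurable]: "g \<in> borel_measurable borel"
    and g_bound: "\<And>\<zeta>. norm (g \<zeta>) \<le> m"
    and g_supp: "\<And>\<zeta>. \<zeta> \<notin> S \<Longrightarrow> g \<zeta> = 0"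
    and S_bounded: "bounded S" and S_meas [measurable]: "S \<in> sets borel"
begin

lemma m_nonneg: "m \<ge> 0"
  using g_bound[of undefined] norm_ge_zero order_trans by blast

lemma g_le: "norm (g \<zeta>) \<le> m * indicator S \<zeta>"
  using g_bound[of \<zeta>] g_supp[of \<zeta>] by (auto simp: indicator_def)

lemma integrable_dom: "integrable lborel (\<lambda>\<zeta>. C * indicator S \<zeta> :: real)"
  using emeasure_bounded_finite[OF S_bounded]
  by (intro integrable_mult_right) (auto simp: integrable_indicator_iff less_top)

lemma norm_mult_le:
  assumes "norm c \<le> C"
  shows "norm (g \<zeta> * c) \<le> m * C * indicator S \<zeta>"
proof -
  have "norm (g \<zeta>) * norm c \<le> (m * indicator S \<zeta>) * C"
    by (rule mult_mono[OF g_le assms]) (use m_nonneg in \<open>auto simp: indicator_def\<close>)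
  then show ?thesis by (simp add: norm_mult mult_ac)
qed

lemma conv_tendsto:
  assumes [measurable]: "k \<in> borel_measurable borel" "\<And>n. kk n \<in> borel_measurable borel"
    and b: "\<And>n u. norm (kk n u) \<le> C" and lim: "\<And>u. (\<lambda>n. kk n u) \<longlonglongrightarrow> k u"
  shows "(\<lambda>n. plane_conv g (kk n) z) \<longlonglongrightarrow> plane_conv g k z"
  unfolding plane_conv_def
proof (rule integral_dominated_convergence[where w = "\<lambda>\<zeta>. m * C * indicator S \<zeta>"])
  show "AE x in lborel. (\<lambda>i. g x * kk i (z - x)) \<longlonglongrightarrow> g x * k (z - x)"
    by (intro AE_I2 tendsto_mult tendsto_const lim)
  show "AE x in lborel. norm (g x * kk i (z - x)) \<le> m * C * indicator S x" for i
    by (intro AE_I2 norm_mult_le b)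
  show "integrable lborel (\<lambda>x. m * C * indicator S x :: real)" by (rule integrable_dom)
qed measurable

lemma conv_integrable:
  assumes [measurable]: "k \<in> borel_measurable borel" and b: "\<And>u. norm (k u) \<le> C"
  shows "integrable lborel (\<lambda>\<zeta>. g \<zeta> * k (z - \<zeta>))"
proof (rule Bochner_Integration.integrable_bound[OF integrable_dom[of "m * C"]])
  show "AE x in lborel. norm (g x * k (z - x)) \<le> norm (m * C * indicator S x)"
    by (intro AE_I2 order_trans[OF norm_mult_le[OF b]]) simp
qed measurable

lemma conv_continuous:
  assumes k: "continuous_on UNIV k" and b: "\<And>u. norm (k u) \<le> C"
  shows "continuous_on UNIV (plane_conv g k)"
proof -
  have [measurable]: "k \<in> borel_measurable borel"
    by (rule borel_measurable_continuous_onI[OF k])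
  have "(\<lambda>n. plane_conv g k (x n)) \<longlonglongrightarrow> plane_conv g k a" if "x \<longlonglongrightarrow> a" for x a
  proof -
    \<comment> \<open>The shift of the argument is moved onto the kernel, where continuity is
      available.\<close>
    have 1: "(\<lambda>n. plane_conv g (\<lambda>u. k (u + (x n - a))) a) \<longlonglongrightarrow> plane_conv g k a"
    proof (rule conv_tendsto[where C = C])
      show "(\<lambda>n. k (u + (x n - a))) \<longlonglongrightarrow> k u" for u
      proof -
        have "(\<lambda>n. u + (x n - a)) \<longlonglongrightarrow> u + (a - a)" by (intro tendsto_intros that)
        then show ?thesis
          using continuous_on_tendsto_compose[OF k, of "\<lambda>n. u + (x n - a)" u sequentially] by simp
      qed
    qed (use b in \<open>auto\<close>)
    have 2: "plane_conv g (\<lambda>u. k (u + (x n - a))) a = plane_conv g k (x n)" for n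
      by (simp add: plane_conv_def algebra_simps)
    show ?thesis using 1 by (simp add: 2)
  qed
  then show ?thesis by (auto simp: continuous_on_sequentially o_def)
qed

text \<open>The derivative falls on the kernel, the only differentiable factor. The mean value
  inequality bounds all difference quotients by \<open>C'\<close>, which is what dominated
  convergence asks for.\<close>

lemma conv_has_derivative:
  assumes k: "continuous_on UNIV k" and b: "\<And>u. norm (k u) \<le> C"
    and k': "continuous_on UNIV k'" and b': "\<And>u. norm (k' u) \<le> C'"
    and d: "\<And>u. ((\<lambda>s. k (u + s *\<^sub>R e)) has_vector_derivative k' u) (at 0)"
  shows "((\<lambda>s. plane_conv g k (z + s *\<^sub>R e)) has_vector_derivative plane_conv g k' z) (at 0)"
proof -
  have [measurable]: "k \<in> borel_measurable borel" "k' \<in> borel_measurable borel"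
    by (auto intro!: borel_measurable_continuous_onI k k')
  have d': "((\<lambda>s. k (u + s *\<^sub>R e)) has_vector_derivative k' (u + t *\<^sub>R e)) (at t)" for u t
  proof -
    have "((\<lambda>s. k ((u + t *\<^sub>R e) + s *\<^sub>R e)) has_vector_derivative k' (u + t *\<^sub>R e)) (at (t - t))"
      using d[of "u + t *\<^sub>R e"] by simp
    then have "(((\<lambda>s. k ((u + t *\<^sub>R e) + s *\<^sub>R e)) \<circ> (\<lambda>s. s - t)) has_vector_derivative 1 *\<^sub>R k' (u + t *\<^sub>R e)) (at t)"
      by (intro vector_diff_chain_at) (auto intro!: derivative_eq_intros)
    then show ?thesis by (simp add: o_def algebra_simps)
  qed
  have lip: "norm (k (u + s *\<^sub>R e) - k u) \<le> C' * \<bar>s\<bar>" for u s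
  proof -
    have "C' \<ge> 0" using b' order_trans[OF norm_ge_zero] by blast
    then have o: "onorm (\<lambda>h. h *\<^sub>R k' v) \<le> C'" for v
      by (intro onorm_bound) (use b'[of v] in \<open>auto simp: mult.commute[of C'] intro!: mult_left_mono\<close>)
    have "norm (k (u + s *\<^sub>R e) - k (u + 0 *\<^sub>R e)) \<le> C' * norm (s - 0)"
      by (rule differentiable_bound[where S = UNIV and f' = "\<lambda>t h. h *\<^sub>R k' (u + t *\<^sub>R e)"])
         (use d'[of u] o in \<open>simp_all add: has_vector_derivative_def\<close>)
    then show ?thesis by simp
  qed
  have "(\<lambda>n. (plane_conv g k (z + x n *\<^sub>R e) - plane_conv g k z) /\<^sub>R x n) \<longlonglongrightarrow> plane_conv g k' z"
    if x: "x \<longlonglongrightarrow> 0" "\<And>n. x n \<noteq> 0" for x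
  proof -
    define kk where "kk n u = (k (u + x n *\<^sub>R e) - k u) /\<^sub>R x n" for n u
    have 1: "(\<lambda>n. plane_conv g (kk n) z) \<longlonglongrightarrow> plane_conv g k' z"
    proof (rule conv_tendsto[where C = C'])
      show "kk n \<in> borel_measurable borel" for n unfolding kk_def by measurable
      show "norm (kk n u) \<le> C'" for n u
        using lip[of u "x n"] x(2)[of n] by (simp add: kk_def divide_simps mult_ac)
      show "(\<lambda>n. kk n u) \<longlonglongrightarrow> k' u" for u
      proof -
        have "((\<lambda>h. (k (u + h *\<^sub>R e) - k u) /\<^sub>R h) \<longlongrightarrow> k' u) (at 0)"
          using d[of u] unfolding has_vector_derivative_at_0_iff by simp
        then show ?thesis
          unfolding kk_def using x by (auto simp: tendsto_at_iff_sequentially o_def)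
      qed
    qed measurable
    have 2: "plane_conv g (kk n) z = (plane_conv g k (z + x n *\<^sub>R e) - plane_conv g k z) /\<^sub>R x n" for n
    proof -
      have "plane_conv g k (z + x n *\<^sub>R e) - plane_conv g k z
          = (LINT \<zeta>|lborel. g \<zeta> * k (z + x n *\<^sub>R e - \<zeta>) - g \<zeta> * k (z - \<zeta>))"
        unfolding plane_conv_def
        by (intro Bochner_Integration.integral_diff[symmetric] conv_integrable[where C = C] b) measurable
      also have "\<dots> /\<^sub>R x n = (LINT \<zeta>|lborel. (g \<zeta> * k (z + x n *\<^sub>R e - \<zeta>) - g \<zeta> * k (z - \<zeta>)) /\<^sub>R x n)"
        by simp
      also have "\<dots> = plane_conv g (kk n) z"
        unfolding plane_conv_def kk_def
        by (intro Bochner_Integration.integral_cong) (auto simp: algebra_simps)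
      finally show ?thesis by simp
    qed
    show ?thesis using 1 by (simp add: 2)
  qed
  then have "((\<lambda>h. (plane_conv g k (z + h *\<^sub>R e) - plane_conv g k z) /\<^sub>R h) \<longlongrightarrow> plane_conv g k' z) (at 0)"
    by (auto simp: tendsto_at_iff_sequentially o_def)
  then show ?thesis
    by (simp add: has_vector_derivative_at_0_iff)
qed

end

lemma lborel_integral_affine_plane:
  fixes f :: "real \<times> real \<Rightarrow> 'b::{banach, second_countable_topology}"
  assumes [measurable]: "f \<in> borel_measurable borel" and c: "c \<noteq> 0"
  shows "(LINT u|lborel. f u) = (LINT u|lborel. c\<^sup>2 *\<^sub>R f (t + c *\<^sub>R u))"
proof -
  have "(LINT u|lborel. f u) = (LINT u|density (distr lborel borel (\<lambda>x. t + c *\<^sub>R x)) (\<lambda>_. ennreal (c\<^sup>2)). f u)"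
    using lborel_affine[OF c, of t] by (simp add: power2_eq_square)
  also have "\<dots> = (LINT u|distr lborel borel (\<lambda>x. t + c *\<^sub>R x). c\<^sup>2 *\<^sub>R f u)"
    by (rule integral_density) auto
  also have "\<dots> = (LINT u|lborel. c\<^sup>2 *\<^sub>R f (t + c *\<^sub>R u))"
    by (rule integral_distr) auto
  finally show ?thesis .
qed

lemma lborel_integral_reflect_plane:
  fixes f :: "real \<times> real \<Rightarrow> 'b::{banach, second_countable_topology}"
  assumes [measurable]: "f \<in> borel_measurable borel"
  shows "(LINT u|lborel. f (z - u)) = (LINT u|lborel. f u)"
  using lborel_integral_affine_plane[OF assms, of "-1" z] by simp

section \<open>The regularised Cauchy kernel\<close>

definition cz :: "real \<times> real \<Rightarrow> complex" where "cz u = Complex (fst u) (snd u)"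

text \<open>A smooth regularisation of the Cauchy kernel: since cnj u / |u|^2 = 1 / u, the case
  \<open>\<tau> = 0\<close> is the kernel itself, with value 0 at the origin.\<close>

definition ckernel :: "real \<Rightarrow> real \<times> real \<Rightarrow> complex" where
  "ckernel \<tau> u = cnj (cz u) /\<^sub>R ((norm u)\<^sup>2 + \<tau>\<^sup>2)"

definition ckernel_x :: "real \<Rightarrow> real \<times> real \<Rightarrow> complex" where
  "ckernel_x \<tau> u = 1 /\<^sub>R ((norm u)\<^sup>2 + \<tau>\<^sup>2) - (2 * fst u / ((norm u)\<^sup>2 + \<tau>\<^sup>2)\<^sup>2) *\<^sub>R cnj (cz u)"

definition ckernel_y :: "real \<Rightarrow> real \<times> real \<Rightarrow> complex" where
  "ckernel_y \<tau> u = (- \<i>) /\<^sub>R ((norm u)\<^sup>2 + \<tau>\<^sup>2) - (2 * snd u / ((norm u)\<^sup>2 + \<tau>\<^sup>2)\<^sup>2) *\<^sub>R cnj (cz u)"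

lemma norm_cz [simp]: "norm (cz u) = norm u"
  by (simp add: cz_def cmod_def norm_prod_def)

lemma norm_pair_power2: "(norm u)\<^sup>2 = (fst u)\<^sup>2 + (snd u)\<^sup>2" for u :: "real \<times> real"
  by (simp add: norm_prod_def)

lemma continuous_on_cz [continuous_intros]:
  "continuous_on S f \<Longrightarrow> continuous_on S (\<lambda>x. cz (f x))"
  unfolding cz_def Complex_eq by (intro continuous_intros)

lemma denominator_pos: "\<tau> \<noteq> 0 \<Longrightarrow> (norm (u :: real \<times> real))\<^sup>2 + \<tau>\<^sup>2 > 0"
  by (simp add: add_nonneg_pos)

lemma continuous_ckernels:
  assumes "\<tau> > 0"
  shows "continuous_on UNIV (ckernel \<tau>)" "continuous_on UNIV (ckernel_x \<tau>)" "continuous_on UNIV (ckernel_y \<tau>)"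
proof -
  have ne: "(norm u)\<^sup>2 + \<tau>\<^sup>2 \<noteq> 0" for u :: "real \<times> real"
    using denominator_pos[of \<tau> u] assms by simp
  show "continuous_on UNIV (ckernel \<tau>)"
    unfolding ckernel_def[abs_def] using ne by (intro continuous_intros) auto
  show "continuous_on UNIV (ckernel_x \<tau>)"
    unfolding ckernel_x_def[abs_def] using ne by (intro continuous_intros) auto
  show "continuous_on UNIV (ckernel_y \<tau>)"
    unfolding ckernel_y_def[abs_def] using ne by (intro continuous_intros) auto
qed

lemma borel_ckernel [measurable]: "ckernel \<tau> \<in> borel_measurable borel"
proof -
  have [measurable]: "(\<lambda>u. cnj (cz u)) \<in> borel_measurable borel"
    by (intro borel_measurable_continuous_onI continuous_intros)
  show ?thesis unfolding ckernel_def[abs_def] by measurable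
qed

lemma norm_ckernel_le:
  assumes "\<tau> > 0" shows "norm (ckernel \<tau> u) \<le> 1 / \<tau>"
proof -
  have "2 * (norm u * \<tau>) \<le> (norm u)\<^sup>2 + \<tau>\<^sup>2"
    using sum_squares_bound[of "norm u" \<tau>] by simp
  moreover have "0 \<le> norm u * \<tau>" using assms by simp
  ultimately have "norm u * \<tau> \<le> (norm u)\<^sup>2 + \<tau>\<^sup>2" by linarith
  then show ?thesis
    using denominator_pos[of \<tau> u] assms
    by (simp add: ckernel_def divide_simps mult_ac)
qed

text \<open>Uniform in \<open>\<tau>\<close>, with \<open>\<tau> = 0\<close> included, so this
  supplies the dominating function as \<open>\<tau>\<close> tends to 0.\<close>

lemma norm_ckernel_le_inverse: "norm (ckernel \<tau> u) \<le> inverse (norm u)"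
proof (cases "u = 0")
  case False
  have "norm u * norm u \<le> (norm u)\<^sup>2 + \<tau>\<^sup>2" by (simp add: power2_eq_square)
  moreover have "(norm u)\<^sup>2 + \<tau>\<^sup>2 > 0" using False by (simp add: add_pos_nonneg)
  ultimately show ?thesis using False by (simp add: ckernel_def field_simps)
qed (simp add: ckernel_def cz_def zero_complex.code[symmetric] complex_eq_iff)

text \<open>These bounds blow up as \<open>\<tau>\<close> tends to 0, which is harmless: partial
  derivatives are only taken at fixed \<open>\<tau>\<close>, and the limit uses only the combination
  computed in \<open>ckernel_dbar\<close>.\<close>

lemma norm_ckernel_xy_le:
  assumes "\<tau> > 0"
  shows "norm (ckernel_x \<tau> u) \<le> 3 / \<tau>\<^sup>2" "norm (ckernel_y \<tau> u) \<le> 3 / \<tau>\<^sup>2"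
proof -
  define N where "N = (norm u)\<^sup>2 + \<tau>\<^sup>2"
  have N: "N > 0" "\<tau>\<^sup>2 \<le> N" "(norm u)\<^sup>2 \<le> N" using denominator_pos[of \<tau> u] assms by (auto simp: N_def)
  have *: "norm (v /\<^sub>R N - (2 * t / N\<^sup>2) *\<^sub>R cnj (cz u)) \<le> 3 / \<tau>\<^sup>2"
    if t: "\<bar>t\<bar> \<le> norm u" and v: "norm v = 1" for t and v :: complex
  proof -
    have "norm ((2 * t / N\<^sup>2) *\<^sub>R cnj (cz u)) = 2 * \<bar>t\<bar> * norm u / N\<^sup>2"
      by (simp add: abs_mult)
    also have "\<dots> \<le> 2 * norm u * norm u / N\<^sup>2"
      using t by (intro divide_right_mono mult_right_mono) auto
    also have "\<dots> = 2 * (norm u)\<^sup>2 / N\<^sup>2" by (simp add: power2_eq_square)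
    also have "\<dots> \<le> 2 * N / N\<^sup>2" using N by (intro divide_right_mono) auto
    also have "\<dots> = 2 / N" using N by (simp add: power2_eq_square)
    finally have "norm ((2 * t / N\<^sup>2) *\<^sub>R cnj (cz u)) \<le> 2 / N" .
    moreover have "norm (v /\<^sub>R N) = 1 / N" using N v by (simp add: divide_inverse)
    moreover have "3 / N \<le> 3 / \<tau>\<^sup>2" using N assms by (intro divide_left_mono) auto
    ultimately show ?thesis
      using norm_triangle_ineq4[of "v /\<^sub>R N" "(2 * t / N\<^sup>2) *\<^sub>R cnj (cz u)"] by simp
  qed
  show "norm (ckernel_x \<tau> u) \<le> 3 / \<tau>\<^sup>2"
    unfolding ckernel_x_def N_def[symmetric]
    by (rule *) (use norm_fst_le[of "fst u" "snd u"] in auto)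
  show "norm (ckernel_y \<tau> u) \<le> 3 / \<tau>\<^sup>2"
    unfolding ckernel_y_def N_def[symmetric]
    by (rule *) (use norm_snd_le[of "snd u" "fst u"] in auto)
qed

lemma ckernel_has_derivative:
  assumes "\<tau> > 0"
  shows "((\<lambda>s. ckernel \<tau> (u + s *\<^sub>R (1, 0))) has_vector_derivative ckernel_x \<tau> u) (at 0)"
    and "((\<lambda>s. ckernel \<tau> (u + s *\<^sub>R (0, 1))) has_vector_derivative ckernel_y \<tau> u) (at 0)"
proof -
  obtain x y where u: "u = (x, y)" by force
  have ne: "x\<^sup>2 + y\<^sup>2 + \<tau>\<^sup>2 \<noteq> 0"
    using denominator_pos[of \<tau> u] assms by (simp add: u norm_pair_power2)
  have e: "ckernel \<tau> (u + s *\<^sub>R (1, 0)) = inverse ((x + s)\<^sup>2 + y\<^sup>2 + \<tau>\<^sup>2) *\<^sub>R (Complex x (- y) + s *\<^sub>R 1)"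
    "ckernel \<tau> (u + s *\<^sub>R (0, 1)) = inverse (x\<^sup>2 + (y + s)\<^sup>2 + \<tau>\<^sup>2) *\<^sub>R (Complex x (- y) + s *\<^sub>R (-\<i>))" for s
    by (simp_all add: u ckernel_def cz_def norm_pair_power2 complex_eq_iff)
  have c: "cnj (cz u) = Complex x (- y)" by (simp add: u cz_def complex_eq_iff)
  have "((\<lambda>s. inverse ((x + s)\<^sup>2 + y\<^sup>2 + \<tau>\<^sup>2) *\<^sub>R (Complex x (- y) + s *\<^sub>R 1)) has_vector_derivative
      inverse ((x + 0)\<^sup>2 + y\<^sup>2 + \<tau>\<^sup>2) *\<^sub>R 1 + (- 2 * x / (x\<^sup>2 + y\<^sup>2 + \<tau>\<^sup>2)\<^sup>2) *\<^sub>R (Complex x (- y) + 0 *\<^sub>R 1)) (at 0)"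
    by (intro has_vector_derivative_scaleR derivative_intros)
       (use ne in \<open>auto intro!: derivative_eq_intros simp: divide_inverse power2_eq_square\<close>)
  then show "((\<lambda>s. ckernel \<tau> (u + s *\<^sub>R (1, 0))) has_vector_derivative ckernel_x \<tau> u) (at 0)"
    unfolding e ckernel_x_def c by (simp add: u norm_pair_power2)
  have "((\<lambda>s. inverse (x\<^sup>2 + (y + s)\<^sup>2 + \<tau>\<^sup>2) *\<^sub>R (Complex x (- y) + s *\<^sub>R (-\<i>))) has_vector_derivative
      inverse (x\<^sup>2 + (y + 0)\<^sup>2 + \<tau>\<^sup>2) *\<^sub>R (-\<i>) + (- 2 * y / (x\<^sup>2 + y\<^sup>2 + \<tau>\<^sup>2)\<^sup>2) *\<^sub>R (Complex x (- y) + 0 *\<^sub>R (-\<i>))) (at 0)"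
    by (intro has_vector_derivative_scaleR derivative_intros)
       (use ne in \<open>auto intro!: derivative_eq_intros simp: divide_inverse power2_eq_square\<close>)
  then show "((\<lambda>s. ckernel \<tau> (u + s *\<^sub>R (0, 1))) has_vector_derivative ckernel_y \<tau> u) (at 0)"
    unfolding e ckernel_y_def c by (simp add: u norm_pair_power2)
qed

text \<open>The left side is twice the d-bar derivative. The kernel 1 / u is holomorphic off the
  origin, so after regularisation only a bump of width \<open>\<tau>\<close> and fixed mass remains;
  convolution with it is an approximate identity.\<close>

lemma ckernel_dbar:
  assumes "\<tau> > 0"
  shows "ckernel_x \<tau> u + \<i> * ckernel_y \<tau> u = of_real (2 * \<tau>\<^sup>2 / ((norm u)\<^sup>2 + \<tau>\<^sup>2)\<^sup>2)"
proof -
  define N where "N = (norm u)\<^sup>2 + \<tau>\<^sup>2"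
  have N: "N > 0" using denominator_pos[of \<tau> u] assms by (auto simp: N_def)
  have "ckernel_x \<tau> u + \<i> * ckernel_y \<tau> u = of_real (2 / N) - (2 / N\<^sup>2) *\<^sub>R (cz u * cnj (cz u))"
    unfolding ckernel_x_def ckernel_y_def N_def[symmetric]
    using N by (simp add: cz_def complex_eq_iff field_simps power2_eq_square)
  also have "cz u * cnj (cz u) = of_real ((norm u)\<^sup>2)"
    by (metis complex_norm_square norm_cz of_real_power)
  also have "of_real (2 / N) - (2 / N\<^sup>2) *\<^sub>R complex_of_real ((norm u)\<^sup>2) = of_real (2 / N - 2 / N\<^sup>2 * (norm u)\<^sup>2)"
    by (simp add: scaleR_conv_of_real)
  also have "2 / N - 2 / N\<^sup>2 * (norm u)\<^sup>2 = 2 * \<tau>\<^sup>2 / N\<^sup>2"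
  proof -
    have "2 / N - 2 / N\<^sup>2 * (norm u)\<^sup>2 = 2 * (N - (norm u)\<^sup>2) / N\<^sup>2"
      using N by (simp add: field_simps power2_eq_square)
    then show ?thesis by (simp add: N_def)
  qed
  finally show ?thesis by (simp add: N_def)
qed

section \<open>Cauchy transforms\<close>

lemma lborel_reflect_plane: "distr lborel borel (\<lambda>u :: real \<times> real. z - u) = lborel"
proof -
  have "lborel = density (distr lborel borel (\<lambda>x. z + (-1) *\<^sub>R x)) (\<lambda>_. \<bar>-1 :: real\<bar> ^ DIM(real \<times> real))"
    by (rule lborel_affine) simp
  then show ?thesis by (simp add: density_1)
qed

lemma integrable_reflect_plane:
  fixes f :: "real \<times> real \<Rightarrow> 'b::{banach, second_countable_topology}"
  assumes "integrable lborel f"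
  shows "integrable lborel (\<lambda>u. f (z - u))"
proof -
  have "integrable (distr lborel borel (\<lambda>u :: real \<times> real. z - u)) f"
    using assms by (simp add: lborel_reflect_plane)
  then show ?thesis
    using borel_measurable_integrable[OF assms] by (subst (asm) integrable_distr_eq) auto
qed

text \<open>The number is pi. Dividing by it normalises the Cauchy transform, so that its d-bar
  derivative reproduces \<open>g\<close>.\<close>

definition smoothing_mass :: real where
  "smoothing_mass = (LINT u::real \<times> real|lborel. 1 / (1 + (norm u)\<^sup>2)\<^sup>2)"

text \<open>Equal to 4 b for nonnegative \<open>b\<close>: a bound, at points of a disc of radius
  \<open>b\<close>, for the normalised Cauchy transform of a function of modulus at most 1 supported
  in that disc. The radius \<open>2 * b\<close> covers all differences of two such points.\<close>

definition cauchy_const :: "real \<Rightarrow> real" where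
  "cauchy_const b = (LINT u::real \<times> real|lborel. indicator (cball 0 (2 * b)) u * inverse (norm u)) / smoothing_mass"

definition smoothing_kernel :: "real \<Rightarrow> real \<times> real \<Rightarrow> complex" where
  "smoothing_kernel \<tau> u = of_real (\<tau>\<^sup>2 / ((norm u)\<^sup>2 + \<tau>\<^sup>2)\<^sup>2)"

lemma smoothing_mass_pos: "smoothing_mass > 0"
  unfolding smoothing_mass_def by (rule smoothing_kernel_mass_pos)

context bounded_support
begin

text \<open>The substitution fixes the kernel and lets the argument of \<open>g\<close> shrink to
  \<open>z\<close>, the form in which dominated convergence applies.\<close>

lemma conv_smoothing_kernel:
  assumes "\<tau> > 0"
  shows "plane_conv g (smoothing_kernel \<tau>) z
    = (LINT u|lborel. g (z - \<tau> *\<^sub>R u) * of_real (1 / (1 + (norm u)\<^sup>2)\<^sup>2))"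
proof -
  have [measurable]: "(\<lambda>\<zeta>. g \<zeta> * smoothing_kernel \<tau> (z - \<zeta>)) \<in> borel_measurable borel"
    unfolding smoothing_kernel_def by measurable
  have eq: "\<tau>\<^sup>2 *\<^sub>R (smoothing_kernel \<tau> (\<tau> *\<^sub>R u)) = of_real (1 / (1 + (norm u)\<^sup>2)\<^sup>2)" for u
  proof -
    have "(norm (\<tau> *\<^sub>R u))\<^sup>2 + \<tau>\<^sup>2 = \<tau>\<^sup>2 * (1 + (norm u)\<^sup>2)"
      by (simp add: power_mult_distrib algebra_simps)
    then show ?thesis
      using assms by (simp add: smoothing_kernel_def scaleR_conv_of_real power_mult_distrib power2_eq_square
          del: of_real_mult of_real_divide flip: of_real_mult of_real_divide)
  qed
  have "plane_conv g (smoothing_kernel \<tau>) z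
    = (LINT u|lborel. (- \<tau>)\<^sup>2 *\<^sub>R (g (z + (-\<tau>) *\<^sub>R u) * smoothing_kernel \<tau> (z - (z + (-\<tau>) *\<^sub>R u))))"
    unfolding plane_conv_def by (rule lborel_integral_affine_plane) (use assms in auto)
  also have "\<dots> = (LINT u|lborel. g (z - \<tau> *\<^sub>R u) * of_real (1 / (1 + (norm u)\<^sup>2)\<^sup>2))"
  proof (intro Bochner_Integration.integral_cong refl)
    fix u
    have "(- \<tau>)\<^sup>2 *\<^sub>R (g (z + (-\<tau>) *\<^sub>R u) * smoothing_kernel \<tau> (z - (z + (-\<tau>) *\<^sub>R u)))
        = g (z - \<tau> *\<^sub>R u) * (\<tau>\<^sup>2 *\<^sub>R smoothing_kernel \<tau> (\<tau> *\<^sub>R u))" by simp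
    then show "(- \<tau>)\<^sup>2 *\<^sub>R (g (z + (-\<tau>) *\<^sub>R u) * smoothing_kernel \<tau> (z - (z + (-\<tau>) *\<^sub>R u)))
        = g (z - \<tau> *\<^sub>R u) * of_real (1 / (1 + (norm u)\<^sup>2)\<^sup>2)" unfolding eq .
  qed
  finally show ?thesis .
qed

lemma norm_dom_smoothing: "norm (g v * complex_of_real (1 / (1 + (norm u)\<^sup>2)\<^sup>2)) \<le> m * (1 / (1 + (norm (u :: real \<times> real))\<^sup>2)\<^sup>2)"
proof -
  have "norm (g v * complex_of_real (1 / (1 + (norm u)\<^sup>2)\<^sup>2)) = norm (g v) * (1 / (1 + (norm u)\<^sup>2)\<^sup>2)"
    by (simp add: norm_mult norm_divide norm_power del: of_real_power of_real_divide of_real_add)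
  also have "\<dots> \<le> m * (1 / (1 + (norm u)\<^sup>2)\<^sup>2)" by (intro mult_right_mono g_bound) auto
  finally show ?thesis .
qed

lemma norm_conv_smoothing_kernel:
  assumes "\<tau> > 0"
  shows "norm (plane_conv g (smoothing_kernel \<tau>) z) \<le> m * smoothing_mass"
proof -
  have "norm (plane_conv g (smoothing_kernel \<tau>) z) \<le> (LINT u|lborel. m * (1 / (1 + (norm (u :: real \<times> real))\<^sup>2)\<^sup>2))"
    unfolding conv_smoothing_kernel[OF assms]
    by (intro Bochner_Integration.integral_norm_bound_integral norm_dom_smoothing
        Bochner_Integration.integrable_bound[OF integrable_mult_right[OF integrable_smoothing_kernel, of m]])
       (use norm_dom_smoothing m_nonneg integrable_smoothing_kernel in \<open>auto simp: abs_mult\<close>)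
  also have "\<dots> = m * smoothing_mass" by (simp only: smoothing_mass_def integral_mult_right_zero)
  finally show ?thesis .
qed

text \<open>At a point of continuity the rescaled integrand converges pointwise under a fixed
  integrable bound. This is the source of the hypothesis \<open>gc\<close> in the similarity
  principle.\<close>

lemma conv_smoothing_tendsto:
  assumes "isCont g z" and \<tau>: "\<tau> \<longlonglongrightarrow> 0" "\<And>n. \<tau> n > 0"
  shows "(\<lambda>n. plane_conv g (smoothing_kernel (\<tau> n)) z) \<longlonglongrightarrow> of_real smoothing_mass * g z"
proof -
  have "(\<lambda>n. LINT u|lborel. g (z - \<tau> n *\<^sub>R u) * of_real (1 / (1 + (norm u)\<^sup>2)\<^sup>2))
     \<longlonglongrightarrow> (LINT u|lborel. g z * of_real (1 / (1 + (norm (u :: real \<times> real))\<^sup>2)\<^sup>2))"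
  proof (rule integral_dominated_convergence)
    show "integrable lborel (\<lambda>u::real \<times> real. m * (1 / (1 + (norm u)\<^sup>2)\<^sup>2))"
      by (rule integrable_mult_right[OF integrable_smoothing_kernel])
    show "AE u in lborel. norm (g (z - \<tau> i *\<^sub>R u) * of_real (1 / (1 + (norm u)\<^sup>2)\<^sup>2)) \<le> m * (1 / (1 + (norm u)\<^sup>2)\<^sup>2)" for i
      by (intro AE_I2 norm_dom_smoothing)
    show "AE u in lborel. (\<lambda>i. g (z - \<tau> i *\<^sub>R u) * of_real (1 / (1 + (norm u)\<^sup>2)\<^sup>2)) \<longlonglongrightarrow> g z * of_real (1 / (1 + (norm u)\<^sup>2)\<^sup>2)"
    proof (intro AE_I2 tendsto_mult tendsto_const)
      fix u
      have "(\<lambda>i. z - \<tau> i *\<^sub>R u) \<longlonglongrightarrow> z - 0 *\<^sub>R u" by (intro tendsto_intros \<tau>)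
      then show "(\<lambda>i. g (z - \<tau> i *\<^sub>R u)) \<longlonglongrightarrow> g z"
        using isCont_tendsto_compose[OF assms(1)] by simp
    qed
  qed measurable
  also have "(LINT u|lborel. g z * of_real (1 / (1 + (norm (u :: real \<times> real))\<^sup>2)\<^sup>2)) = of_real smoothing_mass * g z"
    unfolding smoothing_mass_def integral_mult_right_zero integral_complex_of_real by simp
  finally show ?thesis by (simp add: conv_smoothing_kernel \<tau>)
qed

text \<open>The kernel for \<open>\<tau> = 0\<close> is unbounded, so \<open>conv_integrable\<close>
  does not cover it. The singularity 1 / |u| is integrated over the disc of radius
  \<open>2 * b\<close> instead, and the resulting bound is free of \<open>\<tau>\<close>.\<close>

lemma conv_ckernel_bounds:
  assumes S: "S \<subseteq> cball z0 b" and z: "z \<in> S"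
  shows "integrable lborel (\<lambda>\<zeta>. g \<zeta> * ckernel \<tau> (z - \<zeta>))"
    and "norm (plane_conv g (ckernel \<tau>) z) \<le> m * smoothing_mass * cauchy_const b"
proof -
  let ?f = "\<lambda>u :: real \<times> real. indicator (cball 0 (2 * b)) u * inverse (norm u) :: real"
  have [measurable]: "cball (0 :: real \<times> real) (2 * b) \<in> sets borel" by simp
  have dom: "norm (g \<zeta> * ckernel \<tau> (z - \<zeta>)) \<le> m * ?f (z - \<zeta>)" for \<zeta>
  proof (cases "\<zeta> \<in> S")
    case True
    have "norm (z - \<zeta>) \<le> 2 * b"
      using subsetD[OF S z] subsetD[OF S True] dist_triangle2[of z \<zeta> z0] by (simp add: dist_norm norm_minus_commute)
    then have e: "?f (z - \<zeta>) = inverse (norm (z - \<zeta>))" by simp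
    show ?thesis
      using mult_mono[OF g_bound[of \<zeta>] norm_ckernel_le_inverse[of \<tau> "z - \<zeta>"]] m_nonneg
      unfolding e norm_mult by simp
  qed (use m_nonneg in \<open>auto simp: g_supp\<close>)
  have I: "integrable lborel (\<lambda>\<zeta>. m * ?f (z - \<zeta>))"
    by (intro integrable_mult_right integrable_reflect_plane[where f = ?f] integrable_inverse_norm) auto
  show 1: "integrable lborel (\<lambda>\<zeta>. g \<zeta> * ckernel \<tau> (z - \<zeta>))"
    by (rule Bochner_Integration.integrable_bound[OF I])
       (auto intro!: order_trans[OF dom])
  have "norm (plane_conv g (ckernel \<tau>) z) \<le> (LINT \<zeta>|lborel. m * ?f (z - \<zeta>))"
    unfolding plane_conv_def by (intro Bochner_Integration.integral_norm_bound_integral 1 I dom)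
  also have "\<dots> = m * (LINT \<zeta>|lborel. ?f (z - \<zeta>))" by simp
  also have "(LINT \<zeta>|lborel. ?f (z - \<zeta>)) = (LINT \<zeta>|lborel. ?f \<zeta>)"
    by (rule lborel_integral_reflect_plane[where f = ?f]) measurable
  also have "m * (LINT \<zeta>|lborel. ?f \<zeta>) = m * smoothing_mass * cauchy_const b"
    using smoothing_mass_pos by (simp add: cauchy_const_def)
  finally show "norm (plane_conv g (ckernel \<tau>) z) \<le> m * smoothing_mass * cauchy_const b" .
qed

text \<open>The difference of the two convolutions is at most \<open>m\<close> times the L1 distance
  of the kernels on a disc that contains all differences of points of \<open>S\<close>, and this
  distance does not involve \<open>z\<close>. It tends to 0 by domination with 2 / |u|. Uniformity
  is what makes the limit continuous.\<close>

lemma uniform_limit_conv_ckernel: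
  assumes \<tau>: "\<tau> \<longlonglongrightarrow> 0" "\<And>n. \<tau> n > 0"
  shows "uniform_limit S (\<lambda>n. plane_conv g (ckernel (\<tau> n))) (plane_conv g (ckernel 0)) sequentially"
proof -
  obtain b where "\<forall>x\<in>S. norm x \<le> b" using S_bounded by (auto simp: bounded_iff)
  then have S: "S \<subseteq> cball 0 b" by auto
  let ?T = "cball (0 :: real \<times> real) (2 * b)"
  define d where "d n u = indicator ?T u * norm (ckernel (\<tau> n) u - ckernel 0 u)" for n u
  have [measurable]: "?T \<in> sets borel" by simp
  have [measurable]: "d n \<in> borel_measurable borel" for n
    unfolding d_def by measurable
  have I2: "integrable lborel (\<lambda>u. 2 * (indicator ?T u * inverse (norm u)) :: real)"
    by (rule integrable_mult_right[OF integrable_inverse_norm]) simp_all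
  have d_le: "norm (d n u) \<le> 2 * (indicator ?T u * inverse (norm u))" for n u
    using norm_triangle_ineq4[of "ckernel (\<tau> n) u" "ckernel 0 u"]
      norm_ckernel_le_inverse[of "\<tau> n" u] norm_ckernel_le_inverse[of 0 u]
    by (auto simp: d_def indicator_def)
  have d_int: "integrable lborel (d n)" for n
    by (rule Bochner_Integration.integrable_bound[OF I2], measurable, intro AE_I2 order_trans[OF d_le], simp)
  have "(\<lambda>n. LINT u|lborel. d n u) \<longlonglongrightarrow> (LINT u::real \<times> real|lborel. 0)"
  proof (rule integral_dominated_convergence[OF _ _ I2])
    show "AE u in lborel. (\<lambda>n. d n u) \<longlonglongrightarrow> 0"
    proof (rule AE_I2)
      fix u
      show "(\<lambda>n. d n u) \<longlonglongrightarrow> 0"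
      proof (cases "u = 0")
        case False
        have "(\<lambda>n. ckernel (\<tau> n) u) \<longlonglongrightarrow> ckernel 0 u"
          unfolding ckernel_def by (intro tendsto_intros \<tau>) (use False in auto)
        then have "(\<lambda>n. norm (ckernel (\<tau> n) u - ckernel 0 u)) \<longlonglongrightarrow> 0"
          by (simp add: LIM_zero tendsto_norm_zero)
        then show ?thesis unfolding d_def by (rule tendsto_mult_right_zero)
      qed (simp add: d_def ckernel_def)
    qed
    show "AE u in lborel. norm (d n u) \<le> 2 * (indicator ?T u * inverse (norm u))" for n
      by (intro AE_I2 d_le)
  qed measurable
  then have "(\<lambda>n. LINT u|lborel. d n u) \<longlonglongrightarrow> 0" by simp
  then have lim: "(\<lambda>n. m * (LINT u|lborel. d n u)) \<longlonglongrightarrow> 0"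
    by (rule tendsto_mult_right_zero)
  have le: "dist (plane_conv g (ckernel (\<tau> n)) z) (plane_conv g (ckernel 0) z) \<le> m * (LINT u|lborel. d n u)"
    if z: "z \<in> S" for n z
  proof -
    have i: "integrable lborel (\<lambda>\<zeta>. g \<zeta> * ckernel (\<tau> n) (z - \<zeta>))"
      by (rule conv_integrable[where C = "1 / \<tau> n", OF borel_ckernel norm_ckernel_le[OF \<tau>(2)]])
    note i0 = conv_ckernel_bounds(1)[OF S z]
    have dd: "norm (g \<zeta> * ckernel (\<tau> n) (z - \<zeta>) - g \<zeta> * ckernel 0 (z - \<zeta>)) \<le> m * d n (z - \<zeta>)" for \<zeta>
    proof (cases "\<zeta> \<in> S")
      case True
      have "norm (z - \<zeta>) \<le> 2 * b"
        using subsetD[OF S z] subsetD[OF S True] norm_triangle_ineq4[of z \<zeta>] by (simp add: dist_norm)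
      then have "d n (z - \<zeta>) = norm (ckernel (\<tau> n) (z - \<zeta>) - ckernel 0 (z - \<zeta>))"
        by (simp add: d_def mem_cball_0)
      then show ?thesis
        unfolding right_diff_distrib[symmetric] norm_mult by (simp only:) (intro mult_right_mono g_bound norm_ge_zero)
    qed (use m_nonneg in \<open>auto simp: g_supp d_def\<close>)
    have I: "integrable lborel (\<lambda>\<zeta>. m * d n (z - \<zeta>))"
      by (intro integrable_mult_right integrable_reflect_plane[where f = "d n"] d_int)
    have "dist (plane_conv g (ckernel (\<tau> n)) z) (plane_conv g (ckernel 0) z)
        = norm (LINT \<zeta>|lborel. g \<zeta> * ckernel (\<tau> n) (z - \<zeta>) - g \<zeta> * ckernel 0 (z - \<zeta>))"
      using i i0 by (simp add: dist_norm plane_conv_def)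
    also have "\<dots> \<le> (LINT \<zeta>|lborel. m * d n (z - \<zeta>))"
      by (intro Bochner_Integration.integral_norm_bound_integral I dd Bochner_Integration.integrable_diff i i0)
    also have "\<dots> = m * (LINT \<zeta>|lborel. d n (z - \<zeta>))" by simp
    also have "(LINT \<zeta>|lborel. d n (z - \<zeta>)) = (LINT \<zeta>|lborel. d n \<zeta>)"
      by (rule lborel_integral_reflect_plane[where f = "d n"]) simp
    finally show ?thesis .
  qed
  show ?thesis
  proof (rule uniform_limitI)
    fix e :: real assume "e > 0"
    then have "\<forall>\<^sub>F n in sequentially. m * (LINT u|lborel. d n u) < e"
      using order_tendstoD(2)[OF lim] by blast
    then show "\<forall>\<^sub>F n in sequentially. \<forall>z\<in>S. dist (plane_conv g (ckernel (\<tau> n)) z) (plane_conv g (ckernel 0) z) < e"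
      by eventually_elim (intro ballI le_less_trans[OF le])
  qed
qed

end

section \<open>A Morera theorem for rectangles\<close>

lemma has_vector_derivative_line:
  fixes H :: "real \<times> real \<Rightarrow> complex"
  shows "((\<lambda>s. H ((x, y) + s *\<^sub>R (1, 0))) has_vector_derivative d) (at 0) \<Longrightarrow> ((\<lambda>t. H (t, y)) has_vector_derivative d) (at x)"
    and "((\<lambda>s. H ((x, y) + s *\<^sub>R (0, 1))) has_vector_derivative d) (at 0) \<Longrightarrow> ((\<lambda>t. H (x, t)) has_vector_derivative d) (at y)"
proof -
  show "((\<lambda>t. H (t, y)) has_vector_derivative d) (at x)"
    if "((\<lambda>s. H ((x, y) + s *\<^sub>R (1, 0))) has_vector_derivative d) (at 0)"
  proof -
    have "(((\<lambda>s. H ((x, y) + s *\<^sub>R (1, 0))) \<circ> (\<lambda>t. t - x)) has_vector_derivative 1 *\<^sub>R d) (at x)"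
      using that by (intro vector_diff_chain_at) (auto intro!: derivative_eq_intros)
    then show ?thesis by (simp add: o_def)
  qed
  show "((\<lambda>t. H (x, t)) has_vector_derivative d) (at y)"
    if "((\<lambda>s. H ((x, y) + s *\<^sub>R (0, 1))) has_vector_derivative d) (at 0)"
  proof -
    have "(((\<lambda>s. H ((x, y) + s *\<^sub>R (0, 1))) \<circ> (\<lambda>t. t - y)) has_vector_derivative 1 *\<^sub>R d) (at y)"
      using that by (intro vector_diff_chain_at) (auto intro!: derivative_eq_intros)
    then show ?thesis by (simp add: o_def)
  qed
qed

text \<open>Green's formula for the form H dz: the left side is minus the counterclockwise boundary
  integral, and the integrand on the right is - i (Hx + i Hy), so it measures the failure of
  holomorphy.\<close>

lemma rectangle_green:
  fixes H Hx Hy :: "real \<times> real \<Rightarrow> complex"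
  assumes le: "x1 \<le> x2" "y1 \<le> y2"
    and dx: "\<And>z. z \<in> cbox (x1, y1) (x2, y2) \<Longrightarrow> ((\<lambda>s. H (z + s *\<^sub>R (1, 0))) has_vector_derivative Hx z) (at 0)"
    and dy: "\<And>z. z \<in> cbox (x1, y1) (x2, y2) \<Longrightarrow> ((\<lambda>s. H (z + s *\<^sub>R (0, 1))) has_vector_derivative Hy z) (at 0)"
    and cx: "continuous_on (cbox (x1, y1) (x2, y2)) Hx" and cy: "continuous_on (cbox (x1, y1) (x2, y2)) Hy"
  shows "integral {x1..x2} (\<lambda>t. H (t, y2) - H (t, y1)) - \<i> * integral {y1..y2} (\<lambda>s. H (x2, s) - H (x1, s))
       = integral (cbox (x1, y1) (x2, y2)) (\<lambda>z. Hy z - \<i> * Hx z)"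
proof -
  let ?R = "cbox (x1, y1) (x2, y2)"
  have iy: "H (t, y2) - H (t, y1) = integral {y1..y2} (\<lambda>s. Hy (t, s))" if "t \<in> {x1..x2}" for t
  proof -
    have "((\<lambda>s. Hy (t, s)) has_integral H (t, y2) - H (t, y1)) {y1..y2}"
      by (rule fundamental_theorem_of_calculus[OF le(2)])
         (use that in \<open>auto intro!: has_vector_derivative_at_within has_vector_derivative_line dy\<close>)
    then show ?thesis by (simp add: integral_unique)
  qed
  have ix: "H (x2, s) - H (x1, s) = integral {x1..x2} (\<lambda>t. Hx (t, s))" if "s \<in> {y1..y2}" for s
  proof -
    have "((\<lambda>t. Hx (t, s)) has_integral H (x2, s) - H (x1, s)) {x1..x2}"
      by (rule fundamental_theorem_of_calculus[OF le(1)])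
         (use that in \<open>auto intro!: has_vector_derivative_at_within has_vector_derivative_line dx\<close>)
    then show ?thesis by (simp add: integral_unique)
  qed
  have "integral {x1..x2} (\<lambda>t. H (t, y2) - H (t, y1)) = integral {x1..x2} (\<lambda>t. integral {y1..y2} (\<lambda>s. Hy (t, s)))"
    by (rule integral_cong) (simp add: iy)
  also have "\<dots> = integral ?R Hy"
    using integral_prod_continuous[OF cy] by simp
  finally have 1: "integral {x1..x2} (\<lambda>t. H (t, y2) - H (t, y1)) = integral ?R Hy" .
  have "integral {y1..y2} (\<lambda>s. H (x2, s) - H (x1, s)) = integral {y1..y2} (\<lambda>s. integral {x1..x2} (\<lambda>t. Hx (t, s)))"
    by (rule integral_cong) (simp add: ix)
  also have "\<dots> = integral {x1..x2} (\<lambda>t. integral {y1..y2} (\<lambda>s. Hx (t, s)))"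
    using integral_swap_continuous[of x1 y1 x2 y2 "\<lambda>t s. Hx (t, s)"] cx by simp
  also have "\<dots> = integral ?R Hx"
    using integral_prod_continuous[OF cx] by simp
  finally have 2: "integral {y1..y2} (\<lambda>s. H (x2, s) - H (x1, s)) = integral ?R Hx" .
  have "integral ?R (\<lambda>z. Hy z - \<i> * Hx z) = integral ?R Hy - integral ?R (\<lambda>z. \<i> * Hx z)"
    by (intro Henstock_Kurzweil_Integration.integral_diff integrable_continuous continuous_intros cx cy)
  also have "integral ?R (\<lambda>z. \<i> * Hx z) = \<i> * integral ?R Hx" by simp
  finally show ?thesis using 1 2 by simp
qed

lemma mem_box_pair: "(a, b) \<in> box (x1, y1) (x2, y2) \<longleftrightarrow> x1 < a \<and> a < x2 \<and> y1 < b \<and> b < (y2 :: real)" for x1 x2 a :: real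
  by (auto simp: box_def Basis_prod_def)

text \<open>Integrating h dz along the two L-shaped paths from the corner \<open>(x1, y1)\<close>
  gives the same primitive \<open>P\<close>. One path shows that its derivative in x is h, the other
  that its derivative in y is i h. So \<open>P\<close> is holomorphic with derivative h, and h is
  holomorphic as the derivative of a holomorphic function.\<close>

lemma morera_rectangle:
  fixes h :: "real \<times> real \<Rightarrow> complex"
  assumes c: "continuous_on (cbox (x1, y1) (x2, y2)) h"
    and rect: "\<And>x y. x \<in> {x1..x2} \<Longrightarrow> y \<in> {y1..y2} \<Longrightarrow>
       integral {x1..x} (\<lambda>t. h (t, y) - h (t, y1)) = \<i> * integral {y1..y} (\<lambda>s. h (x, s) - h (x1, s))"
  shows "(\<lambda>z. h (Re z, Im z)) holomorphic_on {z. (Re z, Im z) \<in> box (x1, y1) (x2, y2)}"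
proof -
  define P where "P x y = integral {x1..x} (\<lambda>t. h (t, y)) + \<i> * integral {y1..y} (\<lambda>s. h (x1, s))" for x y
  let ?U = "{z. (Re z, Im z) \<in> box (x1, y1) (x2, y2)}"
  have ch: "continuous_on {x1..x2} (\<lambda>t. h (t, y))" if "y \<in> {y1..y2}" for y
    by (rule continuous_on_compose2[OF c]) (use that in \<open>auto intro!: continuous_intros\<close>)
  have cv: "continuous_on {y1..y2} (\<lambda>s. h (x, s))" if "x \<in> {x1..x2}" for x
    by (rule continuous_on_compose2[OF c]) (use that in \<open>auto intro!: continuous_intros\<close>)
  have ih: "(\<lambda>t. h (t, y)) integrable_on {x1..x}" if "x \<in> {x1..x2}" "y \<in> {y1..y2}" for x y
    by (rule integrable_continuous_interval[OF continuous_on_subset[OF ch]]) (use that in auto)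
  have iv: "(\<lambda>s. h (x, s)) integrable_on {y1..y}" if "x \<in> {x1..x2}" "y \<in> {y1..y2}" for x y
    by (rule integrable_continuous_interval[OF continuous_on_subset[OF cv]]) (use that in auto)
  have P2: "P x y = integral {x1..x} (\<lambda>t. h (t, y1)) + \<i> * integral {y1..y} (\<lambda>s. h (x, s))"
    if "x \<in> {x1..x2}" "y \<in> {y1..y2}" for x y
  proof -
    have y1: "y1 \<in> {y1..y2}" and x1: "x1 \<in> {x1..x2}" using that by auto
    have "integral {x1..x} (\<lambda>t. h (t, y)) - integral {x1..x} (\<lambda>t. h (t, y1))
        = \<i> * (integral {y1..y} (\<lambda>s. h (x, s)) - integral {y1..y} (\<lambda>s. h (x1, s)))"
      using rect[OF that]
      unfolding Henstock_Kurzweil_Integration.integral_diff[OF ih[OF that] ih[OF that(1) y1]]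
        Henstock_Kurzweil_Integration.integral_diff[OF iv[OF that] iv[OF x1 that(2)]] .
    then show ?thesis by (simp add: P_def algebra_simps)
  qed
  have der: "((\<lambda>z. P (Re z) (Im z)) has_field_derivative h (Re z, Im z)) (at z)" if "z \<in> ?U" for z
  proof -
    define x y where "x = Re z" and "y = Im z"
    have xy: "x \<in> {x1<..<x2}" "y \<in> {y1<..<y2}" using that by (auto simp: x_def y_def mem_box_pair)
    have Px: "((\<lambda>x. P x y) has_derivative (\<lambda>t. t *\<^sub>R h (x, y))) (at x within {x1<..<x2})"
    proof -
      have "((\<lambda>x. integral {x1..x} (\<lambda>t. h (t, y))) has_vector_derivative h (x, y)) (at x within {x1..x2})"
        using integral_has_vector_derivative[OF ch, of y x] xy by simp
      then have "((\<lambda>x. P x y) has_vector_derivative h (x, y)) (at x within {x1..x2})"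
        unfolding P_def by (auto intro!: derivative_eq_intros)
      then have "((\<lambda>x. P x y) has_vector_derivative h (x, y)) (at x within {x1<..<x2})"
        by (rule has_vector_derivative_within_subset) auto
      then show ?thesis by (simp add: has_vector_derivative_def)
    qed
    have Py: "((\<lambda>y. P x y) has_derivative (\<lambda>t. t *\<^sub>R (\<i> * h (x, y)))) (at y within {y1<..<y2})"
      if "x \<in> {x1<..<x2}" "y \<in> {y1<..<y2}" for x y
    proof -
      have "((\<lambda>y. integral {y1..y} (\<lambda>s. h (x, s))) has_vector_derivative h (x, y)) (at y within {y1..y2})"
        using integral_has_vector_derivative[OF cv, of x y] that by simp
      then have "((\<lambda>y. integral {x1..x} (\<lambda>t. h (t, y1)) + \<i> * integral {y1..y} (\<lambda>s. h (x, s)))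
           has_vector_derivative \<i> * h (x, y)) (at y within {y1..y2})"
        by (auto intro!: derivative_eq_intros)
      then have "((\<lambda>y. P x y) has_vector_derivative \<i> * h (x, y)) (at y within {y1..y2})"
        by (rule has_vector_derivative_transform[rotated 2]) (use that P2 in auto)
      then have "((\<lambda>y. P x y) has_vector_derivative \<i> * h (x, y)) (at y within {y1<..<y2})"
        by (rule has_vector_derivative_within_subset) auto
      then show ?thesis by (simp add: has_vector_derivative_def)
    qed
    have "((\<lambda>(x, y). P x y) has_derivative (\<lambda>(tx, ty). tx *\<^sub>R h (x, y) + blinfun_apply (blinfun_scaleR_left (\<i> * h (x, y))) ty))
       (at (x, y) within {x1<..<x2} \<times> {y1<..<y2})"
    proof (rule has_derivative_partialsI[where f = P, OF Px])
      show "(P x has_derivative blinfun_apply (blinfun_scaleR_left (\<i> * h (x, y)))) (at y within {y1<..<y2})"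
        if "x \<in> {x1<..<x2}" "y \<in> {y1<..<y2}" for x y
        using Py[OF that] by simp
      have "continuous_on ({x1<..<x2} \<times> {y1<..<y2}) (\<lambda>(x, y). blinfun_scaleR_left (\<i> * h (x, y)))"
        unfolding case_prod_beta'
        by (intro bounded_linear.continuous_on[OF bounded_linear_blinfun_scaleR_left] continuous_intros
            continuous_on_compose2[OF c]) auto
      then show "continuous (at (x, y) within {x1<..<x2} \<times> {y1<..<y2}) (\<lambda>(x, y). blinfun_scaleR_left (\<i> * h (x, y)))"
        unfolding continuous_on_eq_continuous_within by (rule bspec) (use xy in auto)
    qed (use xy in auto)
    then have "((\<lambda>(x, y). P x y) has_derivative (\<lambda>(tx, ty). tx *\<^sub>R h (x, y) + ty *\<^sub>R (\<i> * h (x, y)))) (at (x, y))"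
      using at_within_open[of "(x, y)" "{x1<..<x2} \<times> {y1<..<y2}"] xy by (simp add: open_Times)
    moreover have "((\<lambda>z. (Re z, Im z)) has_derivative (\<lambda>z. (Re z, Im z))) (at z)"
      by (auto intro!: derivative_eq_intros)
    ultimately have "((\<lambda>(x, y). P x y) \<circ> (\<lambda>z. (Re z, Im z)) has_derivative
       (\<lambda>(tx, ty). tx *\<^sub>R h (x, y) + ty *\<^sub>R (\<i> * h (x, y))) \<circ> (\<lambda>z. (Re z, Im z))) (at z)"
      by (intro diff_chain_at) (simp_all add: x_def y_def)
    then have "((\<lambda>z. P (Re z) (Im z)) has_derivative (\<lambda>v. Re v *\<^sub>R h (x, y) + Im v *\<^sub>R (\<i> * h (x, y)))) (at z)"
      by (simp add: o_def)
    moreover have "(\<lambda>v. Re v *\<^sub>R h (x, y) + Im v *\<^sub>R (\<i> * h (x, y))) = (*) (h (x, y))"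
      by (auto simp: fun_eq_iff complex_eq_iff algebra_simps)
    ultimately show ?thesis by (simp add: has_field_derivative_def x_def y_def)
  qed
  have U: "open ?U"
  proof -
    have "?U = box (Complex x1 y1) (Complex x2 y2)" by (auto simp: in_box_complex_iff mem_box_pair)
    then show ?thesis by (metis open_box)
  qed
  have "(\<lambda>z. P (Re z) (Im z)) holomorphic_on ?U"
    using der by (auto simp: holomorphic_on_open[OF U])
  then have "deriv (\<lambda>z. P (Re z) (Im z)) holomorphic_on ?U"
    using U by (rule holomorphic_deriv)
  then show ?thesis
    by (rule holomorphic_transform) (rule DERIV_imp_deriv[OF der])
qed


section \<open>The similarity principle\<close>

lemma (in bounded_support) conv_ckernel_dbar:
  assumes "\<tau> > 0"
  shows "plane_conv g (ckernel_x \<tau>) z + \<i> * plane_conv g (ckernel_y \<tau>) z = 2 * plane_conv g (smoothing_kernel \<tau>) z"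
proof -
  have [measurable]: "ckernel_x \<tau> \<in> borel_measurable borel" "ckernel_y \<tau> \<in> borel_measurable borel"
    by (intro borel_measurable_continuous_onI continuous_ckernels assms)+
  have ix: "integrable lborel (\<lambda>\<zeta>. g \<zeta> * ckernel_x \<tau> (z - \<zeta>))"
    by (rule conv_integrable[OF _ norm_ckernel_xy_le(1)[OF assms]]) measurable
  have iy: "integrable lborel (\<lambda>\<zeta>. \<i> * (g \<zeta> * ckernel_y \<tau> (z - \<zeta>)))"
    by (rule integrable_mult_right, rule conv_integrable[OF _ norm_ckernel_xy_le(2)[OF assms]]) measurable
  have "plane_conv g (ckernel_x \<tau>) z + \<i> * plane_conv g (ckernel_y \<tau>) z
      = (LINT \<zeta>|lborel. g \<zeta> * ckernel_x \<tau> (z - \<zeta>) + \<i> * (g \<zeta> * ckernel_y \<tau> (z - \<zeta>)))"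
    unfolding plane_conv_def Bochner_Integration.integral_add[OF ix iy] by simp
  also have "\<dots> = (LINT \<zeta>|lborel. 2 * (g \<zeta> * smoothing_kernel \<tau> (z - \<zeta>)))"
  proof (intro Bochner_Integration.integral_cong refl)
    fix \<zeta>
    have "g \<zeta> * ckernel_x \<tau> (z - \<zeta>) + \<i> * (g \<zeta> * ckernel_y \<tau> (z - \<zeta>))
        = g \<zeta> * (ckernel_x \<tau> (z - \<zeta>) + \<i> * ckernel_y \<tau> (z - \<zeta>))" by (simp add: algebra_simps)
    then show "g \<zeta> * ckernel_x \<tau> (z - \<zeta>) + \<i> * (g \<zeta> * ckernel_y \<tau> (z - \<zeta>)) = 2 * (g \<zeta> * smoothing_kernel \<tau> (z - \<zeta>))"
      unfolding ckernel_dbar[OF assms] by (simp add: smoothing_kernel_def)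
  qed
  finally show ?thesis by (simp add: plane_conv_def)
qed

text \<open>
  \<open>\<beta>\<close> is the uniform limit of convolutions of \<open>g\<close> with the smooth kernels
  \<open>cnj u / (\<bar>u\<bar>\<^sup>2 + \<tau>\<^sup>2)\<close>. Their d-bar derivatives are averages of \<open>g\<close>, which converge
  only where \<open>g\<close> is continuous; elsewhere the factor \<open>W\<close> vanishes.
\<close>
theorem similarity_principle:
  fixes W Wx Wy g :: "real \<times> real \<Rightarrow> complex"
  assumes D: "box p q \<subseteq> cball z0 b"
    and gm [measurable]: "g \<in> borel_measurable borel" and gb: "\<And>z. norm (g z) \<le> m"
    and dx: "\<And>z. z \<in> box p q \<Longrightarrow> ((\<lambda>s. W (z + s *\<^sub>R (1, 0))) has_vector_derivative Wx z) (at 0)"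
    and dy: "\<And>z. z \<in> box p q \<Longrightarrow> ((\<lambda>s. W (z + s *\<^sub>R (0, 1))) has_vector_derivative Wy z) (at 0)"
    and c: "continuous_on (box p q) W" "continuous_on (box p q) Wx" "continuous_on (box p q) Wy"
    and eq: "\<And>z. z \<in> box p q \<Longrightarrow> Wx z + \<i> * Wy z = 2 * g z * W z"
    and gc: "\<And>z. z \<in> box p q \<Longrightarrow> W z \<noteq> 0 \<Longrightarrow> isCont g z"
  obtains \<beta> where "\<And>z. z \<in> box p q \<Longrightarrow> norm (\<beta> z) \<le> m * cauchy_const b"
    "(\<lambda>z. W (Re z, Im z) * exp (- \<beta> (Re z, Im z))) holomorphic_on {z. (Re z, Im z) \<in> box p q}"
proof -
  \<comment> \<open>Truncation gives bounded support and changes neither \<open>g\<close> nor its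
    continuity inside the open box.\<close>
  define g' where "g' z = (if z \<in> box p q then g z else 0)" for z
  define \<kappa> where "\<kappa> = complex_of_real smoothing_mass"
  have \<kappa>: "\<kappa> \<noteq> 0" "norm \<kappa> = smoothing_mass" using smoothing_mass_pos by (auto simp: \<kappa>_def)
  have m: "m \<ge> 0" using gb[of undefined] norm_ge_zero order_trans by blast
  interpret bounded_support g' m "box p q"
  proof
    show "g' \<in> borel_measurable borel" unfolding g'_def[abs_def] by measurable
  qed (use gb m in \<open>auto simp: g'_def bounded_box\<close>)
  define \<tau> where "\<tau> n = inverse (real (Suc n))" for n
  have \<tau>: "\<tau> \<longlonglongrightarrow> 0" "\<And>n. \<tau> n > 0"
    unfolding \<tau>_def by (rule LIMSEQ_inverse_real_of_nat) simp
  define \<beta> where "\<beta> z = plane_conv g' (ckernel 0) z / \<kappa>" for z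
  define bn where "bn n z = plane_conv g' (ckernel (\<tau> n)) z / \<kappa>" for n z
  define bx where "bx n z = plane_conv g' (ckernel_x (\<tau> n)) z / \<kappa>" for n z
  define b_y where "b_y n z = plane_conv g' (ckernel_y (\<tau> n)) z / \<kappa>" for n z
  define G where "G n z = plane_conv g' (smoothing_kernel (\<tau> n)) z / \<kappa>" for n z
  define B where "B = m * cauchy_const b"
  have \<beta>_le: "norm (\<beta> z) \<le> B" if "z \<in> box p q" for z
    using conv_ckernel_bounds(2)[OF D that, of 0] smoothing_mass_pos
    by (simp add: \<beta>_def B_def norm_divide \<kappa> divide_simps mult_ac)
  have bn_le: "norm (bn n z) \<le> B" if "z \<in> box p q" for n z
    using conv_ckernel_bounds(2)[OF D that, of "\<tau> n"] smoothing_mass_pos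
    by (simp add: bn_def B_def norm_divide \<kappa> divide_simps mult_ac)
  have G_le: "norm (G n z) \<le> m" for n z
    using norm_conv_smoothing_kernel[OF \<tau>(2), of n z] smoothing_mass_pos
    by (simp add: G_def norm_divide \<kappa> divide_simps)
  have b_dbar: "bx n z + \<i> * b_y n z = 2 * G n z" for n z
    using conv_ckernel_dbar[OF \<tau>(2), of n z] \<kappa>(1) by (simp add: bx_def b_y_def G_def field_simps)
  have bx_der: "((\<lambda>s. bn n (z + s *\<^sub>R (1, 0))) has_vector_derivative bx n z) (at 0)" for n z
    unfolding bn_def bx_def
    by (intro has_vector_derivative_divide conv_has_derivative[OF continuous_ckernels(1)[OF \<tau>(2)] norm_ckernel_le[OF \<tau>(2)]
         continuous_ckernels(2)[OF \<tau>(2)] norm_ckernel_xy_le(1)[OF \<tau>(2)]] ckernel_has_derivative \<tau>)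
  have by_der: "((\<lambda>s. bn n (z + s *\<^sub>R (0, 1))) has_vector_derivative b_y n z) (at 0)" for n z
    unfolding bn_def b_y_def
    by (intro has_vector_derivative_divide conv_has_derivative[OF continuous_ckernels(1)[OF \<tau>(2)] norm_ckernel_le[OF \<tau>(2)]
         continuous_ckernels(3)[OF \<tau>(2)] norm_ckernel_xy_le(2)[OF \<tau>(2)]] ckernel_has_derivative \<tau>)
  have cont_b: "continuous_on S (bn n)" "continuous_on S (bx n)" "continuous_on S (b_y n)" for n S
    unfolding bn_def[abs_def] bx_def[abs_def] b_y_def[abs_def]
    by (intro continuous_on_divide continuous_on_const continuous_on_subset[OF conv_continuous[OF continuous_ckernels(1)[OF \<tau>(2)] norm_ckernel_le[OF \<tau>(2)]]]
      continuous_on_subset[OF conv_continuous[OF continuous_ckernels(2)[OF \<tau>(2)] norm_ckernel_xy_le(1)[OF \<tau>(2)]]]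
      continuous_on_subset[OF conv_continuous[OF continuous_ckernels(3)[OF \<tau>(2)] norm_ckernel_xy_le(2)[OF \<tau>(2)]]]; use \<kappa> in simp)+
  have unif: "uniform_limit (box p q) bn \<beta> sequentially"
    unfolding bn_def[abs_def] \<beta>_def[abs_def] divide_inverse
    by (intro uniform_limit_intros uniform_limit_conv_ckernel \<tau>)
  have cont_\<beta>: "continuous_on (box p q) \<beta>"
    by (rule uniform_limit_theorem[OF _ unif]) (auto intro!: always_eventually cont_b)
  have bn_lim: "(\<lambda>n. bn n z) \<longlonglongrightarrow> \<beta> z" if "z \<in> box p q" for z
    using tendsto_uniform_limitI[OF unif that] .
  \<comment> \<open>\<open>\<beta>\<close> is only continuous, so \<open>h\<close> cannot be
    differentiated directly. The approximations \<open>hn\<close> have continuous partial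
    derivatives, and their d-bar derivative is a bounded multiple of \<open>W * (g - G n)\<close>,
    which tends to 0 pointwise.\<close>
  define h where "h z = W z * exp (- \<beta> z)" for z
  define hn where "hn n z = W z * exp (- bn n z)" for n z
  define hx where "hx n z = (Wx z - W z * bx n z) * exp (- bn n z)" for n z
  define hy where "hy n z = (Wy z - W z * b_y n z) * exp (- bn n z)" for n z
  have exp_der: "((\<lambda>s. exp (- f s)) has_vector_derivative - d * exp (- f 0)) (at 0)"
    if "(f has_vector_derivative d) (at 0)" for f :: "real \<Rightarrow> complex" and d
  proof -
    have "((\<lambda>s. - f s) has_vector_derivative - d) (at 0)" using that by (rule has_vector_derivative_minus)
    then have "(exp \<circ> (\<lambda>s. - f s) has_vector_derivative - d * exp (- f 0)) (at 0)"
      by (intro field_vector_diff_chain_at) (auto intro: DERIV_exp)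
    then show ?thesis by (simp add: o_def)
  qed
  have dhx: "((\<lambda>s. hn n (z + s *\<^sub>R (1, 0))) has_vector_derivative hx n z) (at 0)" if "z \<in> box p q" for n z
    using has_vector_derivative_mult[OF dx[OF that] exp_der[OF bx_der[of n z]]]
    by (simp add: hn_def hx_def algebra_simps flip: zero_prod_def)
  have dhy: "((\<lambda>s. hn n (z + s *\<^sub>R (0, 1))) has_vector_derivative hy n z) (at 0)" if "z \<in> box p q" for n z
    using has_vector_derivative_mult[OF dy[OF that] exp_der[OF by_der[of n z]]]
    by (simp add: hn_def hy_def algebra_simps flip: zero_prod_def)
  have ch: "continuous_on (box p q) h" unfolding h_def[abs_def] by (intro continuous_intros c cont_\<beta>)
  have chn: "continuous_on (box p q) (hn n)" for n unfolding hn_def[abs_def] by (intro continuous_intros c cont_b)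
  have chx: "continuous_on (box p q) (hx n)" for n unfolding hx_def[abs_def] by (intro continuous_intros c cont_b)
  have chy: "continuous_on (box p q) (hy n)" for n unfolding hy_def[abs_def] by (intro continuous_intros c cont_b)
  have h_lim: "(\<lambda>n. hn n z) \<longlonglongrightarrow> h z" if "z \<in> box p q" for z
    unfolding hn_def h_def by (intro tendsto_intros bn_lim that)
  have exp_le: "norm (exp (- bn n z)) \<le> exp B" if "z \<in> box p q" for n z
    using bn_le[OF that, of n] norm_exp[of "- bn n z"] by (simp add: order_trans)
  have dbar: "hy n z - \<i> * hx n z = - 2 * \<i> * exp (- bn n z) * (W z * (g z - G n z))" if "z \<in> box p q" for n z
  proof -
    have "hy n z - \<i> * hx n z = - \<i> * exp (- bn n z) * ((Wx z + \<i> * Wy z) - W z * (bx n z + \<i> * b_y n z))"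
      by (simp add: hx_def hy_def algebra_simps)
    also have "\<dots> = - 2 * \<i> * exp (- bn n z) * (W z * (g z - G n z))"
      unfolding eq[OF that] b_dbar by (simp add: algebra_simps)
    finally show ?thesis .
  qed
  have G_lim: "(\<lambda>n. W z * (g z - G n z)) \<longlonglongrightarrow> 0" if z: "z \<in> box p q" for z
  proof (cases "W z = 0")
    case False
    have "isCont g' z"
    proof -
      have "\<forall>\<^sub>F w in nhds z. g' w = g w"
        using eventually_nhds_in_open[OF open_box z] by eventually_elim (simp add: g'_def)
      then show ?thesis using gc[OF z False] isCont_cong by blast
    qed
    then have "(\<lambda>n. G n z) \<longlonglongrightarrow> \<kappa> * g' z / \<kappa>"
      unfolding G_def \<kappa>_def using smoothing_mass_pos by (intro tendsto_divide tendsto_const conv_smoothing_tendsto \<tau>) auto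
    then have "(\<lambda>n. G n z) \<longlonglongrightarrow> g z" using \<kappa> z by (simp add: g'_def)
    then have "(\<lambda>n. W z * (g z - G n z)) \<longlonglongrightarrow> W z * (g z - g z)" by (intro tendsto_intros)
    then show ?thesis by simp
  qed simp
  \<comment> \<open>Green's formula holds for every \<open>hn\<close>. Its area integral tends to 0
    and its boundary integrals tend to those of \<open>h\<close>, both by dominated convergence with
    the uniform bounds \<open>A\<close>, \<open>B\<close> and \<open>m\<close>.\<close>
  have rect: "integral {x1..x2} (\<lambda>t. h (t, y2) - h (t, y1)) = \<i> * integral {y1..y2} (\<lambda>s. h (x2, s) - h (x1, s))"
    if le: "x1 \<le> x2" "y1 \<le> y2" and sub: "cbox (x1, y1) (x2, y2) \<subseteq> box p q" for x1 x2 y1 y2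
  proof -
    let ?R = "cbox (x1, y1) (x2, y2)"
    have in_R: "(t, s) \<in> ?R" if "t \<in> {x1..x2}" "s \<in> {y1..y2}" for t s using that by simp
    have in_D: "(t, s) \<in> box p q" if "t \<in> {x1..x2}" "s \<in> {y1..y2}" for t s using in_R[OF that] sub by blast
    obtain A where A: "\<And>z. z \<in> ?R \<Longrightarrow> norm (W z) \<le> A" and A0: "A \<ge> 0"
    proof -
      have "compact (W ` ?R)"
        by (intro compact_continuous_image continuous_on_subset[OF c(1)] sub compact_cbox)
      then obtain A where "A > 0" "\<forall>x\<in>W ` ?R. norm x \<le> A" using compact_imp_bounded bounded_pos by metis
      then show ?thesis using that[of A] by auto
    qed
    have hn_le: "norm (hn n z) \<le> A * exp B" if "z \<in> ?R" for n z
      unfolding hn_def norm_mult using A[OF that] exp_le[of z n] that sub A0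
      by (intro mult_mono) auto
    have hn_diff: "norm (hn n u - hn n v) \<le> 2 * (A * exp B)" if "u \<in> ?R" "v \<in> ?R" for n u v
      using norm_triangle_ineq4[of "hn n u" "hn n v"] hn_le[OF that(1), of n] hn_le[OF that(2), of n] by linarith
    have ct: "continuous_on {x1..x2} (\<lambda>t. hn n (t, y))" if "y \<in> {y1..y2}" for n y
      by (rule continuous_on_compose2[OF chn]) (use in_D that in \<open>auto intro!: continuous_intros\<close>)
    have cs: "continuous_on {y1..y2} (\<lambda>s. hn n (x, s))" if "x \<in> {x1..x2}" for n x
      by (rule continuous_on_compose2[OF chn]) (use in_D that in \<open>auto intro!: continuous_intros\<close>)
    have L1: "(\<lambda>n. integral {x1..x2} (\<lambda>t. hn n (t, y2) - hn n (t, y1))) \<longlonglongrightarrow> integral {x1..x2} (\<lambda>t. h (t, y2) - h (t, y1))"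
    proof (rule dominated_convergence(2)[where h = "\<lambda>_. 2 * (A * exp B)"])
      show "(\<lambda>t. hn n (t, y2) - hn n (t, y1)) integrable_on {x1..x2}" for n
        by (intro integrable_continuous_interval continuous_intros ct) (use le in auto)
      show "norm (hn n (t, y2) - hn n (t, y1)) \<le> 2 * (A * exp B)" if "t \<in> {x1..x2}" for n t
        by (intro hn_diff in_R that) (use le in auto)
      show "(\<lambda>n. hn n (t, y2) - hn n (t, y1)) \<longlonglongrightarrow> h (t, y2) - h (t, y1)" if "t \<in> {x1..x2}" for t
        by (intro tendsto_intros h_lim in_D that) (use le in auto)
    qed auto
    have L2: "(\<lambda>n. integral {y1..y2} (\<lambda>s. hn n (x2, s) - hn n (x1, s))) \<longlonglongrightarrow> integral {y1..y2} (\<lambda>s. h (x2, s) - h (x1, s))"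
    proof (rule dominated_convergence(2)[where h = "\<lambda>_. 2 * (A * exp B)"])
      show "(\<lambda>s. hn n (x2, s) - hn n (x1, s)) integrable_on {y1..y2}" for n
        by (intro integrable_continuous_interval continuous_intros cs) (use le in auto)
      show "norm (hn n (x2, s) - hn n (x1, s)) \<le> 2 * (A * exp B)" if "s \<in> {y1..y2}" for n s
        by (intro hn_diff in_R that) (use le in auto)
      show "(\<lambda>n. hn n (x2, s) - hn n (x1, s)) \<longlonglongrightarrow> h (x2, s) - h (x1, s)" if "s \<in> {y1..y2}" for s
        by (intro tendsto_intros h_lim in_D that) (use le in auto)
    qed auto
    have L3: "(\<lambda>n. integral ?R (\<lambda>z. hy n z - \<i> * hx n z)) \<longlonglongrightarrow> integral ?R (\<lambda>z. 0)"
    proof (rule dominated_convergence(2)[where h = "\<lambda>_. 2 * exp B * (A * (m + m))"])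
      show "(\<lambda>z. hy n z - \<i> * hx n z) integrable_on ?R" for n
        by (intro integrable_continuous continuous_intros continuous_on_subset[OF chx] continuous_on_subset[OF chy] sub)
      fix z assume z: "z \<in> ?R"
      have zD: "z \<in> box p q" using z sub by blast
      show "norm (hy n z - \<i> * hx n z) \<le> 2 * exp B * (A * (m + m))" for n
      proof -
        have gG: "norm (g z - G n z) \<le> m + m"
          using norm_triangle_ineq4[of "g z" "G n z"] gb[of z] G_le[of n z] by linarith
        have WG: "norm (W z) * norm (g z - G n z) \<le> A * (m + m)"
          by (rule mult_mono[OF A[OF z] gG A0]) simp
        have "norm (exp (- bn n z)) * (norm (W z) * norm (g z - G n z)) \<le> exp B * (A * (m + m))"
          by (rule mult_mono[OF exp_le[OF zD] WG]) auto
        moreover have "norm (- 2 * \<i> * exp (- bn n z) * (W z * (g z - G n z)))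
            = 2 * (norm (exp (- bn n z)) * (norm (W z) * norm (g z - G n z)))"
          by (simp add: norm_mult)
        ultimately show ?thesis unfolding dbar[OF zD] by linarith
      qed
      have "(\<lambda>n. - 2 * \<i> * exp (- bn n z) * (W z * (g z - G n z))) \<longlonglongrightarrow> - 2 * \<i> * exp (- \<beta> z) * 0"
        by (intro tendsto_mult tendsto_const tendsto_exp tendsto_minus bn_lim G_lim zD)
      then show "(\<lambda>n. hy n z - \<i> * hx n z) \<longlonglongrightarrow> 0" unfolding dbar[OF zD] by simp
    qed auto
    have "integral {x1..x2} (\<lambda>t. hn n (t, y2) - hn n (t, y1)) - \<i> * integral {y1..y2} (\<lambda>s. hn n (x2, s) - hn n (x1, s))
       = integral ?R (\<lambda>z. hy n z - \<i> * hx n z)" for n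
      by (rule rectangle_green[OF le]) (use dhx dhy sub chx chy continuous_on_subset in \<open>blast+\<close>)
    moreover have "(\<lambda>n. integral {x1..x2} (\<lambda>t. hn n (t, y2) - hn n (t, y1)) - \<i> * integral {y1..y2} (\<lambda>s. hn n (x2, s) - hn n (x1, s)))
       \<longlonglongrightarrow> integral {x1..x2} (\<lambda>t. h (t, y2) - h (t, y1)) - \<i> * integral {y1..y2} (\<lambda>s. h (x2, s) - h (x1, s))"
      by (intro tendsto_intros L1 L2)
    ultimately have "(\<lambda>n. integral ?R (\<lambda>z. hy n z - \<i> * hx n z))
       \<longlonglongrightarrow> integral {x1..x2} (\<lambda>t. h (t, y2) - h (t, y1)) - \<i> * integral {y1..y2} (\<lambda>s. h (x2, s) - h (x1, s))"
      by simp
    then have "integral {x1..x2} (\<lambda>t. h (t, y2) - h (t, y1)) - \<i> * integral {y1..y2} (\<lambda>s. h (x2, s) - h (x1, s)) = integral ?R (\<lambda>z. 0)"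
      by (rule LIMSEQ_unique[OF _ L3])
    then show ?thesis by simp
  qed
  have "(\<lambda>z. h (Re z, Im z)) field_differentiable at z" if z: "(Re z, Im z) \<in> box p q" for z
  proof -
    obtain p1 p2 q1 q2 where pq: "p = (p1, p2)" "q = (q1, q2)" by force
    \<comment> \<open>The box is open and \<open>h\<close> need not extend to its boundary, so
      Morera is applied on a closed rectangle around each point.\<close>
    define x1 x2 y1 y2 where "x1 = (p1 + Re z) / 2" and "x2 = (Re z + q1) / 2" and "y1 = (p2 + Im z) / 2" and "y2 = (Im z + q2) / 2"
    have ord: "p1 < x1" "x1 < Re z" "Re z < x2" "x2 < q1" "p2 < y1" "y1 < Im z" "Im z < y2" "y2 < q2"
      using z by (auto simp: pq mem_box_pair x1_def x2_def y1_def y2_def)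
    have sub: "cbox (x1, y1) (x2, y2) \<subseteq> box p q"
      using ord by (auto simp: pq mem_box_pair)
    let ?U = "{z. (Re z, Im z) \<in> box (x1, y1) (x2, y2)}"
    have "(\<lambda>z. h (Re z, Im z)) holomorphic_on ?U"
    proof (rule morera_rectangle)
      show "continuous_on (cbox (x1, y1) (x2, y2)) h" by (rule continuous_on_subset[OF ch sub])
      fix x y assume xy: "x \<in> {x1..x2}" "y \<in> {y1..y2}"
      have "cbox (x1, y1) (x, y) \<subseteq> cbox (x1, y1) (x2, y2)" using xy by auto
      then show "integral {x1..x} (\<lambda>t. h (t, y) - h (t, y1)) = \<i> * integral {y1..y} (\<lambda>s. h (x, s) - h (x1, s))"
        using xy sub by (intro rect) auto
    qed
    moreover have "?U = box (Complex x1 y1) (Complex x2 y2)" by (auto simp: in_box_complex_iff mem_box_pair)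
    moreover have "z \<in> ?U" using ord by (simp add: mem_box_pair)
    ultimately show ?thesis by (metis holomorphic_on_imp_differentiable_at open_box)
  qed
  then have "(\<lambda>z. h (Re z, Im z)) holomorphic_on {z. (Re z, Im z) \<in> box p q}"
    by (auto simp: holomorphic_on_def intro: field_differentiable_at_within)
  then show ?thesis
    by (intro that[of \<beta>]) (use \<beta>_le in \<open>auto simp: B_def h_def\<close>)
qed

section \<open>Quantitative unique continuation on one interval\<close>

section \<open>A Remez inequality for holomorphic functions\<close>

lemma separated_points:
  fixes S :: "real set"
  assumes S: "S \<in> sets lebesgue" "S \<subseteq> {u..v}" and \<sigma>: "0 < \<sigma>" "\<sigma> \<le> measure lebesgue S"
    and n: "n > 0"
  obtains x :: "nat \<Rightarrow> real" where "\<And>i. i < n \<Longrightarrow> x i \<in> S"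
    "\<And>i j. i < j \<Longrightarrow> j < n \<Longrightarrow> real (j - i) * (\<sigma> / (2 * real n)) \<le> x j - x i"
proof -
  \<comment> \<open>\<open>F\<close> is 1-Lipschitz, so points of \<open>S\<close> at which \<open>F\<close> takes separated values are separated.\<close>
  define F where "F t = measure lebesgue (S \<inter> {u..t})" for t
  define \<eta> where "\<eta> = \<sigma> / (2 * real n)"
  have \<eta>: "\<eta> > 0" using \<sigma> n by (simp add: \<eta>_def)
  have uv: "u \<le> v" using S(2) \<sigma> by (cases "u \<le> v") auto
  have lm: "S \<inter> {u..t} \<in> lmeasurable" for t
    by (rule bounded_set_imp_lmeasurable) (use S in auto)
  have ioc: "{s<..t} \<in> lmeasurable" for s t :: real
    by (rule bounded_set_imp_lmeasurable) auto
  have lm': "S \<inter> {s<..t} \<in> lmeasurable" for s t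
    by (rule bounded_set_imp_lmeasurable) (use S in \<open>auto intro: bounded_subset[of "{u..v}"]\<close>)
  have split: "F t = F s + measure lebesgue (S \<inter> {s<..t})" if "u \<le> s" "s \<le> t" for s t
  proof -
    have "S \<inter> {u..t} = (S \<inter> {u..s}) \<union> (S \<inter> {s<..t})" using that by auto
    then show ?thesis unfolding F_def
      by (simp, intro measure_Un_AE) (use lm lm' in auto)
  qed
  have step: "measure lebesgue (S \<inter> {s<..t}) \<le> t - s" if "s \<le> t" for s t
  proof -
    have "measure lebesgue (S \<inter> {s<..t}) \<le> measure lebesgue {s<..t}"
      by (rule measure_mono_fmeasurable) (use S ioc in auto)
    then show ?thesis using that by simp
  qed
  have F_mono: "F s \<le> F t" if "u \<le> s" "s \<le> t" for s t
    using split[OF that] by simp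
  have F_lip: "F t - F s \<le> t - s" if "u \<le> s" "s \<le> t" for s t
    using split[OF that] step[OF that(2)] by simp
  have F_cont: "continuous_on {u..v} F"
  proof (rule lipschitz_on_continuous_on)
    show "1-lipschitz_on {u..v} F"
    proof (rule lipschitz_onI)
      fix s t assume "s \<in> {u..v}" "t \<in> {u..v}"
      then show "dist (F s) (F t) \<le> 1 * dist s t"
        using F_mono[of s t] F_mono[of t s] F_lip[of s t] F_lip[of t s]
        by (cases "s \<le> t") (auto simp: dist_real_def)
    qed simp
  qed
  have Fu: "F u = 0"
  proof -
    have "F u \<le> measure lebesgue {u..u}"
      unfolding F_def by (rule measure_mono_fmeasurable) (use S lmeasurable_interval(1)[of u u] in auto)
    then show ?thesis using measure_nonneg[of lebesgue "S \<inter> {u..u}"] by (simp add: F_def del: atLeastAtMost_singleton)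
  qed
  have Fv: "F v \<ge> \<sigma>"
  proof -
    have "S \<inter> {u..v} = S" using S(2) by auto
    then show ?thesis using \<sigma> by (simp add: F_def)
  qed
  \<comment> \<open>The bands from \<open>2 * i * \<eta>\<close> to
    \<open>(2 * i + 1) * \<eta>\<close> of values of \<open>F\<close> are separated by gaps of
    length \<open>\<eta>\<close>, and \<open>n\<close> of them fit below
    \<open>\<sigma> = 2 * n * \<eta>\<close>. \<open>F\<close> rises across a band only by
    collecting measure of \<open>S\<close>, so some point of \<open>S\<close> has its value
    there.\<close>
  have "\<exists>x. x \<in> S \<and> u \<le> x \<and> 2 * real i * \<eta> \<le> F x \<and> F x \<le> (2 * real i + 1) * \<eta>" if i: "i < n" for i
  proof -
    have "(2 * real i + 1) \<le> 2 * real n" using i by simp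
    then have "(2 * real i + 1) * \<eta> \<le> 2 * real n * \<eta>" using \<eta> by (intro mult_right_mono) auto
    also have "\<dots> = \<sigma>" using n by (simp add: \<eta>_def)
    finally have le: "(2 * real i + 1) * \<eta> \<le> \<sigma>" .
    have le2: "2 * real i * \<eta> < (2 * real i + 1) * \<eta>" using \<eta> by (simp add: algebra_simps)
    have nn: "0 \<le> 2 * real i * \<eta>" using \<eta> by simp
    obtain t1 where t1: "u \<le> t1" "t1 \<le> v" "F t1 = 2 * real i * \<eta>"
      using IVT'[of F u "2 * real i * \<eta>" v] Fu Fv le le2 nn uv F_cont by auto
    obtain t2 where t2: "u \<le> t2" "t2 \<le> v" "F t2 = (2 * real i + 1) * \<eta>"
      using IVT'[of F u "(2 * real i + 1) * \<eta>" v] Fu Fv le le2 nn uv F_cont by auto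
    have "t1 \<le> t2" using F_mono[of t2 t1] t1 t2 le2 by (cases "t1 \<le> t2") auto
    have "measure lebesgue (S \<inter> {t1<..t2}) > 0"
      using split[OF t1(1) \<open>t1 \<le> t2\<close>] t1 t2 le2 by simp
    then have "S \<inter> {t1<..t2} \<noteq> {}" by (intro notI) simp
    then obtain x where "x \<in> S" "t1 < x" "x \<le> t2" by auto
    then show ?thesis
      using F_mono[of t1 x] F_mono[of x t2] t1 t2 by (intro exI[of _ x]) auto
  qed
  then obtain x where x: "\<And>i. i < n \<Longrightarrow> x i \<in> S" "\<And>i. i < n \<Longrightarrow> u \<le> x i"
    "\<And>i. i < n \<Longrightarrow> 2 * real i * \<eta> \<le> F (x i)" "\<And>i. i < n \<Longrightarrow> F (x i) \<le> (2 * real i + 1) * \<eta>"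
    by metis
  have "real (j - i) * \<eta> \<le> x j - x i" if ij: "i < j" "j < n" for i j
  proof -
    have i: "i < n" using ij by simp
    have "1 \<le> real j - real i" using ij by simp
    then have "(real j - real i) * \<eta> \<le> (2 * (real j - real i) - 1) * \<eta>"
      using \<eta> by (intro mult_right_mono) auto
    also have "\<dots> \<le> F (x j) - F (x i)"
      using x(3)[OF ij(2)] x(4)[OF i] by (simp add: algebra_simps)
    finally have 1: "(real j - real i) * \<eta> \<le> F (x j) - F (x i)" .
    have pos: "0 < (real j - real i) * \<eta>" using ij \<eta> by simp
    have "x i \<le> x j" using F_mono[of "x j" "x i"] x(2)[OF ij(2)] 1 pos by (cases "x i \<le> x j") auto
    then have "F (x j) - F (x i) \<le> x j - x i" by (rule F_lip[OF x(2)[OF i]])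
    then show ?thesis using 1 ij by (simp add: of_nat_diff)
  qed
  then show ?thesis using that[of x] x(1) by (simp add: \<eta>_def)
qed

text \<open>The points are at least as spread out as a grid of step \<open>\<eta>\<close>: those to
  the left of \<open>x i\<close> contribute i!, those to the right (n - 1 - i)!. In Lagrange's
  formula these factorials become a binomial coefficient.\<close>

lemma prod_abs_diff_ge:
  fixes x :: "nat \<Rightarrow> real"
  assumes sep: "\<And>i j. i < j \<Longrightarrow> j < n \<Longrightarrow> real (j - i) * \<eta> \<le> x j - x i" and \<eta>: "\<eta> \<ge> 0" and i: "i < n"
  shows "\<eta> ^ (n - 1) * fact i * fact (n - 1 - i) \<le> (\<Prod>j\<in>{..<n} - {i}. \<bar>x i - x j\<bar>)"
proof -
  have A: "(\<Prod>j\<in>{..<i}. real (i - j) * \<eta>) = \<eta> ^ i * fact i"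
  proof -
    have "(\<Prod>j\<in>{..<i}. real (i - j)) = (\<Prod>k\<in>{1..i}. real k)"
      by (rule prod.reindex_bij_witness[of _ "\<lambda>k. i - k" "\<lambda>j. i - j"]) auto
    then show ?thesis by (simp add: prod.distrib fact_prod mult.commute)
  qed
  have B: "(\<Prod>j\<in>{i<..<n}. real (j - i) * \<eta>) = \<eta> ^ (n - 1 - i) * fact (n - 1 - i)"
  proof -
    have "(\<Prod>j\<in>{i<..<n}. real (j - i)) = (\<Prod>k\<in>{1..n - 1 - i}. real k)"
      by (rule prod.reindex_bij_witness[of _ "\<lambda>k. i + k" "\<lambda>j. j - i"]) auto
    moreover have "card {i<..<n} = n - 1 - i" by simp
    ultimately show ?thesis by (simp add: prod.distrib fact_prod mult.commute)
  qed
  have eq: "{..<n} - {i} = {..<i} \<union> {i<..<n}" using i by auto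
  have "\<eta> ^ (n - 1) * fact i * fact (n - 1 - i)
      = (\<Prod>j\<in>{..<i}. real (i - j) * \<eta>) * (\<Prod>j\<in>{i<..<n}. real (j - i) * \<eta>)"
    unfolding A B using i by (simp add: power_add[symmetric])
  also have "\<dots> \<le> (\<Prod>j\<in>{..<i}. \<bar>x i - x j\<bar>) * (\<Prod>j\<in>{i<..<n}. \<bar>x i - x j\<bar>)"
  proof (intro mult_mono prod_mono prod_nonneg conjI ballI)
    show "real (i - j) * \<eta> \<le> \<bar>x i - x j\<bar>" if "j \<in> {..<i}" for j using sep[of j i] that i by simp
    show "real (j - i) * \<eta> \<le> \<bar>x i - x j\<bar>" if "j \<in> {i<..<n}" for j using sep[of i j] that by simp
  qed (use \<eta> in auto)
  also have "\<dots> = (\<Prod>j\<in>{..<n} - {i}. \<bar>x i - x j\<bar>)"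
    unfolding eq by (subst prod.union_disjoint) auto
  finally show ?thesis .
qed

text \<open>One term of the exponential series; it takes the place of Stirling's formula in the
  interpolation bound.\<close>

lemma power_le_fact_exp: "real n ^ (n - 1) \<le> fact (n - 1) * exp (real n)"
proof -
  have "real n ^ (n - 1) / fact (n - 1) \<le> exp (real n)"
  proof -
    have s: "(\<lambda>k. real n ^ k /\<^sub>R fact k) sums exp (real n)" by (rule exp_converges)
    have "sum (\<lambda>k. real n ^ k /\<^sub>R fact k) {n - 1} \<le> suminf (\<lambda>k. real n ^ k /\<^sub>R fact k)"
      by (rule sum_le_suminf[OF sums_summable[OF s]]) auto
    then show ?thesis using sums_unique[OF s] by (simp add: field_simps)
  qed
  then show ?thesis by (simp add: field_simps)
qed

text \<open>Zeros are divided out one at a time by removing the singularity; distinctness ensures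
  that the quotient still vanishes at the next point.\<close>

lemma holomorphic_factor_zeros:
  fixes f :: "complex \<Rightarrow> complex" and x :: "nat \<Rightarrow> complex"
  assumes U: "open U" and f: "f holomorphic_on U"
    and x: "\<And>i. i < n \<Longrightarrow> x i \<in> U" "\<And>i. i < n \<Longrightarrow> f (x i) = 0" "inj_on x {..<n}"
  obtains k where "k holomorphic_on U" "\<And>z. z \<in> U \<Longrightarrow> f z = (\<Prod>i<n. z - x i) * k z"
  using x
proof (induction n arbitrary: thesis)
  case 0
  then show ?case using f by simp
next
  case (Suc n)
  obtain k where k: "k holomorphic_on U" "\<And>z. z \<in> U \<Longrightarrow> f z = (\<Prod>i<n. z - x i) * k z"
  proof (rule Suc.IH)
    show "inj_on x {..<n}" using Suc.prems(4) by (rule inj_on_subset) auto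
  qed (use Suc.prems in auto)
  have "(\<Prod>i<n. x n - x i) \<noteq> 0"
    using inj_onD[OF Suc.prems(4), of n] by fastforce
  then have kn: "k (x n) = 0" using k(2)[of "x n"] Suc.prems(2,3)[of n] by simp
  let ?k = "\<lambda>z. if z = x n then deriv k (x n) else (k z - k (x n)) / (z - x n)"
  have "?k holomorphic_on U" by (rule pole_lemma_open[OF k(1) U])
  moreover have "f z = (\<Prod>i<Suc n. z - x i) * ?k z" if "z \<in> U" for z
    using k(2)[OF that] kn by simp
  ultimately show ?case using Suc.prems(1) by blast
qed

text \<open>Interpolate \<open>h\<close> at \<open>n\<close> separated points of \<open>S\<close> by
  a Lagrange polynomial \<open>p\<close>. It is of order \<open>\<epsilon>\<close> on the whole disc
  because the nodes carry values at most \<open>\<epsilon>\<close>, while \<open>h - p\<close> has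
  \<open>n\<close> zeros and is therefore small on the middle interval by the maximum principle, as
  in an n-fold Schwarz lemma. The free parameter \<open>n\<close> balances the growing term against
  the decaying one.\<close>

theorem holomorphic_remez:
  fixes h :: "complex \<Rightarrow> complex" and a c A \<epsilon> \<sigma> :: real and S :: "real set"
  assumes a: "a > 0" and U: "open U" "cball (of_real c) (4 * a) \<subseteq> U" and h: "h holomorphic_on U"
    and A: "\<And>z. z \<in> cball (of_real c) (4 * a) \<Longrightarrow> norm (h z) \<le> A"
    and S: "S \<in> sets lebesgue" "S \<subseteq> {c - a / 2..c + a / 2}" and \<sigma>: "0 < \<sigma>" "\<sigma> \<le> measure lebesgue S"
    and \<epsilon>: "\<And>x. x \<in> S \<Longrightarrow> norm (h (of_real x)) \<le> \<epsilon>"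
    and x0: "x0 \<in> {c - a / 2..c + a / 2}" and n: "n > 0"
  shows "norm (h (of_real x0)) \<le> 2 * \<epsilon> * (18 * exp 1 * a / \<sigma>) ^ n + A / 3 ^ n"
proof -
  obtain x where x: "\<And>i. i < n \<Longrightarrow> x i \<in> S"
    and sep: "\<And>i j. i < j \<Longrightarrow> j < n \<Longrightarrow> real (j - i) * (\<sigma> / (2 * real n)) \<le> x j - x i"
    using separated_points[OF S \<sigma> n] by metis
  define \<eta> where "\<eta> = \<sigma> / (2 * real n)"
  \<comment> \<open>A point of the disc is within \<open>9 / 2 * a\<close> of every node. Dividing
    by \<open>\<eta> = \<sigma> / (2 * real n)\<close> gives 9 a n / \<sigma> per factor, the sum of
    the binomial coefficients doubles this to 18 a n / \<sigma>, and n^(n-1) / (n-1)! is at most exp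
    n.\<close>
  define K where "K = 18 * exp 1 * a / \<sigma>"
  have \<eta>: "\<eta> > 0" using \<sigma> n by (simp add: \<eta>_def)
  have sep': "real (j - i) * \<eta> \<le> x j - x i" if "i < j" "j < n" for i j using sep[OF that] by (simp add: \<eta>_def)
  have \<sigma>a: "\<sigma> \<le> a"
  proof -
    have "measure lebesgue S \<le> measure lebesgue {c - a / 2..c + a / 2}"
      by (rule measure_mono_fmeasurable) (use S in auto)
    then show ?thesis using \<sigma> a by simp
  qed
  have xI: "x i \<in> {c - a / 2..c + a / 2}" if "i < n" for i using x[OF that] S(2) by blast
  have near: "norm (of_real y - complex_of_real c) \<le> a / 2" if "y \<in> {c - a / 2..c + a / 2}" for y
  proof -
    have "norm (of_real y - complex_of_real c) = \<bar>y - c\<bar>" by (metis norm_of_real of_real_diff)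
    moreover have "\<bar>y - c\<bar> \<le> a / 2" using that unfolding abs_le_iff by auto
    ultimately show ?thesis by simp
  qed
  have inj: "inj_on x {..<n}"
  proof (rule inj_onI, rule ccontr)
    fix i j assume ij: "i \<in> {..<n}" "j \<in> {..<n}" "x i = x j" "i \<noteq> j"
    have False if "i < j" "j < n" "x i = x j" for i j
      using sep'[OF that(1,2)] that \<eta> by (simp add: mult_le_0_iff)
    then show False using ij by (metis lessThan_iff linorder_neqE_nat)
  qed
  have \<epsilon>0: "\<epsilon> \<ge> 0" using \<epsilon>[OF x[OF n]] norm_ge_zero order_trans by blast
  have A0: "A \<ge> 0" using order_trans[OF norm_ge_zero A[of "of_real c"]] a by simp
  have AK: "0 \<le> A + \<epsilon> * K ^ n" using A0 \<epsilon>0 a \<sigma> by (simp add: K_def)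
  define p where "p z = (\<Sum>i<n. h (of_real (x i)) * (\<Prod>j\<in>{..<n} - {i}. (z - of_real (x j)) / (of_real (x i) - of_real (x j))))" for z
  have p_nodes: "p (of_real (x k)) = h (of_real (x k))" if k: "k < n" for k
  proof -
    have "(\<Prod>j\<in>{..<n} - {i}. (complex_of_real (x k) - of_real (x j)) / (of_real (x i) - of_real (x j))) = (if i = k then 1 else 0)"
      if i: "i < n" for i
    proof (cases "i = k")
      case True
      have "(complex_of_real (x k) - of_real (x j)) / (of_real (x i) - of_real (x j)) = 1" if "j \<in> {..<n} - {i}" for j
        using inj_onD[OF inj, of k j] that True k by auto
      then show ?thesis using True by (simp add: prod.neutral)
    next
      case False
      then have "k \<in> {..<n} - {i}" using k by simp
      then show ?thesis using False by (auto intro!: prod_zero)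
    qed
    then have "p (of_real (x k)) = (\<Sum>i<n. h (of_real (x i)) * (if i = k then 1 else 0))"
      unfolding p_def by (intro sum.cong) auto
    also have "\<dots> = h (of_real (x k))" using k by (simp add: if_distrib cong: if_cong)
    finally show ?thesis .
  qed
  have p_hol: "p holomorphic_on U" unfolding p_def
    by (intro holomorphic_intros) (use inj in \<open>auto simp: inj_on_def\<close>)
  have p_le: "norm (p z) \<le> \<epsilon> * K ^ n" if z: "z \<in> cball (of_real c) (4 * a)" for z
  proof -
    have zx: "norm (z - of_real (x j)) \<le> 9 / 2 * a" if "j < n" for j
    proof -
      have "norm (z - of_real (x j)) \<le> norm (z - of_real c) + norm (of_real (x j) - complex_of_real c)"
        using norm_triangle_ineq4[of "z - of_real c" "of_real (x j) - of_real c"] by simp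
      then show ?thesis using near[OF xI[OF that]] z by (simp add: dist_norm norm_minus_commute)
    qed
    have summand: "norm (h (of_real (x i)) * (\<Prod>j\<in>{..<n} - {i}. (z - of_real (x j)) / (of_real (x i) - of_real (x j))))
        \<le> \<epsilon> * ((9 / 2 * a / \<eta>) ^ (n - 1) / fact (n - 1) * real ((n - 1) choose i))" if i: "i < n" for i
    proof -
      have c1: "card ({..<n} - {i}) = n - 1" using i by simp
      have "(\<Prod>j\<in>{..<n} - {i}. norm (z - of_real (x j))) \<le> (\<Prod>j\<in>{..<n} - {i}. 9 / 2 * a)"
        by (intro prod_mono) (use zx in auto)
      then have num: "(\<Prod>j\<in>{..<n} - {i}. norm (z - of_real (x j))) \<le> (9 / 2 * a) ^ (n - 1)" by (simp add: c1)
      have den: "\<eta> ^ (n - 1) * fact i * fact (n - 1 - i) \<le> (\<Prod>j\<in>{..<n} - {i}. norm (complex_of_real (x i) - of_real (x j)))"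
        using prod_abs_diff_ge[of n \<eta> x i, OF sep' _ i] \<eta>
        by (simp flip: of_real_diff)
      have "norm (\<Prod>j\<in>{..<n} - {i}. (z - of_real (x j)) / (of_real (x i) - of_real (x j)))
          = (\<Prod>j\<in>{..<n} - {i}. norm (z - of_real (x j))) / (\<Prod>j\<in>{..<n} - {i}. norm (complex_of_real (x i) - of_real (x j)))"
        by (simp add: prod_norm[symmetric] norm_divide prod_dividef)
      also have "\<dots> \<le> (9 / 2 * a) ^ (n - 1) / (\<eta> ^ (n - 1) * fact i * fact (n - 1 - i))"
        by (rule frac_le[OF _ num _ den]) (use a \<eta> in \<open>auto intro!: prod_nonneg\<close>)
      also have "\<dots> = (9 / 2 * a / \<eta>) ^ (n - 1) / fact (n - 1) * real ((n - 1) choose i)"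
        using i \<eta> by (subst binomial_fact) (auto simp: field_simps power_divide)
      finally have "norm (\<Prod>j\<in>{..<n} - {i}. (z - of_real (x j)) / (of_real (x i) - of_real (x j)))
          \<le> (9 / 2 * a / \<eta>) ^ (n - 1) / fact (n - 1) * real ((n - 1) choose i)" .
      then show ?thesis unfolding norm_mult using \<epsilon>[OF x[OF i]] \<epsilon>0 by (intro mult_mono) auto
    qed
    have "norm (p z) \<le> (\<Sum>i<n. \<epsilon> * ((9 / 2 * a / \<eta>) ^ (n - 1) / fact (n - 1) * real ((n - 1) choose i)))"
      unfolding p_def by (rule order_trans[OF norm_sum]) (intro sum_mono summand, simp)
    also have "\<dots> = \<epsilon> * ((9 / 2 * a / \<eta>) ^ (n - 1) / fact (n - 1) * (\<Sum>i<n. real ((n - 1) choose i)))"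
      by (simp add: sum_distrib_left)
    also have "(\<Sum>i<n. real ((n - 1) choose i)) = 2 ^ (n - 1)"
    proof -
      have "{..<n} = {..n - 1}" using n by auto
      then have "(\<Sum>i<n. real ((n - 1) choose i)) = real (\<Sum>i\<le>n - 1. (n - 1) choose i)" by simp
      then show ?thesis unfolding choose_row_sum by simp
    qed
    also have "(9 / 2 * a / \<eta>) ^ (n - 1) / fact (n - 1) * 2 ^ (n - 1)
        = (18 * a / \<sigma>) ^ (n - 1) * (real n ^ (n - 1) / fact (n - 1))"
    proof -
      have "9 / 2 * a / \<eta> * 2 = 18 * a / \<sigma> * real n" using n \<sigma> by (simp add: \<eta>_def field_simps)
      then have "(9 / 2 * a / \<eta>) ^ (n - 1) * 2 ^ (n - 1) = (18 * a / \<sigma>) ^ (n - 1) * real n ^ (n - 1)"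
        by (metis power_mult_distrib)
      then show ?thesis by (metis (no_types) times_divide_eq_left times_divide_eq_right)
    qed
    also have "\<epsilon> * ((18 * a / \<sigma>) ^ (n - 1) * (real n ^ (n - 1) / fact (n - 1))) \<le> \<epsilon> * K ^ n"
    proof (rule mult_left_mono[OF _ \<epsilon>0])
      have "real n ^ (n - 1) / fact (n - 1) \<le> exp (real n)"
        using power_le_fact_exp[of n] by (simp add: field_simps)
      then have "(18 * a / \<sigma>) ^ (n - 1) * (real n ^ (n - 1) / fact (n - 1)) \<le> (18 * a / \<sigma>) ^ (n - 1) * exp (real n)"
        using a \<sigma> by (intro mult_left_mono) auto
      also have "\<dots> \<le> (18 * a / \<sigma>) ^ n * exp (real n)"
        using a \<sigma> \<sigma>a by (intro mult_right_mono power_increasing) (auto simp: field_simps)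
      also have "\<dots> = K ^ n"
        by (simp add: K_def power_mult_distrib power_divide exp_of_nat_mult[of n 1, symmetric] mult_ac flip: exp_of_nat_mult)
      finally show "(18 * a / \<sigma>) ^ (n - 1) * (real n ^ (n - 1) / fact (n - 1)) \<le> K ^ n" .
    qed
    finally show ?thesis .
  qed
  have "(\<lambda>z. h z - p z) holomorphic_on U" by (intro holomorphic_intros h p_hol)
  then obtain k where k: "k holomorphic_on U" "\<And>z. z \<in> U \<Longrightarrow> h z - p z = (\<Prod>i<n. z - of_real (x i)) * k z"
  proof (rule holomorphic_factor_zeros[OF U(1), where x = "\<lambda>i. complex_of_real (x i)" and n = n])
    show "complex_of_real (x i) \<in> U" if "i < n" for i
      using near[OF xI[OF that]] a U(2) by (auto simp: dist_norm norm_minus_commute subset_iff)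
    show "inj_on (\<lambda>i. complex_of_real (x i)) {..<n}" using inj by (auto simp: inj_on_def)
  qed (use p_nodes in auto)
  \<comment> \<open>On the bounding circle every node is at distance at least
    \<open>4 * a - a / 2\<close>, whereas from a point of the middle interval it is at distance at
    most \<open>a\<close>; each zero therefore gains a factor \<open>2 / 7\<close>.\<close>
  have k_le: "norm (k (of_real x0)) \<le> (A + \<epsilon> * K ^ n) / (7 / 2 * a) ^ n"
  proof (rule maximum_modulus_frontier[of k "cball (of_real c) (4 * a)"])
    show "k holomorphic_on interior (cball (complex_of_real c) (4 * a))"
      by (rule holomorphic_on_subset[OF k(1)]) (use U(2) interior_subset in blast)
    show "continuous_on (closure (cball (complex_of_real c) (4 * a))) k"
      using holomorphic_on_imp_continuous_on[OF k(1)] U(2) by (simp add: continuous_on_subset)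
    show "complex_of_real x0 \<in> cball (complex_of_real c) (4 * a)"
      using near[OF x0] a by (simp add: dist_norm norm_minus_commute)
    fix z assume "z \<in> frontier (cball (complex_of_real c) (4 * a))"
    then have z: "norm (z - of_real c) = 4 * a" using a by (simp add: frontier_cball dist_norm norm_minus_commute)
    then have zc: "z \<in> cball (of_real c) (4 * a)" by (simp add: dist_norm norm_minus_commute)
    then have zU: "z \<in> U" using U(2) by blast
    have "7 / 2 * a \<le> norm (z - of_real (x i))" if "i < n" for i
      using norm_triangle_ineq2[of "z - of_real c" "of_real (x i) - of_real c"] near[OF xI[OF that]] z by simp
    then have "(\<Prod>i<n. 7 / 2 * a) \<le> (\<Prod>i<n. norm (z - of_real (x i)))"
      by (intro prod_mono) (use a in auto)
    then have den: "(7 / 2 * a) ^ n \<le> norm (\<Prod>i<n. z - of_real (x i))" by (simp add: prod_norm)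
    then have den0: "norm (\<Prod>i<n. z - of_real (x i)) > 0"
      using a by (smt (verit) zero_less_power divide_pos_pos mult_pos_pos)
    have "norm (h z - p z) \<le> A + \<epsilon> * K ^ n"
      using norm_triangle_ineq4[of "h z" "p z"] A[OF zc] p_le[OF zc] by linarith
    moreover have "norm (k z) = norm (h z - p z) / norm (\<Prod>i<n. z - of_real (x i))"
      using den0 k(2)[OF zU] by (simp add: norm_mult)
    ultimately show "norm (k z) \<le> (A + \<epsilon> * K ^ n) / (7 / 2 * a) ^ n"
      using den a AK by (simp only:) (intro frac_le; simp)
  qed auto
  have x0U: "of_real x0 \<in> U" and x0c: "complex_of_real x0 \<in> cball (of_real c) (4 * a)"
    using near[OF x0] a U(2) by (auto simp: dist_norm norm_minus_commute subset_iff)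
  have "norm (\<Prod>i<n. of_real x0 - complex_of_real (x i)) \<le> a ^ n"
  proof -
    have "norm (of_real x0 - complex_of_real (x i)) \<le> a" if "i < n" for i
      using norm_triangle_ineq4[of "of_real x0 - complex_of_real c" "of_real (x i) - of_real c"] near[OF x0] near[OF xI[OF that]] by simp
    then have "(\<Prod>i<n. norm (of_real x0 - complex_of_real (x i))) \<le> (\<Prod>i<n. a)"
      by (intro prod_mono) auto
    then show ?thesis by (simp add: prod_norm)
  qed
  then have "norm (h (of_real x0) - p (of_real x0)) \<le> a ^ n * ((A + \<epsilon> * K ^ n) / (7 / 2 * a) ^ n)"
    unfolding k(2)[OF x0U] norm_mult using k_le a by (intro mult_mono) auto
  also have "\<dots> = (A + \<epsilon> * K ^ n) / (7 / 2) ^ n"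
  proof -
    have "(7 / 2 * a) ^ n = (7 / 2) ^ n * a ^ n" by (rule power_mult_distrib)
    then show ?thesis using a by simp
  qed
  \<comment> \<open>\<open>2 / 7\<close> is weakened to \<open>1 / 3\<close>. The base 3 still
    exceeds exp 1, which is what the later choice of \<open>n\<close> relies on.\<close>
  also have "\<dots> \<le> (A + \<epsilon> * K ^ n) / 3 ^ n"
    using A0 \<epsilon>0 a \<sigma> by (intro divide_left_mono power_mono) (auto simp: K_def)
  also have "\<dots> \<le> A / 3 ^ n + \<epsilon> * K ^ n"
  proof -
    have "\<epsilon> * K ^ n / 3 ^ n \<le> \<epsilon> * K ^ n / 1"
      using \<epsilon>0 a \<sigma> by (intro divide_left_mono) (auto simp: K_def)
    then show ?thesis by (simp add: add_divide_distrib)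
  qed
  finally have "norm (h (of_real x0) - p (of_real x0)) \<le> A / 3 ^ n + \<epsilon> * K ^ n" .
  then show ?thesis
    using norm_triangle_ineq2[of "h (of_real x0)" "p (of_real x0)"] p_le[OF x0c] by (simp add: K_def)
qed

section \<open>Pointwise bounds from integral bounds\<close>

text \<open>Somewhere \<open>u\<^sup>2\<close> is at most its mean value; the oscillation carries
  this value to every other point.\<close>

lemma bound_by_L2_and_oscillation:
  fixes u :: "real \<Rightarrow> real"
  assumes se: "s < e" and u: "continuous_on {s..e} u" and P: "P \<ge> 0" "integral {s..e} (\<lambda>x. (u x)\<^sup>2) \<le> P\<^sup>2"
    and osc: "\<And>x y. x \<in> {s..e} \<Longrightarrow> y \<in> {s..e} \<Longrightarrow> \<bar>u x - u y\<bar> \<le> \<Omega>" and x: "x \<in> {s..e}"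
  shows "\<bar>u x\<bar> \<le> P / sqrt (e - s) + \<Omega>"
proof -
  have "\<exists>y\<in>{s..e}. (u y)\<^sup>2 \<le> P\<^sup>2 / (e - s)"
  proof (rule ccontr)
    assume "\<not> ?thesis"
    then have gt: "P\<^sup>2 / (e - s) < (u y)\<^sup>2" if "y \<in> {s..e}" for y using that by (simp add: not_le)
    have "continuous_on {s..e} (\<lambda>x. (u x)\<^sup>2)" by (intro continuous_intros u)
    then obtain y where y: "y \<in> {s..e}" "\<And>z. z \<in> {s..e} \<Longrightarrow> (u y)\<^sup>2 \<le> (u z)\<^sup>2"
      using continuous_attains_inf[of "{s..e}" "\<lambda>x. (u x)\<^sup>2"] se by auto
    have "(u y)\<^sup>2 * (e - s) \<le> integral {s..e} (\<lambda>x. (u x)\<^sup>2)"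
    proof -
      have "integral {s..e} (\<lambda>_. (u y)\<^sup>2) \<le> integral {s..e} (\<lambda>x. (u x)\<^sup>2)"
        by (intro integral_le integrable_continuous_interval continuous_intros u) (use y in auto)
      then show ?thesis using se by (simp add: mult.commute)
    qed
    moreover have "P\<^sup>2 < (u y)\<^sup>2 * (e - s)" using gt[OF y(1)] se by (simp add: field_simps)
    ultimately show False using P by simp
  qed
  then obtain y where y: "y \<in> {s..e}" "(u y)\<^sup>2 \<le> P\<^sup>2 / (e - s)" by blast
  have "\<bar>u y\<bar> \<le> sqrt (P\<^sup>2 / (e - s))" using y(2) real_le_rsqrt by simp
  also have "\<dots> = P / sqrt (e - s)" using P by (simp add: real_sqrt_divide)
  finally show ?thesis using osc[OF x y(1)] by linarith
qed

text \<open>The inequality |t| <= (t^2 / P + P) / 2 under the integral sign replaces Cauchy-Schwarz,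
  at the cost of a constant that depends on the length only.\<close>

lemma oscillation_by_L2:
  fixes u u' :: "real \<Rightarrow> real"
  assumes du: "\<And>x. x \<in> {s..e} \<Longrightarrow> (u has_real_derivative u' x) (at x within {s..e})"
    and u': "continuous_on {s..e} u'" and P: "P > 0" "integral {s..e} (\<lambda>x. (u' x)\<^sup>2) \<le> P\<^sup>2"
    and xy: "x \<in> {s..e}" "y \<in> {s..e}"
  shows "\<bar>u x - u y\<bar> \<le> P * (1 + (e - s)) / 2"
proof -
  have le: "\<bar>u y - u x\<bar> \<le> P * (1 + (e - s)) / 2" if xy: "s \<le> x" "x \<le> y" "y \<le> e" for x y
  proof -
    have ftc: "(u' has_integral (u y - u x)) {x..y}"
      by (rule fundamental_theorem_of_calculus)
         (use xy in \<open>auto simp flip: has_real_derivative_iff_has_vector_derivative intro!: DERIV_subset[OF du]\<close>)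
    have c: "continuous_on {s..e} (\<lambda>t. ((u' t)\<^sup>2 / P + P) / 2)" by (intro continuous_intros u') (use P in auto)
    have "norm (integral {x..y} u') \<le> integral {x..y} (\<lambda>t. ((u' t)\<^sup>2 / P + P) / 2)"
    proof (rule Henstock_Kurzweil_Integration.integral_norm_bound_integral)
      show "norm (u' t) \<le> ((u' t)\<^sup>2 / P + P) / 2" for t
        using sum_squares_bound[of "\<bar>u' t\<bar>" P] P by (simp add: field_simps power2_eq_square)
      show "u' integrable_on {x..y}" using ftc by blast
      show "(\<lambda>t. ((u' t)\<^sup>2 / P + P) / 2) integrable_on {x..y}"
        by (rule integrable_continuous_interval[OF continuous_on_subset[OF c]]) (use xy in auto)
    qed
    also have "\<dots> \<le> integral {s..e} (\<lambda>t. ((u' t)\<^sup>2 / P + P) / 2)"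
    proof (rule integral_subset_le)
      show "(\<lambda>t. ((u' t)\<^sup>2 / P + P) / 2) integrable_on {x..y}"
        by (rule integrable_continuous_interval[OF continuous_on_subset[OF c]]) (use xy in auto)
      show "(\<lambda>t. ((u' t)\<^sup>2 / P + P) / 2) integrable_on {s..e}"
        by (rule integrable_continuous_interval[OF c])
    qed (use xy P in auto)
    also have "\<dots> = (integral {s..e} (\<lambda>t. (u' t)\<^sup>2) / P + P * (e - s)) / 2"
    proof -
      have "((\<lambda>t. ((u' t)\<^sup>2 / P + P) / 2) has_integral (integral {s..e} (\<lambda>t. (u' t)\<^sup>2) / P + P * (e - s)) / 2) {s..e}"
        by (intro has_integral_divide has_integral_add integrable_integral integrable_continuous_interval continuous_intros u')
           (use has_integral_const_real[of P s e] xy in \<open>auto simp: mult.commute\<close>)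
      then show ?thesis by (rule integral_unique)
    qed
    also have "\<dots> \<le> (P\<^sup>2 / P + P * (e - s)) / 2"
      using P by (intro divide_right_mono add_right_mono) auto
    also have "\<dots> = P * (1 + (e - s)) / 2" using P by (simp add: power2_eq_square algebra_simps)
    finally show ?thesis using ftc by (simp add: integral_unique)
  qed
  show ?thesis using le[of x y] le[of y x] xy by (cases "x \<le> y") (auto simp: abs_minus_commute)
qed

section \<open>Hyperbolic functions as power series in the eigenvalue\<close>

text \<open>The solution of s'' = \<mu> s with s(0) = 0 and s'(0) = 1. Dividing by
  \<open>sqrt \<mu>\<close> leaves a power series in \<open>\<mu>\<close> without fractional powers,
  which the moment bounds below require.\<close>

definition sinhc :: "real \<Rightarrow> real \<Rightarrow> real" where
  "sinhc \<mu> y = sinh (sqrt \<mu> * y) / sqrt \<mu>"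

lemma cosh_sqrt_sums:
  assumes "\<mu> \<ge> 0" shows "(\<lambda>m. \<mu> ^ m * (y ^ (2 * m) / fact (2 * m))) sums cosh (sqrt \<mu> * y)"
proof -
  let ?f = "\<lambda>n. if even n then (sqrt \<mu> * y) ^ n /\<^sub>R fact n else 0"
  have "(\<lambda>m. ?f (2 * m)) sums cosh (sqrt \<mu> * y)"
    by (subst sums_mono_reindex) (auto simp: strict_mono_def cosh_converges elim!: evenE)
  moreover have "?f (2 * m) = \<mu> ^ m * (y ^ (2 * m) / fact (2 * m))" for m
  proof -
    have p: "sqrt \<mu> ^ (2 * m) = \<mu> ^ m" using assms by (simp add: power_mult)
    show ?thesis by (simp add: power_mult_distrib p divide_inverse)
  qed
  ultimately show ?thesis by simp
qed

lemma sinhc_sums: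
  assumes "\<mu> > 0" shows "(\<lambda>m. \<mu> ^ m * (y ^ (2 * m + 1) / fact (2 * m + 1))) sums sinhc \<mu> y"
proof -
  let ?f = "\<lambda>n. if even n then 0 else (sqrt \<mu> * y) ^ n /\<^sub>R fact n"
  have "(\<lambda>m. ?f (2 * m + 1)) sums sinh (sqrt \<mu> * y)"
    by (subst sums_mono_reindex) (auto simp: strict_mono_def sinh_converges elim!: oddE)
  then have "(\<lambda>m. ?f (2 * m + 1) / sqrt \<mu>) sums sinhc \<mu> y"
    unfolding sinhc_def by (rule sums_divide)
  moreover have "?f (2 * m + 1) / sqrt \<mu> = \<mu> ^ m * (y ^ (2 * m + 1) / fact (2 * m + 1))" for m
  proof -
    have "sqrt \<mu> ^ (2 * m + 1) = \<mu> ^ m * sqrt \<mu>" using assms by (simp add: power_mult)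
    then show ?thesis using assms by (simp add: power_mult_distrib field_simps del: power_Suc fact_Suc)
  qed
  ultimately show ?thesis by simp
qed

lemma abs_sums_le:
  fixes f g :: "nat \<Rightarrow> real"
  assumes "f sums a" "g sums b" "\<And>m. \<bar>f m\<bar> \<le> g m"
  shows "\<bar>a\<bar> \<le> b"
  using norm_suminf_le[of f g] assms by (simp add: sums_iff)

text \<open>Expanding in powers of \<open>\<mu>\<close> expresses the sums through the moments of
  \<open>g\<close>, so cancellation between different \<open>\<mu>\<close> is respected. Term by
  term the result is as if a single eigenvalue \<open>T\<close> were present.\<close>

lemma abs_sum_cosh_le:
  fixes g :: "real \<Rightarrow> real"
  assumes \<Lambda>: "finite \<Lambda>" "\<And>\<mu>. \<mu> \<in> \<Lambda> \<Longrightarrow> \<mu> > 0" and T: "T > 0" and y: "\<bar>y\<bar> \<le> Y"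
    and b: "\<And>m. \<bar>\<Sum>\<mu>\<in>\<Lambda>. \<mu> ^ m * g \<mu>\<bar> \<le> A * T ^ m"
  shows "\<bar>\<Sum>\<mu>\<in>\<Lambda>. cosh (sqrt \<mu> * y) * g \<mu>\<bar> \<le> A * exp (sqrt T * Y)"
    and "\<bar>\<Sum>\<mu>\<in>\<Lambda>. sinhc \<mu> y * g \<mu>\<bar> \<le> A * (exp (sqrt T * Y) / sqrt T)"
proof -
  have A: "A \<ge> 0" using b[of 0] by simp
  have Y: "Y \<ge> 0" using y by simp
  have "(\<lambda>m. \<Sum>\<mu>\<in>\<Lambda>. \<mu> ^ m * (y ^ (2 * m) / fact (2 * m)) * g \<mu>) sums (\<Sum>\<mu>\<in>\<Lambda>. cosh (sqrt \<mu> * y) * g \<mu>)"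
    by (intro sums_sum sums_mult2 cosh_sqrt_sums) (use \<Lambda> less_imp_le in auto)
  moreover have "(\<lambda>m. A * (T ^ m * (Y ^ (2 * m) / fact (2 * m)))) sums (A * cosh (sqrt T * Y))"
    by (intro sums_mult cosh_sqrt_sums) (use T in auto)
  moreover have "\<bar>\<Sum>\<mu>\<in>\<Lambda>. \<mu> ^ m * (y ^ (2 * m) / fact (2 * m)) * g \<mu>\<bar> \<le> A * (T ^ m * (Y ^ (2 * m) / fact (2 * m)))" for m
  proof -
    have "(\<Sum>\<mu>\<in>\<Lambda>. \<mu> ^ m * (y ^ (2 * m) / fact (2 * m)) * g \<mu>) = (\<Sum>\<mu>\<in>\<Lambda>. \<mu> ^ m * g \<mu>) * (y ^ (2 * m) / fact (2 * m))"
      unfolding sum_distrib_right by (intro sum.cong) simp_all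
    also have "\<bar>\<dots>\<bar> = \<bar>\<Sum>\<mu>\<in>\<Lambda>. \<mu> ^ m * g \<mu>\<bar> * (\<bar>y\<bar> ^ (2 * m) / fact (2 * m))"
      by (simp add: abs_mult power_abs)
    also have "\<dots> \<le> (A * T ^ m) * (Y ^ (2 * m) / fact (2 * m))"
      using A T y by (intro mult_mono b divide_right_mono power_mono) auto
    finally show ?thesis by (simp add: mult_ac)
  qed
  ultimately have "\<bar>\<Sum>\<mu>\<in>\<Lambda>. cosh (sqrt \<mu> * y) * g \<mu>\<bar> \<le> A * cosh (sqrt T * Y)"
    by (rule abs_sums_le)
  also have "\<dots> \<le> A * exp (sqrt T * Y)"
    using A T Y by (intro mult_left_mono) (auto simp: cosh_field_def)
  finally show "\<bar>\<Sum>\<mu>\<in>\<Lambda>. cosh (sqrt \<mu> * y) * g \<mu>\<bar> \<le> A * exp (sqrt T * Y)" .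
next
  have A: "A \<ge> 0" using b[of 0] by simp
  have Y: "Y \<ge> 0" using y by simp
  have "(\<lambda>m. \<Sum>\<mu>\<in>\<Lambda>. \<mu> ^ m * (y ^ (2 * m + 1) / fact (2 * m + 1)) * g \<mu>) sums (\<Sum>\<mu>\<in>\<Lambda>. sinhc \<mu> y * g \<mu>)"
    by (intro sums_sum sums_mult2 sinhc_sums) (use \<Lambda> in auto)
  moreover have "(\<lambda>m. A * (T ^ m * (Y ^ (2 * m + 1) / fact (2 * m + 1)))) sums (A * sinhc T Y)"
    by (intro sums_mult sinhc_sums) (use T in auto)
  moreover have "\<bar>\<Sum>\<mu>\<in>\<Lambda>. \<mu> ^ m * (y ^ (2 * m + 1) / fact (2 * m + 1)) * g \<mu>\<bar> \<le> A * (T ^ m * (Y ^ (2 * m + 1) / fact (2 * m + 1)))" for m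
  proof -
    have "(\<Sum>\<mu>\<in>\<Lambda>. \<mu> ^ m * (y ^ (2 * m + 1) / fact (2 * m + 1)) * g \<mu>) = (\<Sum>\<mu>\<in>\<Lambda>. \<mu> ^ m * g \<mu>) * (y ^ (2 * m + 1) / fact (2 * m + 1))"
      unfolding sum_distrib_right by (intro sum.cong) simp_all
    also have "\<bar>\<dots>\<bar> = \<bar>\<Sum>\<mu>\<in>\<Lambda>. \<mu> ^ m * g \<mu>\<bar> * (\<bar>y\<bar> ^ (2 * m + 1) / fact (2 * m + 1))"
      by (simp add: abs_mult power_abs)
    also have "\<dots> \<le> (A * T ^ m) * (Y ^ (2 * m + 1) / fact (2 * m + 1))"
      using A T y by (intro mult_mono b divide_right_mono power_mono) auto
    finally show ?thesis by (simp add: mult_ac)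
  qed
  ultimately have "\<bar>\<Sum>\<mu>\<in>\<Lambda>. sinhc \<mu> y * g \<mu>\<bar> \<le> A * sinhc T Y"
    by (rule abs_sums_le)
  also have "\<dots> \<le> A * (exp (sqrt T * Y) / sqrt T)"
  proof (intro mult_left_mono A)
    have "sinh (sqrt T * Y) \<le> exp (sqrt T * Y)"
    proof -
      have *: "(p - q) / 2 \<le> p" if "p > 0" "q > 0" for p q :: real using that by simp
      show ?thesis unfolding sinh_field_def by (rule *) simp_all
    qed
    then show "sinhc T Y \<le> exp (sqrt T * Y) / sqrt T"
      unfolding sinhc_def using T by (intro divide_right_mono) auto
  qed
  finally show "\<bar>\<Sum>\<mu>\<in>\<Lambda>. sinhc \<mu> y * g \<mu>\<bar> \<le> A * (exp (sqrt T * Y) / sqrt T)" .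
qed

section \<open>Propagation of smallness on one interval\<close>

lemma has_vector_derivative_of_real_line:
  assumes "(F has_real_derivative d) (at x)"
  shows "((\<lambda>s. complex_of_real (F (x + s))) has_vector_derivative of_real d) (at 0)"
proof -
  have "((\<lambda>s. F (x + s)) has_real_derivative d) (at 0)"
    using assms by (simp add: DERIV_shift[of F d 0 x, symmetric] add.commute)
  then show ?thesis
    by (intro has_vector_derivative_of_real) (simp add: has_real_derivative_iff_has_vector_derivative)
qed

text \<open>The window has length \<open>10 * a\<close> so that the disc of radius
  \<open>4 * a\<close> about its centre lies in the box of half-height \<open>5 * a\<close> on which
  the extension lives. \<open>A\<close> may be much larger than the value to be estimated; the
  factor \<open>3 ^ n\<close> is there to beat it.\<close>

lemma propagation_of_smallness:
  fixes V :: "real \<Rightarrow> real" and g g' :: "real \<Rightarrow> real \<Rightarrow> real" and \<Lambda> S :: "real set"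
  defines "c s a \<equiv> s + 5 * a"
  assumes a: "a > 0" and M: "M \<ge> 1" and E: "E \<ge> 1" "E \<le> M\<^sup>2"
    and V: "V \<in> borel_measurable lebesgue"
    and Vb: "\<And>x. x \<in> {s..s + 10 * a} \<Longrightarrow> 0 \<le> V x" "\<And>x. x \<in> {s..s + 10 * a} \<Longrightarrow> V x \<le> M\<^sup>2"
    and \<Lambda>: "finite \<Lambda>" "\<And>\<mu>. \<mu> \<in> \<Lambda> \<Longrightarrow> \<mu> > 0"
    and dg: "\<And>\<mu> x. \<mu> \<in> \<Lambda> \<Longrightarrow> (g \<mu> has_real_derivative g' \<mu> x) (at x)"
    and ig: "\<And>\<mu> x y. \<mu> \<in> \<Lambda> \<Longrightarrow> x \<le> y \<Longrightarrow> ((\<lambda>t. (V t - \<mu>) * g \<mu> t) has_integral (g' \<mu> y - g' \<mu> x)) {x..y}"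
    and b: "\<And>m x. x \<in> {s..s + 10 * a} \<Longrightarrow> \<bar>\<Sum>\<mu>\<in>\<Lambda>. \<mu> ^ m * g \<mu> x\<bar> \<le> A * (2 * E) ^ m"
    and b': "\<And>m x. x \<in> {s..s + 10 * a} \<Longrightarrow> \<bar>\<Sum>\<mu>\<in>\<Lambda>. \<mu> ^ m * g' \<mu> x\<bar> \<le> A * (2 * E) ^ m"
    and S: "S \<in> sets lebesgue" "S \<subseteq> {c s a - a / 2..c s a + a / 2}" and \<sigma>: "0 < \<sigma>" "\<sigma> \<le> measure lebesgue S"
    and \<epsilon>: "\<And>x. x \<in> S \<Longrightarrow> \<bar>\<Sum>\<mu>\<in>\<Lambda>. g \<mu> x\<bar> \<le> \<epsilon>"
    and x0: "x0 \<in> {c s a - a / 2..c s a + a / 2}" and n: "n > 0"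
  shows "\<bar>\<Sum>\<mu>\<in>\<Lambda>. g \<mu> x0\<bar> \<le> exp (M * cauchy_const (10 * a)) *
      (2 * \<epsilon> * (18 * exp 1 * a / \<sigma>) ^ n + (2 + M) * A * exp (10 * a * M) / 3 ^ n)"
proof -
  define e where "e = s + 10 * a"
  define J where "J = {s..e}"
  define c0 where "c0 = s + 5 * a"
  have se: "s < e" using a by (simp add: e_def)
  note Vb = Vb[folded e_def] and b = b[folded e_def J_def] and b' = b'[folded e_def J_def]
  have M0: "M > 0" using M by simp
  obtain w w' where dw: "\<And>x. x \<in> {s..e} \<Longrightarrow> (w has_real_derivative w' x) (at x within {s..e})"
    and w': "\<And>x. x \<in> {s..e} \<Longrightarrow> w' x = integral {s..x} (\<lambda>t. V t * w t)"
    and cw: "continuous_on {s..e} w" and ws: "w s = 1"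
    using positive_solution_exists[OF less_imp_le[OF se] V M0 Vb] by metis
  have wb: "w x > 0" "0 \<le> w' x" "w' x \<le> M * w x" if x: "x \<in> {s..e}" for x
    by (rule positive_solution_bounds[OF less_imp_le[OF se] V M0 Vb dw w' cw ws x]; assumption)+
  have int_Vw: "(\<lambda>t. V t * w t) integrable_on {s..e}"
  proof -
    have "bounded (V ` {s..e})" unfolding bounded_iff using Vb by (intro exI[of _ "M\<^sup>2"]) auto
    then have "(\<lambda>t. V t * w t) absolutely_integrable_on {s..e}"
      using V cw by (intro absolutely_integrable_bounded_measurable_product_real measurable_restrict_space1 absolutely_integrable_continuous_real) auto
    then show ?thesis by (rule set_lebesgue_integral_eq_integral(1))
  qed
  have cw': "continuous_on {s..e} w'"
    using indefinite_integral_continuous_1[OF int_Vw] by (rule continuous_on_eq) (simp add: w')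
  have w's: "w' s = 0" using w'[of s] se by simp
  obtain Aw where Aw: "\<And>x. x \<in> {s..e} \<Longrightarrow> \<bar>w x\<bar> \<le> Aw"
  proof -
    have "compact (w ` {s..e})" by (intro compact_continuous_image cw) auto
    then obtain A where "A > 0" "\<forall>x\<in>w ` {s..e}. norm x \<le> A" using compact_imp_bounded bounded_pos by metis
    then show ?thesis using that[of A] by auto
  qed
  have cg: "continuous_on X (g \<mu>)" if "\<mu> \<in> \<Lambda>" for \<mu> X
    using dg[OF that] by (meson DERIV_continuous_on has_field_derivative_at_within)
  have cg': "continuous_on {s..e} (g' \<mu>)" if \<mu>: "\<mu> \<in> \<Lambda>" for \<mu>
  proof -
    have "(\<lambda>t. (V t - \<mu>) * g \<mu> t) integrable_on {s..e}" using ig[OF \<mu>, of s e] se by auto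
    then have "continuous_on {s..e} (\<lambda>x. g' \<mu> s + integral {s..x} (\<lambda>t. (V t - \<mu>) * g \<mu> t))"
      by (intro continuous_intros indefinite_integral_continuous_1)
    then show ?thesis
    proof (rule continuous_on_eq)
      fix x assume "x \<in> {s..e}"
      then show "g' \<mu> s + integral {s..x} (\<lambda>t. (V t - \<mu>) * g \<mu> t) = g' \<mu> x"
        using integral_unique[OF ig[OF \<mu>, of s x]] by simp
    qed
  qed
  \<comment> \<open>The Wronskian \<open>w g' - w' g\<close> is continuously differentiable although \<open>V\<close> is only measurable.\<close>
  define z where "z \<mu> x = w x * g' \<mu> x - w' x * g \<mu> x" for \<mu> x
  have zint: "((\<lambda>t. - \<mu> * w t * g \<mu> t) has_integral (z \<mu> x - z \<mu> s)) {s..x}" if \<mu>: "\<mu> \<in> \<Lambda>" and x: "x \<in> {s..e}" for \<mu> x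
  proof -
    obtain G where G: "\<And>t. t \<in> {s..e} \<Longrightarrow> \<bar>g \<mu> t\<bar> \<le> G"
    proof -
      have "compact (g \<mu> ` {s..e})" by (intro compact_continuous_image cg[OF \<mu>]) auto
      then obtain A where "A > 0" "\<forall>x\<in>g \<mu> ` {s..e}. norm x \<le> A" using compact_imp_bounded bounded_pos by metis
      then show ?thesis using that[of A] by auto
    qed
    have 1: "((\<lambda>t. w' t * g' \<mu> t + w t * ((V t - \<mu>) * g \<mu> t)) has_integral (w x * g' \<mu> x - w s * g' \<mu> s)) {s..x}"
    proof (rule integration_by_parts_bounded[where C = "(M\<^sup>2 + \<mu>) * G"])
      show "(w has_real_derivative w' t) (at t within {s..x})" if "t \<in> {s..x}" for t
        by (rule DERIV_subset[OF dw]) (use that x in auto)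
      show "continuous_on {s..x} w'" by (rule continuous_on_subset[OF cw']) (use x in auto)
      show "(\<lambda>t. (V t - \<mu>) * g \<mu> t) integrable_on {s..x}" using ig[OF \<mu>, of s x] x by auto
      show "g' \<mu> t = g' \<mu> s + integral {s..t} (\<lambda>t. (V t - \<mu>) * g \<mu> t)" if "t \<in> {s..x}" for t
        using integral_unique[OF ig[OF \<mu>, of s t]] that by simp
      show "\<bar>(V t - \<mu>) * g \<mu> t\<bar> \<le> (M\<^sup>2 + \<mu>) * G" if "t \<in> {s..x}" for t
        unfolding abs_mult using Vb[of t] G[of t] \<Lambda>(2)[OF \<mu>] that x by (intro mult_mono) (auto simp: abs_le_iff)
    qed (use x in auto)
    have 2: "((\<lambda>t. g' \<mu> t * w' t + g \<mu> t * (V t * w t)) has_integral (g \<mu> x * w' x - g \<mu> s * w' s)) {s..x}"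
    proof (rule integration_by_parts_bounded[where C = "M\<^sup>2 * Aw"])
      show "(g \<mu> has_real_derivative g' \<mu> t) (at t within {s..x})" for t
        by (rule has_field_derivative_at_within[OF dg[OF \<mu>]])
      show "continuous_on {s..x} (g' \<mu>)" by (rule continuous_on_subset[OF cg'[OF \<mu>]]) (use x in auto)
      show "(\<lambda>t. V t * w t) integrable_on {s..x}" by (rule integrable_on_subinterval[OF int_Vw]) (use x in auto)
      show "w' t = w' s + integral {s..t} (\<lambda>t. V t * w t)" if "t \<in> {s..x}" for t
        using w'[of t] w's that x by simp
      show "\<bar>V t * w t\<bar> \<le> M\<^sup>2 * Aw" if "t \<in> {s..x}" for t
        unfolding abs_mult using Vb[of t] Aw[of t] that x by (intro mult_mono) auto
    qed (use x in auto)
    show ?thesis using has_integral_diff[OF 1 2] by (simp add: z_def algebra_simps)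
  qed
  have dz: "(z \<mu> has_real_derivative - \<mu> * w x * g \<mu> x) (at x)" if \<mu>: "\<mu> \<in> \<Lambda>" and x: "x \<in> {s<..<e}" for \<mu> x
  proof -
    have "((\<lambda>x. integral {s..x} (\<lambda>t. - \<mu> * w t * g \<mu> t)) has_real_derivative - \<mu> * w x * g \<mu> x) (at x within {s..e})"
      by (rule integral_has_real_derivative) (use x in \<open>auto intro!: continuous_intros cw cg \<mu>\<close>)
    from DERIV_add[OF DERIV_const this, of "z \<mu> s"]
    have "((\<lambda>x. z \<mu> s + integral {s..x} (\<lambda>t. - \<mu> * w t * g \<mu> t)) has_real_derivative - \<mu> * w x * g \<mu> x) (at x within {s..e})"
      unfolding add_0 .
    then have "(z \<mu> has_real_derivative - \<mu> * w x * g \<mu> x) (at x within {s..e})"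
    proof (rule has_field_derivative_transform_within[where d = 1])
      fix y assume "y \<in> {s..e}"
      then show "z \<mu> s + integral {s..y} (\<lambda>t. - \<mu> * w t * g \<mu> t) = z \<mu> y"
        using integral_unique[OF zint[OF \<mu>]] by simp
    qed (use x in auto)
    then have "(z \<mu> has_real_derivative - \<mu> * w x * g \<mu> x) (at x within {s<..<e})"
      by (rule DERIV_subset) auto
    then show ?thesis using x at_within_open[of x "{s<..<e}"] by simp
  qed
  have dwi: "(w has_real_derivative w' x) (at x)" if x: "x \<in> {s<..<e}" for x
  proof -
    have "(w has_real_derivative w' x) (at x within {s<..<e})" by (rule DERIV_subset[OF dw]) (use x in auto)
    then show ?thesis using at_within_open[of x "{s<..<e}"] x by simp
  qed
  \<comment> \<open>Formally q' + q^2 = V, so \<open>g \<mu>\<close> and the \<open>B \<mu>\<close>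
    defined next satisfy the first order system g' = q g + B, B' = - \<mu> g - q B, from which
    \<open>V\<close> has disappeared.\<close>
  define q where "q x = w' x / w x" for x
  have q_le: "\<bar>q x\<bar> \<le> M" if "x \<in> {s..e}" for x
    using wb[OF that] by (simp add: q_def divide_le_eq)
  define B where "B \<mu> x = z \<mu> x / w x" for \<mu> x
  have B_eq: "B \<mu> x = g' \<mu> x - q x * g \<mu> x" if "x \<in> {s..e}" for \<mu> x
    using wb(1)[OF that] by (simp add: B_def q_def z_def field_simps)
  have dB: "(B \<mu> has_real_derivative (- \<mu> * g \<mu> x - q x * B \<mu> x)) (at x)" if \<mu>: "\<mu> \<in> \<Lambda>" and x: "x \<in> {s<..<e}" for \<mu> x
  proof -
    have wx: "w x \<noteq> 0" using wb(1)[of x] x by auto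
    have "((\<lambda>x. z \<mu> x / w x) has_real_derivative ((- \<mu> * w x * g \<mu> x) * w x - z \<mu> x * w' x) / (w x * w x)) (at x)"
      by (rule DERIV_divide[OF dz[OF \<mu> x] dwi[OF x] wx])
    moreover have "((- \<mu> * w x * g \<mu> x) * w x - z \<mu> x * w' x) / (w x * w x) = - \<mu> * g \<mu> x - q x * B \<mu> x"
      using wx by (simp add: B_def q_def field_simps)
    ultimately show ?thesis by (simp add: B_def[abs_def])
  qed
  define U where "U x y = (\<Sum>\<mu>\<in>\<Lambda>. cosh (sqrt \<mu> * y) * g \<mu> x)" for x y
  define Im' where "Im' x y = (\<Sum>\<mu>\<in>\<Lambda>. sinhc \<mu> y * B \<mu> x)" for x y
  \<comment> \<open>\<open>W\<close> extends \<open>\<Sum>\<mu>\<in>\<Lambda>. g \<mu>\<close> off the real axis so that \<open>Wx + \<i> * Wy = q * cnj W\<close>.\<close>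
  define W where "W u = of_real (U (fst u) (snd u)) + \<i> * of_real (Im' (fst u) (snd u))" for u
  define Wx where "Wx u = of_real (\<Sum>\<mu>\<in>\<Lambda>. cosh (sqrt \<mu> * snd u) * g' \<mu> (fst u))
      + \<i> * of_real (\<Sum>\<mu>\<in>\<Lambda>. sinhc \<mu> (snd u) * (- \<mu> * g \<mu> (fst u) - q (fst u) * B \<mu> (fst u)))" for u
  define Wy where "Wy u = of_real (\<Sum>\<mu>\<in>\<Lambda>. (sqrt \<mu> * sinh (sqrt \<mu> * snd u)) * g \<mu> (fst u))
      + \<i> * of_real (\<Sum>\<mu>\<in>\<Lambda>. cosh (sqrt \<mu> * snd u) * B \<mu> (fst u))" for u
  \<comment> \<open>The box lies in a disc of radius \<open>10 * a\<close>, whence the constant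
    \<open>cauchy_const (10 * a)\<close> in the conclusion.\<close>
  define D where "D = box (s, - (5 * a)) (e, 5 * a)"
  have D: "u \<in> D \<longleftrightarrow> fst u \<in> {s<..<e} \<and> \<bar>snd u\<bar> < 5 * a" for u
    by (cases u) (auto simp: D_def mem_box_pair)
  have D_ball: "D \<subseteq> cball (c0, 0) (10 * a)"
  proof
    fix u assume "u \<in> D"
    then have "\<bar>c0 - fst u\<bar> \<le> 5 * a" "\<bar>snd u\<bar> \<le> 5 * a" by (auto simp: D c0_def e_def)
    then have "norm (c0 - fst u, 0 - snd u) \<le> 5 * a + 5 * a"
      using norm_Pair_le[of "c0 - fst u" "0 - snd u"] by simp
    then show "u \<in> cball (c0, 0) (10 * a)" by (cases u) (simp add: dist_norm)
  qed
  have cgD: "continuous_on D (\<lambda>u. g \<mu> (fst u))" if "\<mu> \<in> \<Lambda>" for \<mu>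
    by (rule continuous_on_compose2[OF cg[OF that, of UNIV]]) (auto intro!: continuous_intros)
  have cg'D: "continuous_on D (\<lambda>u. g' \<mu> (fst u))" if "\<mu> \<in> \<Lambda>" for \<mu>
    by (rule continuous_on_compose2[OF cg'[OF that]]) (auto intro!: continuous_intros simp: D)
  have cq: "continuous_on {s..e} q"
    unfolding q_def[abs_def] by (intro continuous_intros cw cw') (use wb(1) in force)
  have cqD: "continuous_on D (\<lambda>u. q (fst u))"
    by (rule continuous_on_compose2[OF cq]) (auto intro!: continuous_intros simp: D)
  have cB: "continuous_on {s..e} (B \<mu>)" if "\<mu> \<in> \<Lambda>" for \<mu>
  proof -
    have "continuous_on {s..e} (\<lambda>x. g' \<mu> x - q x * g \<mu> x)" by (intro continuous_intros cg' cq cg that)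
    then show ?thesis by (rule continuous_on_eq) (simp add: B_eq)
  qed
  have cBD: "continuous_on D (\<lambda>u. B \<mu> (fst u))" if "\<mu> \<in> \<Lambda>" for \<mu>
    by (rule continuous_on_compose2[OF cB[OF that]]) (auto intro!: continuous_intros simp: D)
  have ccosh: "continuous_on D (\<lambda>u. cosh (sqrt \<mu> * snd u))" for \<mu> :: real
    unfolding cosh_field_def by (intro continuous_intros) auto
  have csinh: "continuous_on D (\<lambda>u. sinh (sqrt \<mu> * snd u))" for \<mu> :: real
    unfolding sinh_field_def by (intro continuous_intros) auto
  have csinhc: "continuous_on D (\<lambda>u. sinhc \<mu> (snd u))" if "\<mu> \<in> \<Lambda>" for \<mu>
    unfolding sinhc_def using \<Lambda>(2)[OF that] by (intro continuous_intros csinh) auto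
  have cW: "continuous_on D W" "continuous_on D Wx" "continuous_on D Wy"
    unfolding W_def[abs_def] U_def Im'_def Wx_def[abs_def] Wy_def[abs_def]
    by (intro continuous_intros ccosh csinh csinhc cgD cg'D cBD cqD; assumption)+
  have dWx: "((\<lambda>t. W (u + t *\<^sub>R (1, 0))) has_vector_derivative Wx u) (at 0)" if u: "u \<in> D" for u
  proof -
    obtain x y where xy: "u = (x, y)" by force
    have x: "x \<in> {s<..<e}" using u by (simp add: D xy)
    have d1: "((\<lambda>x. U x y) has_real_derivative (\<Sum>\<mu>\<in>\<Lambda>. cosh (sqrt \<mu> * y) * g' \<mu> x)) (at x)"
      unfolding U_def by (auto intro!: DERIV_sum DERIV_cmult dg)
    have d2: "((\<lambda>x. Im' x y) has_real_derivative (\<Sum>\<mu>\<in>\<Lambda>. sinhc \<mu> y * (- \<mu> * g \<mu> x - q x * B \<mu> x))) (at x)"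
      unfolding Im'_def by (intro DERIV_sum DERIV_cmult dB x)
    show ?thesis
      using has_vector_derivative_add[OF has_vector_derivative_of_real_line[OF d1]
          has_vector_derivative_mult_right[OF has_vector_derivative_of_real_line[OF d2], of \<i>]]
      unfolding W_def Wx_def xy by simp
  qed
  have dWy: "((\<lambda>t. W (u + t *\<^sub>R (0, 1))) has_vector_derivative Wy u) (at 0)" if u: "u \<in> D" for u
  proof -
    obtain x y where xy: "u = (x, y)" by force
    have d1: "((\<lambda>y. U x y) has_real_derivative (\<Sum>\<mu>\<in>\<Lambda>. (sqrt \<mu> * sinh (sqrt \<mu> * y)) * g \<mu> x)) (at y)"
      unfolding U_def by (auto intro!: derivative_eq_intros sum.cong)
    have ds: "((\<lambda>y. sinhc \<mu> y) has_real_derivative cosh (sqrt \<mu> * y)) (at y)" if "\<mu> \<in> \<Lambda>" for \<mu>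
      unfolding sinhc_def using \<Lambda>(2)[OF that] by (auto intro!: derivative_eq_intros simp: mult.assoc)
    have d2: "((\<lambda>y. Im' x y) has_real_derivative (\<Sum>\<mu>\<in>\<Lambda>. cosh (sqrt \<mu> * y) * B \<mu> x)) (at y)"
      unfolding Im'_def by (intro DERIV_sum DERIV_cmult_right ds)
    show ?thesis
      using has_vector_derivative_add[OF has_vector_derivative_of_real_line[OF d1]
          has_vector_derivative_mult_right[OF has_vector_derivative_of_real_line[OF d2], of \<i>]]
      unfolding W_def Wy_def xy by simp
  qed
  have dbar: "Wx u + \<i> * Wy u = of_real (q (fst u)) * cnj (W u)" if u: "u \<in> D" for u
  proof -
    obtain x y where xy: "u = (x, y)" by force
    have x: "x \<in> {s..e}" using u by (simp add: D xy)
    have 1: "(\<Sum>\<mu>\<in>\<Lambda>. cosh (sqrt \<mu> * y) * g' \<mu> x) - (\<Sum>\<mu>\<in>\<Lambda>. cosh (sqrt \<mu> * y) * B \<mu> x) = q x * U x y"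
      unfolding U_def sum_distrib_left sum_subtractf[symmetric]
      by (intro sum.cong refl) (simp add: B_eq[OF x] algebra_simps)
    have 2: "(\<Sum>\<mu>\<in>\<Lambda>. sinhc \<mu> y * (- \<mu> * g \<mu> x - q x * B \<mu> x)) + (\<Sum>\<mu>\<in>\<Lambda>. (sqrt \<mu> * sinh (sqrt \<mu> * y)) * g \<mu> x) = - (q x * Im' x y)"
      unfolding Im'_def sum_distrib_left sum.distrib[symmetric] sum_negf[symmetric]
    proof (intro sum.cong refl)
      fix \<mu> assume "\<mu> \<in> \<Lambda>"
      then have "\<mu> > 0" using \<Lambda> by blast
      then have "sinhc \<mu> y * \<mu> = sqrt \<mu> * sinh (sqrt \<mu> * y)"
        unfolding sinhc_def by (simp add: divide_simps)
      then show "sinhc \<mu> y * (- \<mu> * g \<mu> x - q x * B \<mu> x) + sqrt \<mu> * sinh (sqrt \<mu> * y) * g \<mu> x = - (q x * (sinhc \<mu> y * B \<mu> x))"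
        by (simp add: algebra_simps)
    qed
    have "Wx u + \<i> * Wy u = of_real ((\<Sum>\<mu>\<in>\<Lambda>. cosh (sqrt \<mu> * y) * g' \<mu> x) - (\<Sum>\<mu>\<in>\<Lambda>. cosh (sqrt \<mu> * y) * B \<mu> x))
       + \<i> * of_real ((\<Sum>\<mu>\<in>\<Lambda>. sinhc \<mu> y * (- \<mu> * g \<mu> x - q x * B \<mu> x)) + (\<Sum>\<mu>\<in>\<Lambda>. (sqrt \<mu> * sinh (sqrt \<mu> * y)) * g \<mu> x))"
      unfolding Wx_def Wy_def xy by (simp add: complex_eq_iff)
    also have "\<dots> = of_real (q x) * cnj (W u)"
      unfolding 1 2 W_def xy by (simp add: complex_eq_iff)
    finally show ?thesis by (simp add: xy)
  qed
  define Z where "Z = {u \<in> D. W u \<noteq> 0}"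
  have Z_open: "open Z"
  proof -
    have "Z = D \<inter> W -` (- {0})" by (auto simp: Z_def)
    moreover have "open (D \<inter> W -` (- {0}))"
      by (rule continuous_open_preimage[OF cW(1)]) (auto simp: D_def open_box)
    ultimately show ?thesis by simp
  qed
  \<comment> \<open>The equation becomes linear over the complex numbers by writing cnj W as (cnj W
    / W) W. The quotient has modulus 1, which bounds \<open>G\<close> by \<open>M / 2\<close>, but
    it may be discontinuous at zeros of \<open>W\<close>; there \<open>G\<close> is set to 0 and
    multiplies a vanishing factor.\<close>
  define G where "G u = indicator Z u *\<^sub>R (of_real (q (fst u) / 2) * cnj (W u) / W u)" for u
  have cR: "continuous_on Z (\<lambda>u. of_real (q (fst u) / 2) * cnj (W u) / W u)"
  proof -
    have "Z \<subseteq> D" by (auto simp: Z_def)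
    then show ?thesis
      by (intro continuous_intros continuous_on_subset[OF cqD] continuous_on_subset[OF cW(1)]) (auto simp: Z_def)
  qed
  have G_meas: "G \<in> borel_measurable borel"
    unfolding G_def[abs_def] by (rule borel_measurable_continuous_on_indicator[OF _ cR]) (use Z_open in auto)
  have G_le: "norm (G u) \<le> M / 2" for u
  proof (cases "u \<in> Z")
    case True
    then have "fst u \<in> {s..e}" "W u \<noteq> 0" by (auto simp: Z_def D)
    then show ?thesis using True q_le[of "fst u"] by (simp add: G_def norm_mult norm_divide)
  qed (use M in \<open>simp add: G_def\<close>)
  have G_eq: "Wx u + \<i> * Wy u = 2 * G u * W u" if "u \<in> D" for u
    using dbar[OF that] that by (cases "u \<in> Z") (auto simp: G_def Z_def)
  have G_cont: "isCont G u" if "u \<in> D" "W u \<noteq> 0" for u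
  proof -
    have u: "u \<in> Z" using that by (simp add: Z_def)
    have "continuous_on Z G" using cR by (rule continuous_on_eq) (simp add: G_def)
    then show ?thesis using u by (simp add: continuous_on_eq_continuous_at[OF Z_open])
  qed
  obtain \<beta> where \<beta>: "\<And>u. u \<in> D \<Longrightarrow> norm (\<beta> u) \<le> M / 2 * cauchy_const (10 * a)"
    and hol: "(\<lambda>z. W (Re z, Im z) * exp (- \<beta> (Re z, Im z))) holomorphic_on {z. (Re z, Im z) \<in> D}"
  proof (rule similarity_principle[of "(s, - (5 * a))" "(e, 5 * a)", folded D_def, OF D_ball G_meas G_le dWx dWy cW G_eq G_cont])
    fix \<beta>
    assume "\<And>u. u \<in> D \<Longrightarrow> norm (\<beta> u) \<le> M / 2 * cauchy_const (10 * a)"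
      and "(\<lambda>z. W (Re z, Im z) * exp (- \<beta> (Re z, Im z))) holomorphic_on {z. (Re z, Im z) \<in> D}"
    then show thesis by (rule that)
  qed
  define h where "h z = W (Re z, Im z) * exp (- \<beta> (Re z, Im z))" for z
  define k where "k = M / 2 * cauchy_const (10 * a)"
  \<comment> \<open>The moments grow like \<open>(2 * E) ^ m\<close>, so off the axis a factor exp
    (sqrt (2 E) 5 a) appears; \<open>2 * E \<le> (2 * M)\<^sup>2\<close> turns it into
    \<open>exp (10 * a * M)\<close>.\<close>
  have W_le: "norm (W u) \<le> (2 + M) * A * exp (10 * a * M)" if u: "u \<in> D" for u
  proof -
    obtain x y where xy: "u = (x, y)" by force
    have x: "x \<in> {s..e}" and y: "\<bar>y\<bar> \<le> 5 * a" using u by (auto simp: D xy)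
    have T: "2 * E > 0" using E by simp
    have A0: "A \<ge> 0" using b[of x 0] x by (simp add: J_def)
    have 1: "\<bar>U x y\<bar> \<le> A * exp (sqrt (2 * E) * (5 * a))"
      unfolding U_def by (rule abs_sum_cosh_le(1)[OF \<Lambda> T y]) (use b[of x] x in \<open>auto simp: J_def\<close>)
    have 2: "\<bar>Im' x y\<bar> \<le> ((1 + M) * A) * (exp (sqrt (2 * E) * (5 * a)) / sqrt (2 * E))"
      unfolding Im'_def
    proof (rule abs_sum_cosh_le(2)[OF \<Lambda> T y])
      fix m
      have "(\<Sum>\<mu>\<in>\<Lambda>. \<mu> ^ m * B \<mu> x) = (\<Sum>\<mu>\<in>\<Lambda>. \<mu> ^ m * g' \<mu> x) - q x * (\<Sum>\<mu>\<in>\<Lambda>. \<mu> ^ m * g \<mu> x)"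
        unfolding sum_distrib_left sum_subtractf[symmetric] by (intro sum.cong refl) (simp add: B_eq[OF x] algebra_simps)
      moreover have "\<bar>q x * (\<Sum>\<mu>\<in>\<Lambda>. \<mu> ^ m * g \<mu> x)\<bar> \<le> M * (A * (2 * E) ^ m)"
        unfolding abs_mult using q_le[OF x] b[of x m] x M by (intro mult_mono) (auto simp: J_def)
      ultimately show "\<bar>\<Sum>\<mu>\<in>\<Lambda>. \<mu> ^ m * B \<mu> x\<bar> \<le> (1 + M) * A * (2 * E) ^ m"
        using b'[of x m] x by (simp add: J_def algebra_simps)
    qed
    also have "\<dots> \<le> ((1 + M) * A) * exp (sqrt (2 * E) * (5 * a))"
    proof (rule mult_left_mono)
      have "exp (sqrt (2 * E) * (5 * a)) / sqrt (2 * E) \<le> exp (sqrt (2 * E) * (5 * a)) / 1"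
        by (rule divide_left_mono) (use E in auto)
      then show "exp (sqrt (2 * E) * (5 * a)) / sqrt (2 * E) \<le> exp (sqrt (2 * E) * (5 * a))" by simp
    qed (use A0 M in simp)
    finally have "\<bar>U x y\<bar> + \<bar>Im' x y\<bar> \<le> (2 + M) * A * exp (sqrt (2 * E) * (5 * a))"
      using 1 by (simp add: algebra_simps)
    moreover have "norm (W u) \<le> \<bar>U x y\<bar> + \<bar>Im' x y\<bar>"
      using norm_triangle_ineq[of "complex_of_real (U x y)" "\<i> * of_real (Im' x y)"] by (simp add: W_def xy norm_mult)
    moreover have "sqrt (2 * E) * (5 * a) \<le> 10 * a * M"
    proof -
      have "2 * E \<le> (2 * M)\<^sup>2" using E by (simp add: power_mult_distrib)
      then have "sqrt (2 * E) \<le> 2 * M" using M by (intro real_le_lsqrt) auto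
      then have "sqrt (2 * E) * (5 * a) \<le> 2 * M * (5 * a)" using a by (intro mult_right_mono) auto
      then show ?thesis by (simp add: mult_ac)
    qed
    then have "(2 + M) * A * exp (sqrt (2 * E) * (5 * a)) \<le> (2 + M) * A * exp (10 * a * M)"
      using M A0 by (intro mult_left_mono) auto
    ultimately show ?thesis by linarith
  qed
  have h_le: "norm (h z) \<le> exp k * ((2 + M) * A * exp (10 * a * M))" if "(Re z, Im z) \<in> D" for z
  proof -
    have "norm (exp (- \<beta> (Re z, Im z))) \<le> exp k"
      using norm_exp[of "- \<beta> (Re z, Im z)"] \<beta>[OF that] by (simp add: k_def order_trans)
    then have "norm (W (Re z, Im z)) * norm (exp (- \<beta> (Re z, Im z))) \<le> ((2 + M) * A * exp (10 * a * M)) * exp k"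
      using W_le[OF that] order_trans[OF norm_ge_zero W_le[OF that]] by (intro mult_mono) auto
    then show ?thesis unfolding h_def norm_mult by (simp only: mult.commute[of "exp k"])
  qed
  have W_real: "W (x, 0) = of_real (\<Sum>\<mu>\<in>\<Lambda>. g \<mu> x)" for x by (simp add: W_def U_def Im'_def sinhc_def)
  \<comment> \<open>The similarity factor is paid twice, once to pass from the data to
    \<open>h\<close> and once to return; the two factors \<open>exp k\<close> together give
    \<open>exp (M * cauchy_const (10 * a))\<close>.\<close>
  have h_real: "norm (h (of_real x)) \<le> exp k * \<bar>\<Sum>\<mu>\<in>\<Lambda>. g \<mu> x\<bar>" "\<bar>\<Sum>\<mu>\<in>\<Lambda>. g \<mu> x\<bar> \<le> exp k * norm (h (of_real x))"
    if x: "x \<in> {s<..<e}" for x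
  proof -
    have xD: "(x, 0) \<in> D" using x a by (simp add: D)
    have nh: "norm (h (of_real x)) = \<bar>\<Sum>\<mu>\<in>\<Lambda>. g \<mu> x\<bar> * norm (exp (- \<beta> (x, 0)))"
      by (simp only: h_def norm_mult W_real norm_of_real Re_complex_of_real Im_complex_of_real)
    have e1: "norm (exp (- \<beta> (x, 0))) \<le> exp k"
      using norm_exp[of "- \<beta> (x, 0)"] \<beta>[OF xD] by (simp add: k_def order_trans)
    have e2: "norm (exp (\<beta> (x, 0))) \<le> exp k"
      using norm_exp[of "\<beta> (x, 0)"] \<beta>[OF xD] by (simp add: k_def order_trans)
    show "norm (h (of_real x)) \<le> exp k * \<bar>\<Sum>\<mu>\<in>\<Lambda>. g \<mu> x\<bar>"
      unfolding nh using mult_left_mono[OF e1, of "\<bar>\<Sum>\<mu>\<in>\<Lambda>. g \<mu> x\<bar>"] by (simp only: mult.commute abs_ge_zero)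
    have "\<bar>\<Sum>\<mu>\<in>\<Lambda>. g \<mu> x\<bar> = norm (h (of_real x)) * norm (exp (\<beta> (x, 0)))"
    proof -
      have "norm (exp (- \<beta> (x, 0))) * norm (exp (\<beta> (x, 0))) = 1"
        by (simp only: norm_mult[symmetric] mult_exp_exp) simp
      then show ?thesis unfolding nh mult.assoc by simp
    qed
    also have "\<dots> \<le> norm (h (of_real x)) * exp k" by (intro mult_left_mono e2) auto
    finally show "\<bar>\<Sum>\<mu>\<in>\<Lambda>. g \<mu> x\<bar> \<le> exp k * norm (h (of_real x))" by (simp only: mult.commute)
  qed
  have sub: "{c0 - a / 2..c0 + a / 2} \<subseteq> {s<..<e}" using a by (auto simp: c0_def e_def)
  have cball_D: "(Re z, Im z) \<in> D" if "z \<in> cball (of_real c0) (4 * a)" for z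
  proof -
    have "\<bar>Re z - c0\<bar> \<le> 4 * a" "\<bar>Im z\<bar> \<le> 4 * a"
      using that abs_Re_le_cmod[of "z - of_real c0"] abs_Im_le_cmod[of "z - of_real c0"] by (auto simp: dist_norm norm_minus_commute)
    then show ?thesis using a by (auto simp: D c0_def e_def abs_le_iff)
  qed
  have "norm (h (of_real x0)) \<le> 2 * (exp k * \<epsilon>) * (18 * exp 1 * a / \<sigma>) ^ n + (exp k * ((2 + M) * A * exp (10 * a * M))) / 3 ^ n"
  proof (rule holomorphic_remez[OF a, of "{z. (Re z, Im z) \<in> D}" c0])
    show "open {z. (Re z, Im z) \<in> D}"
    proof -
      have "{z. (Re z, Im z) \<in> D} = box (Complex s (- (5 * a))) (Complex e (5 * a))"
        by (auto simp: D_def mem_box_pair in_box_complex_iff)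
      then show ?thesis by (metis open_box)
    qed
    show "h holomorphic_on {z. (Re z, Im z) \<in> D}" using hol by (simp add: h_def[abs_def])
    show "norm (h (of_real x)) \<le> exp k * \<epsilon>" if "x \<in> S" for x
    proof -
      have "x \<in> {s<..<e}" using that S(2) sub by (auto simp: c0_def c_def)
      from h_real(1)[OF this] mult_left_mono[OF \<epsilon>[OF that] exp_ge_zero[of k]]
      show ?thesis by (rule order_trans)
    qed
  qed (use cball_D h_le S \<sigma> x0 n in \<open>auto simp: c0_def c_def\<close>)
  moreover have "x0 \<in> {s<..<e}" using x0 sub by (auto simp: c0_def c_def)
  ultimately have "\<bar>\<Sum>\<mu>\<in>\<Lambda>. g \<mu> x0\<bar> \<le> exp k * (2 * (exp k * \<epsilon>) * (18 * exp 1 * a / \<sigma>) ^ n + (exp k * ((2 + M) * A * exp (10 * a * M))) / 3 ^ n)"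
    using h_real(2)[of x0] mult_left_mono[of "norm (h (of_real x0))" _ "exp k"] by (meson exp_ge_zero order_trans)
  also have "\<dots> = (exp k * exp k) * (2 * \<epsilon> * (18 * exp 1 * a / \<sigma>) ^ n + (2 + M) * A * exp (10 * a * M) / 3 ^ n)"
    by (simp add: algebra_simps)
  also have "exp k * exp k = exp (M * cauchy_const (10 * a))"
    by (simp add: k_def flip: exp_add)
  finally show ?thesis .
qed

text \<open>The chain satisfies f_m'' = V f_m - f_(m+1). The bound for \<open>f m\<close> uses only
  its own L2 data; the oscillation of \<open>f' m\<close> is read off the equation and so costs the
  supremum bound of the next member and a factor \<open>M\<^sup>2\<close>. The constant is the same
  for all \<open>m\<close>, which preserves the growth \<open>(2 * E) ^ m\<close>.\<close>

lemma chain_sup_bounds: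
  fixes V :: "real \<Rightarrow> real" and f f' :: "nat \<Rightarrow> real \<Rightarrow> real"
  defines "\<kappa> l M \<equiv> (1 / sqrt l + (1 + l) / 2) * (1 + 3 * l) * M\<^sup>2"
  assumes se: "s < e" and M: "M \<ge> 1" and E: "E > 0" "E \<le> M\<^sup>2" and B: "B > 0"
    and Vb: "\<And>x. x \<in> {s..e} \<Longrightarrow> \<bar>V x\<bar> \<le> M\<^sup>2"
    and df: "\<And>m x. x \<in> {s..e} \<Longrightarrow> (f m has_real_derivative f' m x) (at x within {s..e})"
    and cf': "\<And>m. continuous_on {s..e} (f' m)"
    and i2: "\<And>m x y. s \<le> x \<Longrightarrow> x \<le> y \<Longrightarrow> y \<le> e \<Longrightarrow> ((\<lambda>t. V t * f m t - f (Suc m) t) has_integral (f' m y - f' m x)) {x..y}"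
    and L2: "\<And>m. integral {s..e} (\<lambda>x. (f m x)\<^sup>2) \<le> (B * (2 * E) ^ m)\<^sup>2"
    and L2': "\<And>m. integral {s..e} (\<lambda>x. (f' m x)\<^sup>2) \<le> (B * (2 * E) ^ m)\<^sup>2"
    and x: "x \<in> {s..e}"
  shows "\<bar>f m x\<bar> \<le> B * \<kappa> (e - s) M * (2 * E) ^ m" "\<bar>f' m x\<bar> \<le> B * \<kappa> (e - s) M * (2 * E) ^ m"
proof -
  define l where "l = e - s"
  define s0 where "s0 = 1 / sqrt l + (1 + l) / 2"
  define P where "P m = B * (2 * E) ^ m" for m
  have l: "l > 0" using se by (simp add: l_def)
  have s0: "s0 > 0" using l by (simp add: s0_def add_pos_pos)
  have P: "P m > 0" for m using B E by (simp add: P_def)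
  have cf: "continuous_on {s..e} (f m)" for m by (rule DERIV_continuous_on[OF df])
  have 1: "\<bar>f m x\<bar> \<le> P m * s0" if "x \<in> {s..e}" for m x
  proof -
    have "\<bar>f m x\<bar> \<le> P m / sqrt (e - s) + P m * (1 + (e - s)) / 2"
      by (rule bound_by_L2_and_oscillation[OF se cf less_imp_le[OF P] _ _ that])
         (use L2 oscillation_by_L2[OF df cf' P] L2' in \<open>auto simp: P_def\<close>)
    then show ?thesis by (simp add: s0_def l_def algebra_simps)
  qed
  have M2: "1 \<le> M\<^sup>2" using M by simp
  define Q where "Q m = M\<^sup>2 * (P m * s0)" for m
  \<comment> \<open>The next member carries the factor \<open>2 * E \<le> 2 * M\<^sup>2\<close>;
    together with the term \<open>V * f m\<close> this makes 3.\<close>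
  have step: "Q m + P (Suc m) * s0 \<le> 3 * Q m" for m
  proof -
    have "P (Suc m) * s0 = 2 * E * (P m * s0)" by (simp add: P_def)
    also have "\<dots> \<le> 2 * M\<^sup>2 * (P m * s0)" using E P[of m] s0 by (intro mult_right_mono) auto
    also have "\<dots> = 2 * Q m" by (simp add: Q_def)
    finally show ?thesis by simp
  qed
  have osc: "\<bar>f' m x - f' m y\<bar> \<le> 3 * Q m * l" if "x \<in> {s..e}" "y \<in> {s..e}" for m x y
  proof -
    have le: "\<bar>f' m y - f' m x\<bar> \<le> 3 * Q m * l" if xy: "s \<le> x" "x \<le> y" "y \<le> e" for x y
    proof -
      have nn: "0 \<le> 3 * Q m" using P[of m] s0 by (simp add: Q_def)
      have "norm (f' m y - f' m x) \<le> 3 * Q m * Henstock_Kurzweil_Integration.content {x..y}"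
      proof (rule has_integral_bound_real[OF nn finite.emptyI i2[OF xy]])
        fix t assume "t \<in> {x..y} - {}"
        then have t: "t \<in> {s..e}" using xy by auto
        have "\<bar>V t * f m t\<bar> \<le> Q m"
          unfolding abs_mult Q_def using Vb[OF t] 1[OF t] by (intro mult_mono) auto
        then show "norm (V t * f m t - f (Suc m) t) \<le> 3 * Q m"
          using 1[OF t, of "Suc m"] step[of m] abs_triangle_ineq4[of "V t * f m t" "f (Suc m) t"] by simp
      qed
      also have "\<dots> \<le> 3 * Q m * l" using nn xy by (intro mult_left_mono) (auto simp: l_def)
      finally show ?thesis by simp
    qed
    show ?thesis using le[of x y] le[of y x] that by (cases "x \<le> y") (auto simp: abs_minus_commute)
  qed
  have 2: "\<bar>f' m x\<bar> \<le> P m / sqrt l + 3 * Q m * l"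
    unfolding l_def
    by (rule bound_by_L2_and_oscillation[OF se cf' less_imp_le[OF P] _ _ x])
       (use L2' osc in \<open>auto simp: P_def l_def\<close>)
  have \<kappa>: "\<kappa> (e - s) M = s0 * (1 + 3 * l) * M\<^sup>2" by (simp add: \<kappa>_def s0_def l_def)
  have "P m * s0 \<le> P m * s0 * ((1 + 3 * l) * M\<^sup>2)"
    proof -
    have "1 \<le> (1 + 3 * l) * M\<^sup>2" using mult_mono[of 1 "1 + 3 * l" 1 "M\<^sup>2"] l M2 by simp
    from mult_left_mono[OF this, of "P m * s0"] show ?thesis using P[of m] s0 by simp
  qed
  then show "\<bar>f m x\<bar> \<le> B * \<kappa> (e - s) M * (2 * E) ^ m"
    using 1[OF x, of m] unfolding \<kappa> by (simp add: P_def mult_ac)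
  have "P m / sqrt l \<le> P m * s0"
    using P[of m] l unfolding s0_def by (simp add: distrib_left)
  also have "\<dots> \<le> P m * s0 * M\<^sup>2" using mult_left_mono[OF M2, of "P m * s0"] P[of m] s0 by simp
  finally have "P m / sqrt l + 3 * Q m * l \<le> P m * s0 * ((1 + 3 * l) * M\<^sup>2)"
    by (simp add: Q_def algebra_simps)
  then show "\<bar>f' m x\<bar> \<le> B * \<kappa> (e - s) M * (2 * E) ^ m"
    using 2 unfolding \<kappa> by (simp add: P_def mult_ac)
qed

text \<open>Chebyshev's inequality on the part of \<open>\<omega>\<close> outside \<open>S\<close>:
  it turns an integral bound over \<open>\<omega>\<close> into a pointwise bound on a set of
  controlled measure, the input of the Remez inequality.\<close>

lemma superlevel_measure:
  fixes F :: "real \<Rightarrow> real"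
  assumes \<omega>: "\<omega> \<in> sets lebesgue" and F: "continuous_on {u..v} F" and \<epsilon>: "\<epsilon> > 0"
  defines "S \<equiv> {x \<in> \<omega> \<inter> {u..v}. \<bar>F x\<bar> \<le> \<epsilon>}"
  shows "S \<in> sets lebesgue"
    and "\<epsilon>\<^sup>2 * (measure lebesgue (\<omega> \<inter> {u..v}) - measure lebesgue S) \<le> (LINT x:\<omega> \<inter> {u..v}|lebesgue. (F x)\<^sup>2)"
proof -
  have cl: "closed {x \<in> {u..v}. \<bar>F x\<bar> \<le> \<epsilon>}"
  proof -
    have "closed ({u..v} \<inter> (\<lambda>x. \<bar>F x\<bar>) -` {..\<epsilon>})"
      by (rule continuous_closed_preimage) (auto intro!: continuous_intros F)
    moreover have "{u..v} \<inter> (\<lambda>x. \<bar>F x\<bar>) -` {..\<epsilon>} = {x \<in> {u..v}. \<bar>F x\<bar> \<le> \<epsilon>}" by auto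
    ultimately show ?thesis by simp
  qed
  have eq: "S = \<omega> \<inter> {x \<in> {u..v}. \<bar>F x\<bar> \<le> \<epsilon>}" by (auto simp: S_def)
  show S: "S \<in> sets lebesgue" unfolding eq using \<omega> cl by (intro sets.Int) (auto simp: borel_closed)
  have W: "\<omega> \<inter> {u..v} \<in> lmeasurable" by (rule bounded_set_imp_lmeasurable) (use \<omega> in auto)
  have Sm: "S \<in> lmeasurable" by (rule bounded_set_imp_lmeasurable) (use S in \<open>auto simp: S_def intro: bounded_subset[of "{u..v}"]\<close>)
  define R where "R = \<omega> \<inter> {u..v} - S"
  have Rm: "R \<in> lmeasurable" unfolding R_def using W Sm by (rule fmeasurable.Diff)
  have "measure lebesgue R = measure lebesgue (\<omega> \<inter> {u..v}) - measure lebesgue S"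
    unfolding R_def by (rule measurable_measure_Diff[OF W]) (use S in \<open>auto simp: S_def\<close>)
  moreover have "\<epsilon>\<^sup>2 * measure lebesgue R = (LINT x|lebesgue. \<epsilon>\<^sup>2 * indicator R x)"
    using Rm by simp
  moreover have "\<dots> \<le> (LINT x:\<omega> \<inter> {u..v}|lebesgue. (F x)\<^sup>2)"
    unfolding set_lebesgue_integral_def
  proof (rule integral_mono)
    show "integrable lebesgue (\<lambda>x. \<epsilon>\<^sup>2 * indicator R x :: real)"
      using Rm unfolding fmeasurable_def by (intro integrable_mult_right integrable_real_indicator) auto
    have "set_integrable lebesgue {u..v} (\<lambda>x. (F x)\<^sup>2)"
      by (rule absolutely_integrable_continuous_real) (intro continuous_intros F)
    then have "set_integrable lebesgue (\<omega> \<inter> {u..v}) (\<lambda>x. (F x)\<^sup>2)"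
      by (rule set_integrable_subset) (use \<omega> in auto)
    then show "integrable lebesgue (\<lambda>x. indicator (\<omega> \<inter> {u..v}) x *\<^sub>R (F x)\<^sup>2)"
      by (simp add: set_integrable_def)
    fix x
    show "\<epsilon>\<^sup>2 * indicator R x \<le> indicator (\<omega> \<inter> {u..v}) x *\<^sub>R (F x)\<^sup>2"
    proof (cases "x \<in> R")
      case True
      then have "x \<in> \<omega> \<inter> {u..v}" "\<epsilon> \<le> \<bar>F x\<bar>" by (auto simp: R_def S_def)
      then show ?thesis using True power_mono[of \<epsilon> "\<bar>F x\<bar>" 2] \<epsilon> by simp
    qed simp
  qed
  ultimately show "\<epsilon>\<^sup>2 * (measure lebesgue (\<omega> \<inter> {u..v}) - measure lebesgue S) \<le> (LINT x:\<omega> \<inter> {u..v}|lebesgue. (F x)\<^sup>2)"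
    by simp
qed

text \<open>
  The constant is uniform in the potential, the interval and the number of eigenvalues. Only the
  exponential rate in \<open>M\<close> matters, so polynomial factors in \<open>M\<close> are absorbed along the way.
\<close>
lemma local_estimate:
  fixes a \<delta> D :: real
  assumes a: "a > 0" and \<delta>: "0 < \<delta>" "\<delta> \<le> 1" and D: "D > 0"
  obtains C where "\<And>(V :: real \<Rightarrow> real) g g' \<Lambda> \<omega> s M E B.
      M \<ge> 1 \<Longrightarrow> E \<ge> 1 \<Longrightarrow> E \<le> M\<^sup>2 \<Longrightarrow> V \<in> borel_measurable lebesgue \<Longrightarrow>
      (\<And>x. x \<in> {s..s + 10 * a} \<Longrightarrow> 0 \<le> V x) \<Longrightarrow> (\<And>x. x \<in> {s..s + 10 * a} \<Longrightarrow> V x \<le> M\<^sup>2) \<Longrightarrow>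
      finite \<Lambda> \<Longrightarrow> (\<And>\<mu>. \<mu> \<in> \<Lambda> \<Longrightarrow> \<mu> > 0) \<Longrightarrow>
      (\<And>\<mu> x. \<mu> \<in> \<Lambda> \<Longrightarrow> (g \<mu> has_real_derivative g' \<mu> x) (at x)) \<Longrightarrow>
      (\<And>\<mu> x y. \<mu> \<in> \<Lambda> \<Longrightarrow> x \<le> y \<Longrightarrow> ((\<lambda>t. (V t - \<mu>) * g \<mu> t) has_integral (g' \<mu> y - g' \<mu> x)) {x..y}) \<Longrightarrow>
      B > 0 \<Longrightarrow>
      (\<And>m. integral {s..s + 10 * a} (\<lambda>x. (\<Sum>\<mu>\<in>\<Lambda>. \<mu> ^ m * g \<mu> x)\<^sup>2) \<le> (B * (2 * E) ^ m)\<^sup>2) \<Longrightarrow>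
      (\<And>m. integral {s..s + 10 * a} (\<lambda>x. (\<Sum>\<mu>\<in>\<Lambda>. \<mu> ^ m * g' \<mu> x)\<^sup>2) \<le> (B * (2 * E) ^ m)\<^sup>2) \<Longrightarrow>
      B\<^sup>2 \<le> D * M ^ 4 * integral {s + 9 / 2 * a..s + 11 / 2 * a} (\<lambda>x. (\<Sum>\<mu>\<in>\<Lambda>. g \<mu> x)\<^sup>2) \<Longrightarrow>
      \<omega> \<in> sets lebesgue \<Longrightarrow> \<delta> * a \<le> measure lebesgue (\<omega> \<inter> {s + 9 / 2 * a..s + 11 / 2 * a}) \<Longrightarrow>
      integral {s + 9 / 2 * a..s + 11 / 2 * a} (\<lambda>x. (\<Sum>\<mu>\<in>\<Lambda>. g \<mu> x)\<^sup>2)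
        \<le> exp (C * M) * (LINT x:\<omega> \<inter> {s + 9 / 2 * a..s + 11 / 2 * a}|lebesgue. (\<Sum>\<mu>\<in>\<Lambda>. g \<mu> x)\<^sup>2)"
proof -
  define k where "k = \<bar>cauchy_const (10 * a)\<bar>"
  \<comment> \<open>The base of the Remez inequality for a set of measure
    \<open>\<delta> * a / 2\<close>, half of what thickness provides.\<close>
  define K where "K = 18 * exp 1 * a / (\<delta> * a / 2)"
  define s0 where "s0 = (1 / sqrt (10 * a) + (1 + 10 * a) / 2) * (1 + 3 * (10 * a))"
  define C1 where "C1 = 3 * s0 * sqrt (D * a)"
  \<comment> \<open>The exponential rate of the remainder term: five powers of \<open>M\<close> and
    the constant \<open>C1\<close>, all absorbed in exponentials, the rate \<open>10 * a\<close> of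
    the extension, and \<open>k\<close> for the similarity factor.\<close>
  define q where "q = C1 + 5 + 10 * a + k"
  \<comment> \<open>Squaring the pointwise bound doubles the rates \<open>k\<close> and
    \<open>ln K * (q + 2)\<close>, the latter coming from \<open>real n \<le> (q + 2) * M\<close>.
    The prefactor \<open>32 / \<delta>\<close> is moved into the exponent as well.\<close>
  define C where "C = 32 / \<delta> + 2 * k + 2 * (ln K * (q + 2))"
  have s0: "s0 > 0" using a by (simp add: s0_def add_pos_pos)
  have C1: "C1 \<ge> 0" using s0 a D by (simp add: C1_def)
  have k: "k \<ge> 0" by (simp add: k_def)
  have q: "q \<ge> 0" using C1 a k by (simp add: q_def)
  have K1: "K \<ge> 1"
  proof -
    have K: "K = 36 * exp 1 / \<delta>" using a \<delta> by (simp add: K_def field_simps)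
    have "\<delta> \<le> 36 * exp 1" using \<delta> exp_ge_add_one_self[of "1 :: real"] by linarith
    then have "1 \<le> 36 * exp 1 / \<delta>" using \<delta> by (simp add: pos_le_divide_eq)
    then show ?thesis unfolding K .
  qed
  show ?thesis
  proof (rule that[of C])
    fix V :: "real \<Rightarrow> real" and g g' :: "real \<Rightarrow> real \<Rightarrow> real" and \<Lambda> \<omega> :: "real set" and s M E B :: real
    assume M: "M \<ge> 1" and E: "E \<ge> 1" "E \<le> M\<^sup>2" and V: "V \<in> borel_measurable lebesgue"
      and V0: "\<And>x. x \<in> {s..s + 10 * a} \<Longrightarrow> 0 \<le> V x" and V1: "\<And>x. x \<in> {s..s + 10 * a} \<Longrightarrow> V x \<le> M\<^sup>2"
      and \<Lambda>: "finite \<Lambda>" "\<And>\<mu>. \<mu> \<in> \<Lambda> \<Longrightarrow> \<mu> > 0"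
      and dg: "\<And>\<mu> x. \<mu> \<in> \<Lambda> \<Longrightarrow> (g \<mu> has_real_derivative g' \<mu> x) (at x)"
      and ig: "\<And>\<mu> x y. \<mu> \<in> \<Lambda> \<Longrightarrow> x \<le> y \<Longrightarrow> ((\<lambda>t. (V t - \<mu>) * g \<mu> t) has_integral (g' \<mu> y - g' \<mu> x)) {x..y}"
      and B: "B > 0"
      and L2: "\<And>m. integral {s..s + 10 * a} (\<lambda>x. (\<Sum>\<mu>\<in>\<Lambda>. \<mu> ^ m * g \<mu> x)\<^sup>2) \<le> (B * (2 * E) ^ m)\<^sup>2"
      and L2': "\<And>m. integral {s..s + 10 * a} (\<lambda>x. (\<Sum>\<mu>\<in>\<Lambda>. \<mu> ^ m * g' \<mu> x)\<^sup>2) \<le> (B * (2 * E) ^ m)\<^sup>2"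
      and BD: "B\<^sup>2 \<le> D * M ^ 4 * integral {s + 9 / 2 * a..s + 11 / 2 * a} (\<lambda>x. (\<Sum>\<mu>\<in>\<Lambda>. g \<mu> x)\<^sup>2)"
      and \<omega>: "\<omega> \<in> sets lebesgue" "\<delta> * a \<le> measure lebesgue (\<omega> \<inter> {s + 9 / 2 * a..s + 11 / 2 * a})"
    define I where "I = {s + 9 / 2 * a..s + 11 / 2 * a}"
    define F where "F x = (\<Sum>\<mu>\<in>\<Lambda>. g \<mu> x)" for x
    define T where "T = (LINT x:\<omega> \<inter> I|lebesgue. (F x)\<^sup>2)"
    define f f' where "f m x = (\<Sum>\<mu>\<in>\<Lambda>. \<mu> ^ m * g \<mu> x)" and "f' m x = (\<Sum>\<mu>\<in>\<Lambda>. \<mu> ^ m * g' \<mu> x)" for m x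
    define e where "e = s + 10 * a"
    have se: "s < e" using a by (simp add: e_def)
    have I_eq: "I = {s + 5 * a - a / 2..s + 5 * a + a / 2}" by (simp add: I_def field_simps)
    have cg: "continuous_on X (g \<mu>)" if "\<mu> \<in> \<Lambda>" for \<mu> X
      using dg[OF that] by (meson DERIV_continuous_on has_field_derivative_at_within)
    have cF: "continuous_on X F" for X unfolding F_def[abs_def] by (intro continuous_intros cg)
    have cg': "continuous_on {s..e} (g' \<mu>)" if \<mu>: "\<mu> \<in> \<Lambda>" for \<mu>
    proof -
      have "(\<lambda>t. (V t - \<mu>) * g \<mu> t) integrable_on {s..e}" using ig[OF \<mu>, of s e] se by auto
      then have "continuous_on {s..e} (\<lambda>x. g' \<mu> s + integral {s..x} (\<lambda>t. (V t - \<mu>) * g \<mu> t))"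
        by (intro continuous_intros indefinite_integral_continuous_1)
      then show ?thesis
      proof (rule continuous_on_eq)
        fix x assume "x \<in> {s..e}"
        then show "g' \<mu> s + integral {s..x} (\<lambda>t. (V t - \<mu>) * g \<mu> t) = g' \<mu> x"
          using integral_unique[OF ig[OF \<mu>, of s x]] by simp
      qed
    qed
    define \<kappa> where "\<kappa> = s0 * M\<^sup>2"
    have \<kappa>: "\<bar>f m x\<bar> \<le> B * \<kappa> * (2 * E) ^ m" "\<bar>f' m x\<bar> \<le> B * \<kappa> * (2 * E) ^ m" if x: "x \<in> {s..e}" for m x
    proof -
      have eq: "(1 / sqrt (e - s) + (1 + (e - s)) / 2) * (1 + 3 * (e - s)) * M\<^sup>2 = \<kappa>"
        by (simp add: \<kappa>_def s0_def e_def)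
      have df: "(f m has_real_derivative f' m x) (at x within {s..e})" for m x
        unfolding f_def[abs_def] f'_def by (intro DERIV_sum DERIV_cmult has_field_derivative_at_within[OF dg])
      have cf': "continuous_on {s..e} (f' m)" for m unfolding f'_def[abs_def] by (intro continuous_intros cg')
      have i2: "((\<lambda>t. V t * f m t - f (Suc m) t) has_integral (f' m y - f' m x)) {x..y}" if "x \<le> y" for m x y
      proof -
        have "((\<lambda>t. \<Sum>\<mu>\<in>\<Lambda>. \<mu> ^ m * ((V t - \<mu>) * g \<mu> t)) has_integral (\<Sum>\<mu>\<in>\<Lambda>. \<mu> ^ m * (g' \<mu> y - g' \<mu> x))) {x..y}"
          by (intro has_integral_sum \<Lambda> has_integral_mult_right ig that)
        moreover have "(\<Sum>\<mu>\<in>\<Lambda>. \<mu> ^ m * ((V t - \<mu>) * g \<mu> t)) = V t * f m t - f (Suc m) t" for t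
          unfolding f_def sum_distrib_left sum_subtractf[symmetric] by (intro sum.cong) (auto simp: algebra_simps)
        moreover have "(\<Sum>\<mu>\<in>\<Lambda>. \<mu> ^ m * (g' \<mu> y - g' \<mu> x)) = f' m y - f' m x"
          unfolding f'_def sum_subtractf[symmetric] by (intro sum.cong) (auto simp: algebra_simps)
        ultimately show ?thesis by simp
      qed
      have Va: "\<bar>V x\<bar> \<le> M\<^sup>2" if "x \<in> {s..e}" for x using V0[of x] V1[of x] that by (simp add: e_def)
      have E0: "E > 0" using E by simp
      note cs = chain_sup_bounds[where f = f and f' = f' and V = V, OF se M E0 E(2) B Va df cf' i2 _ _ x, of m]
      show "\<bar>f m x\<bar> \<le> B * \<kappa> * (2 * E) ^ m" "\<bar>f' m x\<bar> \<le> B * \<kappa> * (2 * E) ^ m"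
        using cs L2 L2' unfolding eq by (auto simp: f_def f'_def e_def)
    qed
    have T0: "T \<ge> 0" unfolding T_def set_lebesgue_integral_def by (intro Bochner_Integration.integral_nonneg) auto
    obtain x0 where x0: "x0 \<in> I" "\<And>x. x \<in> I \<Longrightarrow> \<bar>F x\<bar> \<le> \<bar>F x0\<bar>"
    proof -
      have "\<exists>z\<in>I. \<forall>y\<in>I. \<bar>F y\<bar> \<le> \<bar>F z\<bar>"
        by (rule continuous_attains_sup) (use a in \<open>auto simp: I_def intro!: continuous_intros cF\<close>)
      then show ?thesis by (elim bexE) (rule that, auto)
    qed
    define X where "X = \<bar>F x0\<bar>"
    have int_le: "integral I (\<lambda>x. (F x)\<^sup>2) \<le> a * X\<^sup>2"
    proof -
      have "integral I (\<lambda>x. (F x)\<^sup>2) \<le> integral I (\<lambda>_. X\<^sup>2)"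
        unfolding I_def
        by (intro integral_le integrable_continuous_interval continuous_intros cF)
           (use x0(2) in \<open>auto simp: X_def I_def abs_le_square_iff[symmetric]\<close>)
      also have "\<dots> = a * X\<^sup>2" using a by (simp add: I_def field_simps)
      finally show ?thesis .
    qed
    have B_le: "B \<le> sqrt (D * a) * M\<^sup>2 * X"
    proof (rule power2_le_imp_le)
      have "B\<^sup>2 \<le> D * M ^ 4 * integral I (\<lambda>x. (F x)\<^sup>2)" using BD unfolding I_def F_def .
      also have "\<dots> \<le> D * M ^ 4 * (a * X\<^sup>2)" by (intro mult_left_mono int_le) (use D M in auto)
      also have "\<dots> = (sqrt (D * a) * M\<^sup>2 * X)\<^sup>2"
        using D a by (simp add: power_mult_distrib power_mult[symmetric])
      finally show "B\<^sup>2 \<le> (sqrt (D * a) * M\<^sup>2 * X)\<^sup>2" .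
    qed (use D a in \<open>auto simp: X_def\<close>)
    \<comment> \<open>Chosen so that \<open>3 ^ n\<close> is at least
      \<open>2 * exp (q * M)\<close>; the successor supplies the factor 2. As \<open>n\<close> stays
      of order \<open>M\<close>, the loss \<open>K ^ n\<close> is admissible.\<close>
    define n where "n = Suc (nat \<lceil>q * M\<rceil>)"
    have n: "q * M + 1 \<le> real n" "real n \<le> (q + 2) * M"
    proof -
      have "0 \<le> q * M" using q M by simp
      then have "real n = of_int \<lceil>q * M\<rceil> + 1" by (simp add: n_def)
      then show "q * M + 1 \<le> real n" "real n \<le> (q + 2) * M"
        unfolding distrib_right using le_of_int_ceiling[of "q * M"] of_int_ceiling_le_add_one[of "q * M"] M by linarith+
    qed
    \<comment> \<open>Here the hypothesis that relates \<open>B\<close> to the mass on the middle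
      interval enters: the remainder is proportional to \<open>B\<close>, hence bounded by a
      multiple of \<open>X\<close>, and half of \<open>X\<close> can be absorbed on the
      left.\<close>
    have tail: "exp (M * k) * ((2 + M) * (B * \<kappa>) * exp (10 * a * M) / 3 ^ n) \<le> X / 2"
    proof -
      have Mexp: "M \<le> exp M" using exp_ge_add_one_self[of M] by linarith
      have "(2 + M) * (B * \<kappa>) \<le> (3 * M) * ((sqrt (D * a) * M\<^sup>2 * X) * (s0 * M\<^sup>2))"
        unfolding \<kappa>_def using M B B_le s0 by (intro mult_mono) auto
      also have "\<dots> = C1 * (M * M * M * M * M) * X" by (simp add: C1_def power2_eq_square)
      also have "\<dots> \<le> exp (C1 * M) * (exp M * exp M * exp M * exp M * exp M) * X"
      proof -
        have "C1 \<le> exp (C1 * M)"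
          using exp_ge_add_one_self[of "C1 * M"] mult_left_mono[OF M C1] by linarith
        then show ?thesis using C1 M Mexp by (intro mult_right_mono mult_mono) (auto simp: X_def)
      qed
      finally have 1: "(2 + M) * (B * \<kappa>) \<le> exp (C1 * M) * (exp M * exp M * exp M * exp M * exp M) * X" .
      have "exp (M * k) * ((2 + M) * (B * \<kappa>) * exp (10 * a * M) / 3 ^ n)
          \<le> exp (M * k) * ((exp (C1 * M) * (exp M * exp M * exp M * exp M * exp M) * X) * exp (10 * a * M) / 3 ^ n)"
        by (intro mult_left_mono divide_right_mono mult_right_mono 1) auto
      also have "\<dots> = exp (q * M) * X / 3 ^ n"
      proof -
        have "exp (q * M) = exp (M * k) * exp (C1 * M) * (exp M * exp M * exp M * exp M * exp M) * exp (10 * a * M)"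
          unfolding q_def mult_exp_exp by (simp add: algebra_simps)
        then show ?thesis by simp
      qed
      also have "\<dots> \<le> X / 2"
      proof -
        have "2 * exp (q * M) \<le> exp 1 * exp (q * M)"
          using exp_ge_add_one_self[of "1 :: real"] by (intro mult_right_mono) auto
        also have "\<dots> = exp (q * M + 1)" by (simp add: exp_add)
        also have "\<dots> \<le> exp (real n)" using n(1) by simp
        also have "\<dots> = exp 1 ^ n" by (simp add: exp_of_nat_mult[of n 1, simplified])
        also have "\<dots> \<le> 3 ^ n" by (rule power_mono[OF exp_le]) auto
        finally have "exp (q * M) / 3 ^ n \<le> 1 / 2" by (simp add: field_simps)
        then have "exp (q * M) / 3 ^ n * X \<le> 1 / 2 * X" by (intro mult_right_mono) (auto simp: X_def)
        then show ?thesis by simp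
      qed
      finally show ?thesis .
    qed
    have main: "integral I (\<lambda>x. (F x)\<^sup>2) \<le> exp (C * M) * (T + \<eta>)" if \<eta>: "\<eta> > 0" for \<eta>
    proof -
      \<comment> \<open>With this threshold Chebyshev loses at most half of the measure
        \<open>\<delta> * a\<close>. The summand \<open>\<eta>\<close> keeps it positive even when
        \<open>T\<close> is 0, and is sent to 0 at the end.\<close>
      define \<epsilon> where "\<epsilon> = sqrt (2 * (T + \<eta>) / (\<delta> * a))"
      have \<epsilon>: "\<epsilon> > 0" "\<epsilon>\<^sup>2 = 2 * (T + \<eta>) / (\<delta> * a)" using T0 \<eta> \<delta> a by (auto simp: \<epsilon>_def)
      define S where "S = {x \<in> \<omega> \<inter> I. \<bar>F x\<bar> \<le> \<epsilon>}"
      have S: "S \<in> sets lebesgue" "\<epsilon>\<^sup>2 * (measure lebesgue (\<omega> \<inter> I) - measure lebesgue S) \<le> T"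
        using superlevel_measure[OF \<omega>(1) cF \<epsilon>(1)] by (auto simp: S_def I_def T_def)
      have "measure lebesgue (\<omega> \<inter> I) - measure lebesgue S \<le> \<delta> * a / 2"
      proof (rule ccontr)
        assume "\<not> ?thesis"
        then have "\<epsilon>\<^sup>2 * (\<delta> * a / 2) < \<epsilon>\<^sup>2 * (measure lebesgue (\<omega> \<inter> I) - measure lebesgue S)"
          using \<epsilon>(1) by (intro mult_strict_left_mono) auto
        moreover have "\<epsilon>\<^sup>2 * (\<delta> * a / 2) = T + \<eta>" unfolding \<epsilon>(2) using \<delta> a by simp
        ultimately show False using S(2) \<eta> by linarith
      qed
      then have Sm: "\<delta> * a / 2 \<le> measure lebesgue S" using \<omega>(2) by (simp add: I_def)
      have "\<bar>F x0\<bar> \<le> exp (M * cauchy_const (10 * a)) *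
          (2 * \<epsilon> * (18 * exp 1 * a / (\<delta> * a / 2)) ^ n + (2 + M) * (B * \<kappa>) * exp (10 * a * M) / 3 ^ n)"
        unfolding F_def
      proof (rule propagation_of_smallness[OF a M E V V0 V1 \<Lambda> dg ig _ _ S(1)])
        show "\<bar>\<Sum>\<mu>\<in>\<Lambda>. \<mu> ^ m * g \<mu> x\<bar> \<le> B * \<kappa> * (2 * E) ^ m" if "x \<in> {s..s + 10 * a}" for m x
          using \<kappa>(1)[of x m] that by (simp add: f_def e_def)
        show "\<bar>\<Sum>\<mu>\<in>\<Lambda>. \<mu> ^ m * g' \<mu> x\<bar> \<le> B * \<kappa> * (2 * E) ^ m" if "x \<in> {s..s + 10 * a}" for m x
          using \<kappa>(2)[of x m] that by (simp add: f'_def e_def)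
        show "S \<subseteq> {s + 5 * a - a / 2..s + 5 * a + a / 2}" using I_eq by (auto simp: S_def)
        show "x0 \<in> {s + 5 * a - a / 2..s + 5 * a + a / 2}" using x0(1) unfolding I_eq .
        show "\<bar>\<Sum>\<mu>\<in>\<Lambda>. g \<mu> x\<bar> \<le> \<epsilon>" if "x \<in> S" for x using that by (simp add: S_def F_def)
      qed (use Sm \<delta> a in \<open>auto simp: n_def\<close>)
      also have "\<dots> \<le> exp (M * k) * (2 * \<epsilon> * K ^ n + (2 + M) * (B * \<kappa>) * exp (10 * a * M) / 3 ^ n)"
        unfolding K_def using M \<epsilon>(1) B s0 a \<delta>
        by (intro mult_right_mono) (auto simp: k_def \<kappa>_def intro!: add_nonneg_nonneg)
      also have "\<dots> \<le> exp (M * k) * (2 * \<epsilon> * K ^ n) + X / 2"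
        using tail by (simp add: distrib_left)
      finally have "X \<le> 4 * exp (M * k) * \<epsilon> * K ^ n" by (simp add: X_def)
      also have "K ^ n \<le> exp (ln K * ((q + 2) * M))"
      proof -
        have "K ^ n = exp (ln K * real n)" using K1 by (simp add: exp_of_nat2_mult)
        also have "\<dots> \<le> exp (ln K * ((q + 2) * M))" using K1 n by (simp add: mult_left_mono)
        finally show ?thesis .
      qed
      finally have "X \<le> 4 * exp (M * k) * \<epsilon> * exp (ln K * ((q + 2) * M))" using \<epsilon> by simp
      then have "X\<^sup>2 \<le> (4 * exp (M * k) * \<epsilon> * exp (ln K * ((q + 2) * M)))\<^sup>2"
        by (intro power_mono) (auto simp: X_def)
      also have "\<dots> = 16 * \<epsilon>\<^sup>2 * exp (2 * k * M + 2 * (ln K * (q + 2)) * M)"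
      proof -
        have "exp (2 * k * M + 2 * (ln K * (q + 2)) * M)
            = (exp (M * k) * exp (M * k)) * (exp (ln K * ((q + 2) * M)) * exp (ln K * ((q + 2) * M)))"
          unfolding mult_exp_exp by (simp add: algebra_simps)
        then show ?thesis by (simp add: power2_eq_square)
      qed
      finally have "a * X\<^sup>2 \<le> a * (16 * \<epsilon>\<^sup>2 * exp (2 * k * M + 2 * (ln K * (q + 2)) * M))"
        using a by (intro mult_left_mono) auto
      also have "\<dots> = 32 / \<delta> * exp (2 * k * M + 2 * (ln K * (q + 2)) * M) * (T + \<eta>)"
        unfolding \<epsilon>(2) using a \<delta> by (simp add: field_simps)
      also have "\<dots> \<le> exp (32 / \<delta> * M) * exp (2 * k * M + 2 * (ln K * (q + 2)) * M) * (T + \<eta>)"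
      proof -
        have "32 / \<delta> \<le> exp (32 / \<delta> * M)"
        proof -
          have "32 / \<delta> * 1 \<le> 32 / \<delta> * M" using M \<delta> by (intro mult_left_mono) auto
          then show ?thesis using exp_ge_add_one_self[of "32 / \<delta> * M"] by linarith
        qed
        then show ?thesis using T0 \<eta> by (intro mult_right_mono) auto
      qed
      also have "\<dots> = exp (C * M) * (T + \<eta>)"
        unfolding C_def mult_exp_exp by (simp add: algebra_simps)
      finally show ?thesis using int_le by linarith
    qed
    have "integral I (\<lambda>x. (F x)\<^sup>2) \<le> exp (C * M) * T"
    proof (rule field_le_epsilon)
      fix r :: real assume "r > 0"
      then have "integral I (\<lambda>x. (F x)\<^sup>2) \<le> exp (C * M) * (T + r / exp (C * M))" by (intro main) simp
      then show "integral I (\<lambda>x. (F x)\<^sup>2) \<le> exp (C * M) * T + r" by (simp add: distrib_left)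
    qed
    then show "integral {s + 9 / 2 * a..s + 11 / 2 * a} (\<lambda>x. (\<Sum>\<mu>\<in>\<Lambda>. g \<mu> x)\<^sup>2)
        \<le> exp (C * M) * (LINT x:\<omega> \<inter> {s + 9 / 2 * a..s + 11 / 2 * a}|lebesgue. (\<Sum>\<mu>\<in>\<Lambda>. g \<mu> x)\<^sup>2)"
      by (simp add: T_def F_def I_def)
  qed
qed

section \<open>Eigenfunctions on the whole line\<close>

section \<open>Integrability on the whole line\<close>

text \<open>Monotone convergence along exhausting intervals. It leads from gauge integrals over
  compact intervals, where the fundamental theorem is available, to the Lebesgue integral over the
  line.\<close>

lemma integrable_of_bounded_integrals:
  fixes k :: "real \<Rightarrow> real"
  assumes k0: "\<And>x. k x \<ge> 0" and ki: "\<And>n :: nat. k integrable_on {- real n..real n}"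
    and b: "\<And>n :: nat. integral {- real n..real n} k \<le> B"
  shows "integrable lebesgue k" "(LINT x|lebesgue. k x) \<le> B"
proof -
  have si: "set_integrable lebesgue {- real n..real n} k" for n
    by (rule nonnegative_absolutely_integrable_1[OF ki]) (use k0 in auto)
  define h where "h n x = indicator {- real n..real n} x *\<^sub>R k x" for n x
  have hi: "integrable lebesgue (h n)" for n using si[of n] by (simp add: set_integrable_def h_def[abs_def])
  have hB: "integral\<^sup>L lebesgue (h n) \<le> B" for n
    using set_lebesgue_integral_eq_integral(2)[OF si[of n]] b[of n]
    by (simp add: h_def[abs_def] set_lebesgue_integral_def)
  have mono: "mono (\<lambda>n. h n x)" for x
    unfolding mono_def h_def using k0[of x] by (auto simp: indicator_def)
  have lim: "(\<lambda>n. h n x) \<longlonglongrightarrow> k x" for x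
  proof (rule tendsto_eventually)
    obtain N where "\<bar>x\<bar> \<le> real N" using real_arch_simple by blast
    then show "\<forall>\<^sub>F n in sequentially. h n x = k x"
      by (intro eventually_sequentiallyI[of N]) (auto simp: h_def indicator_def abs_le_iff)
  qed
  have km: "k \<in> borel_measurable lebesgue"
    by (rule borel_measurable_LIMSEQ_real[OF lim]) (rule borel_measurable_integrable[OF hi])
  have inc: "incseq (\<lambda>n. integral\<^sup>L lebesgue (h n))"
    unfolding incseq_def using mono by (intro allI impI integral_mono hi) (auto simp: mono_def)
  obtain L where L: "(\<lambda>n. integral\<^sup>L lebesgue (h n)) \<longlonglongrightarrow> L"
    using incseq_convergent[OF inc] hB by blast
  note mc = integrable_monotone_convergence[OF hi _ _ L km] integral_monotone_convergence[OF hi _ _ L km]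
  show "integrable lebesgue k" by (rule mc(1)) (use mono lim in auto)
  have "integral\<^sup>L lebesgue k = L" by (rule mc(2)) (use mono lim in auto)
  then show "(LINT x|lebesgue. k x) \<le> B" using LIMSEQ_le_const2[OF L, of B] hB by auto
qed

lemma integral_subinterval_le:
  fixes k :: "real \<Rightarrow> real"
  assumes k: "integrable lebesgue k" "\<And>x. k x \<ge> 0"
  shows "k integrable_on {x..y}" "integral {x..y} k \<le> (LINT x|lebesgue. k x)"
proof -
  have si: "set_integrable lebesgue {x..y} k"
    unfolding set_integrable_def by (intro integrable_mult_indicator k) auto
  then show "k integrable_on {x..y}" by (rule set_lebesgue_integral_eq_integral)
  have "integral {x..y} k = (LINT x:{x..y}|lebesgue. k x)" using set_lebesgue_integral_eq_integral(2)[OF si] by simp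
  also have "\<dots> \<le> (LINT x|lebesgue. k x)"
    unfolding set_lebesgue_integral_def
    by (intro integral_mono k) (use si k in \<open>auto simp: set_integrable_def indicator_def\<close>)
  finally show "integral {x..y} k \<le> (LINT x|lebesgue. k x)" .
qed

text \<open>Integrability alone does not force \<open>F\<close> to tend to 0, but every unit
  interval contains a point where |F| is at most its integral over that interval. Along such points
  towards both ends of the line the boundary terms vanish.\<close>

lemma integral_derivative_eq_0:
  fixes F k :: "real \<Rightarrow> real"
  assumes F: "integrable lebesgue F" "continuous_on UNIV F" and k: "integrable lebesgue k"
    and Fk: "\<And>x y. x \<le> y \<Longrightarrow> (k has_integral (F y - F x)) {x..y}"
  shows "(LINT x|lebesgue. k x) = 0"
proof -
  have small: "\<exists>z\<in>{c..c + 1}. \<bar>F z\<bar> \<le> (LINT x|lebesgue. indicator {c..c + 1} x * \<bar>F x\<bar>)" for c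
  proof -
    have cont: "continuous_on {c..c + 1} (\<lambda>x. \<bar>F x\<bar>)"
      by (intro continuous_intros continuous_on_subset[OF F(2)]) auto
    then obtain z where z: "z \<in> {c..c + 1}" "\<And>y. y \<in> {c..c + 1} \<Longrightarrow> \<bar>F z\<bar> \<le> \<bar>F y\<bar>"
      using continuous_attains_inf[of "{c..c + 1}" "\<lambda>x. \<bar>F x\<bar>"] by auto
    have "integral {c..c + 1} (\<lambda>_. \<bar>F z\<bar>) \<le> integral {c..c + 1} (\<lambda>x. \<bar>F x\<bar>)"
      by (intro integral_le integrable_continuous_interval cont continuous_intros z)
    also have "\<dots> = (LINT x:{c..c + 1}|lebesgue. \<bar>F x\<bar>)"
      using set_lebesgue_integral_eq_integral(2)[OF absolutely_integrable_continuous_real[OF cont]] by simp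
    finally show ?thesis using z(1) by (auto simp: set_lebesgue_integral_def)
  qed
  define pt where "pt c = (SOME z. z \<in> {c..c + 1} \<and> \<bar>F z\<bar> \<le> (LINT x|lebesgue. indicator {c..c + 1} x * \<bar>F x\<bar>))" for c
  have pt: "pt c \<in> {c..c + 1}" "\<bar>F (pt c)\<bar> \<le> (LINT x|lebesgue. indicator {c..c + 1} x * \<bar>F x\<bar>)" for c
    using someI_ex[OF small[of c, unfolded Bex_def]] by (auto simp: pt_def)
  define a b where "a n = pt (real n)" and "b n = pt (- real n - 1)" for n
  have ab: "a n \<in> {real n..real n + 1}" "\<bar>F (a n)\<bar> \<le> (LINT x|lebesgue. indicator {real n..real n + 1} x * \<bar>F x\<bar>)"
    "b n \<in> {- real n - 1..- real n - 1 + 1}" "\<bar>F (b n)\<bar> \<le> (LINT x|lebesgue. indicator {- real n - 1..- real n - 1 + 1} x * \<bar>F x\<bar>)" for n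
    unfolding a_def b_def by (rule pt)+
  have Fm [measurable]: "F \<in> borel_measurable lebesgue" by (rule borel_measurable_integrable[OF F(1)])
  have tail: "(\<lambda>n. LINT x|lebesgue. indicator (I n) x * \<bar>F x\<bar>) \<longlonglongrightarrow> 0"
    if I: "\<And>n. I n \<in> sets lebesgue" "\<And>x. \<forall>\<^sub>F n in sequentially. x \<notin> I n" for I :: "nat \<Rightarrow> real set"
  proof -
    have "(\<lambda>n. LINT x|lebesgue. indicator (I n) x * \<bar>F x\<bar>) \<longlonglongrightarrow> (LINT x :: real|lebesgue. 0)"
    proof (rule integral_dominated_convergence[where w = "\<lambda>x. \<bar>F x\<bar>"])
      show "AE x in lebesgue. (\<lambda>n. indicator (I n) x * \<bar>F x\<bar>) \<longlonglongrightarrow> 0"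
      proof (intro AE_I2 tendsto_eventually)
        fix x
        show "\<forall>\<^sub>F n in sequentially. indicator (I n) x * \<bar>F x\<bar> = 0"
          using I(2)[of x] by eventually_elim simp
      qed
    qed (use F I in \<open>auto simp: indicator_def\<close>)
    then show ?thesis by simp
  qed
  have far: "\<forall>\<^sub>F n in sequentially. \<bar>x\<bar> < real n" for x :: real
  proof -
    obtain N where "\<bar>x\<bar> < real N" using reals_Archimedean2 by blast
    then show ?thesis by (intro eventually_sequentiallyI[of N]) simp
  qed
  have "(\<lambda>n. F (a n)) \<longlonglongrightarrow> 0"
  proof (rule Lim_null_comparison[OF _ tail])
    show "\<forall>\<^sub>F n in sequentially. norm (F (a n)) \<le> (LINT x|lebesgue. indicator {real n..real n + 1} x * \<bar>F x\<bar>)"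
      using ab by auto
    show "\<forall>\<^sub>F n in sequentially. x \<notin> {real n..real n + 1}" for x
      using far[of x] by eventually_elim auto
  qed auto
  moreover have "(\<lambda>n. F (b n)) \<longlonglongrightarrow> 0"
  proof (rule Lim_null_comparison[OF _ tail])
    show "\<forall>\<^sub>F n in sequentially. norm (F (b n)) \<le> (LINT x|lebesgue. indicator {- real n - 1..- real n - 1 + 1} x * \<bar>F x\<bar>)"
      using ab(4) by (intro always_eventually allI) simp
    show "\<forall>\<^sub>F n in sequentially. x \<notin> {- real n - 1..- real n - 1 + 1}" for x
      using far[of x] by eventually_elim auto
  qed auto
  ultimately have lim0: "(\<lambda>n. F (a n) - F (b n)) \<longlonglongrightarrow> 0 - 0" by (intro tendsto_intros)
  have eq: "F (a n) - F (b n) = (LINT x|lebesgue. indicator {b n..a n} x * k x)" for n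
  proof -
    have si: "set_integrable lebesgue {b n..a n} k"
      unfolding set_integrable_def by (intro integrable_mult_indicator k) auto
    have "b n \<le> a n" using ab(1)[of n] ab(3)[of n] by auto
    from integral_unique[OF Fk[OF this]] show ?thesis
      using set_lebesgue_integral_eq_integral(2)[OF si] by (simp add: set_lebesgue_integral_def)
  qed
  have "(\<lambda>n. LINT x|lebesgue. indicator {b n..a n} x * k x) \<longlonglongrightarrow> (LINT x|lebesgue. k x)"
  proof (rule integral_dominated_convergence[where w = "\<lambda>x. \<bar>k x\<bar>"])
    show "AE x in lebesgue. (\<lambda>n. indicator {b n..a n} x * k x) \<longlonglongrightarrow> k x"
    proof (intro AE_I2 tendsto_eventually)
      fix x :: real
      show "\<forall>\<^sub>F n in sequentially. indicator {b n..a n} x * k x = k x"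
        using far[of x]
      proof eventually_elim
        case (elim n)
        then have "x \<in> {b n..a n}" using ab(1)[of n] ab(3)[of n] by (auto simp: abs_less_iff)
        then show ?case by simp
      qed
    qed
    show "k \<in> borel_measurable lebesgue" by (rule borel_measurable_integrable[OF k])
    then show "(\<lambda>x. indicator {b n..a n} x * k x) \<in> borel_measurable lebesgue" for n
      by (intro borel_measurable_times borel_measurable_indicator) auto
  qed (use k in \<open>auto simp: indicator_def\<close>)
  from LIMSEQ_unique[OF this[folded eq] lim0] show ?thesis by simp
qed

lemma continuous_integral_square_eq_0:
  fixes u :: "real \<Rightarrow> real"
  assumes u: "continuous_on UNIV u" "integrable lebesgue (\<lambda>x. (u x)\<^sup>2)" "(LINT x|lebesgue. (u x)\<^sup>2) = 0"
  shows "u x = 0"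
proof -
  have "integral {x - 1..x + 1} (\<lambda>x. (u x)\<^sup>2) \<le> 0"
    using integral_subinterval_le(2)[OF u(2), of "x - 1" "x + 1"] u(3) by simp
  moreover have "0 \<le> integral {x - 1..x + 1} (\<lambda>x. (u x)\<^sup>2)"
    by (intro Henstock_Kurzweil_Integration.integral_nonneg integral_subinterval_le(1)[OF u(2)]) auto
  ultimately have "integral (cbox (x - 1) (x + 1)) (\<lambda>x. (u x)\<^sup>2) = 0" by simp
  then have "\<forall>y\<in>cbox (x - 1) (x + 1). (u y)\<^sup>2 = 0"
    by (subst (asm) integral_cbox_eq_0_iff) (auto intro!: continuous_intros continuous_on_subset[OF u(1)])
  then show ?thesis by simp
qed

section \<open>Real eigenfunctions\<close>

definition real_eigen :: "(real \<Rightarrow> real) \<Rightarrow> real \<Rightarrow> (real \<Rightarrow> real) \<Rightarrow> (real \<Rightarrow> real) \<Rightarrow> bool" where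
  "real_eigen V \<mu> u u' \<longleftrightarrow> (\<forall>x. (u has_real_derivative u' x) (at x)) \<and>
     (\<forall>x y. x \<le> y \<longrightarrow> ((\<lambda>t. (V t - \<mu>) * u t) has_integral (u' y - u' x)) {x..y}) \<and>
     integrable lebesgue (\<lambda>x. (u x)\<^sup>2)"

locale potential =
  fixes V :: "real \<Rightarrow> real"
  assumes V_meas: "V \<in> borel_measurable lebesgue" and V_nonneg: "\<And>x. 0 \<le> V x"
    and V_loc: "\<And>R. \<exists>C. \<forall>x. \<bar>x\<bar> \<le> R \<longrightarrow> V x \<le> C"
begin

context
  fixes \<mu> u u' assumes u: "real_eigen V \<mu> u u'"
begin

lemma eigen_derivative: "(u has_real_derivative u' x) (at x)"
  and eigen_integral: "x \<le> y \<Longrightarrow> ((\<lambda>t. (V t - \<mu>) * u t) has_integral (u' y - u' x)) {x..y}"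
  and eigen_L2: "integrable lebesgue (\<lambda>x. (u x)\<^sup>2)"
  using u by (auto simp: real_eigen_def)

lemma eigen_continuous: "continuous_on X u"
  by (rule DERIV_continuous_on[OF has_field_derivative_at_within[OF eigen_derivative]])

lemma eigen_derivative_continuous: "continuous_on X u'"
proof -
  have "continuous_on {s..e} u'" if "s < e" for s e
  proof -
    have "(\<lambda>t. (V t - \<mu>) * u t) integrable_on {s..e}" using eigen_integral[of s e] that by auto
    then have "continuous_on {s..e} (\<lambda>x. u' s + integral {s..x} (\<lambda>t. (V t - \<mu>) * u t))"
      by (intro continuous_intros indefinite_integral_continuous_1)
    then show ?thesis
    proof (rule continuous_on_eq)
      fix x assume "x \<in> {s..e}"
      then show "u' s + integral {s..x} (\<lambda>t. (V t - \<mu>) * u t) = u' x"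
        using integral_unique[OF eigen_integral, of s x] by simp
    qed
  qed
  then have "isCont u' x" for x
    using continuous_on_interior[of "{x - 1..x + 1}" u' x] by simp
  then show ?thesis by (simp add: continuous_at_imp_continuous_on)
qed

lemma eigen_rhs_bounded: "\<exists>C. \<forall>x\<in>{s..e}. \<bar>(V x - \<mu>) * u x\<bar> \<le> C"
proof -
  obtain A where "\<forall>x. \<bar>x\<bar> \<le> max \<bar>s\<bar> \<bar>e\<bar> \<longrightarrow> V x \<le> A" using V_loc ..
  then have A: "\<And>x. \<bar>x\<bar> \<le> max \<bar>s\<bar> \<bar>e\<bar> \<Longrightarrow> V x \<le> A" by simp
  have "compact (u ` {s..e})" by (intro compact_continuous_image eigen_continuous) auto
  then obtain G where G: "\<forall>x\<in>u ` {s..e}. norm x \<le> G" using compact_imp_bounded bounded_pos by metis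
  have "\<bar>(V x - \<mu>) * u x\<bar> \<le> (A + \<bar>\<mu>\<bar>) * G" if "x \<in> {s..e}" for x
  proof -
    have "\<bar>x\<bar> \<le> max \<bar>s\<bar> \<bar>e\<bar>" using that by auto
    then have "V x \<le> A" by (rule A)
    then have "\<bar>V x - \<mu>\<bar> \<le> A + \<bar>\<mu>\<bar>" using V_nonneg[of x] by linarith
    then show ?thesis unfolding abs_mult using G that by (intro mult_mono) auto
  qed
  then show ?thesis by blast
qed

lemma eigen_by_parts:
  assumes xy: "x \<le> y" and p: "\<And>t. (p has_real_derivative p' t) (at t)" "continuous_on UNIV p'"
  shows "((\<lambda>t. p' t * u' t + p t * ((V t - \<mu>) * u t)) has_integral (p y * u' y - p x * u' x)) {x..y}"
proof -
  obtain C where C: "\<forall>t\<in>{x..y}. \<bar>(V t - \<mu>) * u t\<bar> \<le> C" using eigen_rhs_bounded by blast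
  show ?thesis
  proof (rule integration_by_parts_bounded[OF xy, where C = C])
    show "u' t = u' x + integral {x..t} (\<lambda>t. (V t - \<mu>) * u t)" if "t \<in> {x..y}" for t
      using integral_unique[OF eigen_integral, of x t] that by simp
  qed (use p C eigen_integral[OF xy] in \<open>auto intro: has_field_derivative_at_within continuous_on_subset\<close>)
qed

lemma eigen_energy_integral:
  assumes "x \<le> y"
  shows "((\<lambda>t. (u' t)\<^sup>2 + V t * (u t)\<^sup>2) has_integral (u y * u' y - u x * u' x + \<mu> * integral {x..y} (\<lambda>t. (u t)\<^sup>2))) {x..y}"
proof -
  have 1: "((\<lambda>t. u' t * u' t + u t * ((V t - \<mu>) * u t)) has_integral (u y * u' y - u x * u' x)) {x..y}"
    by (rule eigen_by_parts[OF assms eigen_derivative eigen_derivative_continuous])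
  have "((\<lambda>t. \<mu> * (u t)\<^sup>2) has_integral (\<mu> * integral {x..y} (\<lambda>t. (u t)\<^sup>2))) {x..y}"
    by (intro has_integral_mult_right integrable_integral integrable_continuous_interval continuous_intros eigen_continuous)
  from has_integral_add[OF 1 this] show ?thesis
    by (simp add: power2_eq_square algebra_simps)
qed

text \<open>
  If the energy on \<open>[0, x]\<close> exceeded the bound, then \<open>u u'\<close> would stay above \<open>1\<close>, so \<open>u\<^sup>2\<close> would grow
  linearly, contradicting integrability.
\<close>
lemma eigen_energy_bounded_right:
  assumes x: "x \<ge> 0"
  shows "integral {0..x} (\<lambda>t. (u' t)\<^sup>2 + V t * (u t)\<^sup>2) \<le> - u 0 * u' 0 + \<bar>\<mu>\<bar> * (LINT x|lebesgue. (u x)\<^sup>2) + 1"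
proof (rule ccontr)
  define P where "P y = integral {0..y} (\<lambda>t. (u' t)\<^sup>2 + V t * (u t)\<^sup>2)" for y
  define U where "U = (LINT x|lebesgue. (u x)\<^sup>2)"
  assume "\<not> ?thesis"
  then have gt: "P x > - u 0 * u' 0 + \<bar>\<mu>\<bar> * U + 1" by (simp add: P_def U_def)
  have Pi: "(\<lambda>t. (u' t)\<^sup>2 + V t * (u t)\<^sup>2) integrable_on {a..b}" if "a \<le> b" for a b
    using eigen_energy_integral[OF that] by auto
  have mono: "P x \<le> P y" if "x \<le> y" for y
    unfolding P_def using x that Pi V_nonneg by (intro integral_subset_le) auto
  have uu': "u y * u' y \<ge> 1" if "x \<le> y" for y
  proof -
    have "P y = u y * u' y - u 0 * u' 0 + \<mu> * integral {0..y} (\<lambda>t. (u t)\<^sup>2)"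
      unfolding P_def using eigen_energy_integral[of 0 y] x that by (simp add: integral_unique)
    moreover have "\<mu> * integral {0..y} (\<lambda>t. (u t)\<^sup>2) \<le> \<bar>\<mu>\<bar> * U"
    proof -
      have "integral {0..y} (\<lambda>t. (u t)\<^sup>2) \<le> U" unfolding U_def by (rule integral_subinterval_le[OF eigen_L2]) simp
      moreover have "0 \<le> integral {0..y} (\<lambda>t. (u t)\<^sup>2)"
        by (intro Henstock_Kurzweil_Integration.integral_nonneg integral_subinterval_le(1)[OF eigen_L2]) auto
      ultimately show ?thesis by (intro mult_mono) auto
    qed
    ultimately show ?thesis using gt mono[OF that] by simp
  qed
  have u2: "(u y)\<^sup>2 \<ge> 2" if "x + 1 \<le> y" for y
  proof -
    have "((\<lambda>t. 2 * (u t * u' t)) has_integral (u y)\<^sup>2 - (u x)\<^sup>2) {x..y}"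
      by (rule fundamental_theorem_of_calculus)
         (use that in \<open>auto intro!: derivative_eq_intros has_field_derivative_at_within[OF eigen_derivative] simp flip: has_real_derivative_iff_has_vector_derivative\<close>)
    then have "2 * (y - x) \<le> (u y)\<^sup>2 - (u x)\<^sup>2"
      using has_integral_le[OF has_integral_const_real[of 2 x y]] uu' that by (simp add: mult.commute)
    moreover have "2 \<le> 2 * (y - x)" using that by simp
    ultimately have "2 + (u x)\<^sup>2 \<le> (u y)\<^sup>2" by simp
    then show ?thesis by (rule order_trans[rotated]) simp
  qed
  define N where "N = \<bar>U\<bar> + 1"
  have "integral {x + 1..x + 1 + N} (\<lambda>_. 2) \<le> integral {x + 1..x + 1 + N} (\<lambda>t. (u t)\<^sup>2)"
    by (intro integral_le integral_subinterval_le(1)[OF eigen_L2]) (use u2 in auto)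
  also have "\<dots> \<le> U" unfolding U_def by (rule integral_subinterval_le(2)[OF eigen_L2]) simp
  finally show False by (simp add: N_def)
qed

end

text \<open>Reflection, applied to the potential as well, makes the energy bound on the right
  half-line available on the left one.\<close>

lemma eigen_reflect:
  assumes u: "real_eigen V \<mu> u u'"
  shows "real_eigen (\<lambda>x. V (- x)) \<mu> (\<lambda>x. u (- x)) (\<lambda>x. - u' (- x))"
  unfolding real_eigen_def
proof (intro conjI allI impI)
  fix x
  show "((\<lambda>x. u (- x)) has_real_derivative - u' (- x)) (at x)"
  proof -
    have "((\<lambda>x. u (- x)) has_real_derivative u' (- x) * (- 1)) (at x)"
      by (rule DERIV_chain2[where f = u and g = uminus, OF eigen_derivative[OF u]]) (auto intro!: derivative_eq_intros)
    then show ?thesis by simp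
  qed
next
  fix x y :: real assume "x \<le> y"
  then have "((\<lambda>t. (V t - \<mu>) * u t) has_integral (u' (- x) - u' (- y))) {- y..- x}"
    by (intro eigen_integral[OF u]) simp
  then show "((\<lambda>t. (V (- t) - \<mu>) * u (- t)) has_integral (- u' (- y) - - u' (- x))) {x..y}"
    using has_integral_reflect_real[of "\<lambda>t. (V t - \<mu>) * u t" _ "- x" "- y"] by simp
next
  show "integrable lebesgue (\<lambda>x. (u (- x))\<^sup>2)"
  proof -
    have "integrable lborel (\<lambda>x. (u x)\<^sup>2)"
      using eigen_L2[OF u] eigen_continuous[OF u, of UNIV]
      by (subst (asm) integrable_completion) (auto intro!: borel_measurable_continuous_onI continuous_intros)
    then have "integrable lborel (\<lambda>x. (u (0 + (-1) * x))\<^sup>2)" by (rule lborel_integrable_real_affine) simp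
    then show ?thesis
      using eigen_continuous[OF u, of UNIV]
      by (subst integrable_completion) (auto intro!: borel_measurable_continuous_onI continuous_intros continuous_on_compose2[of UNIV u])
  qed
qed

lemma potential_reflect: "potential (\<lambda>x. V (- x))"
proof
  show "(\<lambda>x. V (- x)) \<in> borel_measurable lebesgue"
    using measurable_compose[OF lebesgue_measurable_scaling[of "-1"] V_meas] by (simp add: o_def)
  show "\<exists>C. \<forall>x. \<bar>x\<bar> \<le> R \<longrightarrow> V (- x) \<le> C" for R
  proof -
    obtain C where "\<forall>x. \<bar>x\<bar> \<le> R \<longrightarrow> V x \<le> C" using V_loc[of R] ..
    then show ?thesis by (intro exI[of _ C]) simp
  qed
qed (rule V_nonneg)

lemma eigen_energy_integrable:
  assumes u: "real_eigen V \<mu> u u'"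
  shows "integrable lebesgue (\<lambda>x. (u' x)\<^sup>2 + V x * (u x)\<^sup>2)"
proof -
  interpret R: potential "\<lambda>x. V (- x)" by (rule potential_reflect)
  define k where "k x = (u' x)\<^sup>2 + V x * (u x)\<^sup>2" for x
  have ki: "k integrable_on {x..y}" for x y
    using eigen_energy_integral[OF u, of x y] by (cases "x \<le> y") (auto simp: k_def[abs_def])
  obtain A where A: "\<And>x. x \<ge> 0 \<Longrightarrow> integral {0..x} k \<le> A"
    using eigen_energy_bounded_right[OF u] by (auto simp: k_def[abs_def])
  obtain B where B: "\<And>x. x \<ge> 0 \<Longrightarrow> integral {0..x} (\<lambda>t. k (- t)) \<le> B"
    using R.eigen_energy_bounded_right[OF eigen_reflect[OF u]] by (auto simp: k_def[abs_def])
  have "integral {- real n..real n} k \<le> A + B" for n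
  proof -
    have "integral {- real n..real n} k = integral {- real n..0} k + integral {0..real n} k"
      by (rule Henstock_Kurzweil_Integration.integral_combine[symmetric]) (auto intro: ki)
    moreover have "integral {- real n..0} k = integral {0..real n} (\<lambda>t. k (- t))"
      using Henstock_Kurzweil_Integration.integral_reflect_real[of "real n" 0 "\<lambda>t. k (- t)"] by simp
    ultimately show ?thesis using A[of "real n"] B[of "real n"] by simp
  qed
  then have "integrable lebesgue k"
    by (intro integrable_of_bounded_integrals(1)[of k "A + B"] ki) (auto simp: k_def V_nonneg)
  then show ?thesis by (simp add: k_def[abs_def])
qed

lemma eigen_integrable:
  assumes u: "real_eigen V \<mu> u u'"
  shows "integrable lebesgue (\<lambda>x. (u' x)\<^sup>2)" "integrable lebesgue (\<lambda>x. V x * (u x)\<^sup>2)"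
    "u \<in> borel_measurable lebesgue" "u' \<in> borel_measurable lebesgue"
proof -
  show m [measurable]: "u \<in> borel_measurable lebesgue" "u' \<in> borel_measurable lebesgue"
    using eigen_continuous[OF u, of UNIV] eigen_derivative_continuous[OF u, of UNIV]
    by (auto intro!: measurable_completion borel_measurable_continuous_onI)
  note [measurable] = V_meas
  show "integrable lebesgue (\<lambda>x. (u' x)\<^sup>2)"
    by (rule Bochner_Integration.integrable_bound[OF eigen_energy_integrable[OF u]])
       (use V_nonneg in auto)
  show "integrable lebesgue (\<lambda>x. V x * (u x)\<^sup>2)"
    by (rule Bochner_Integration.integrable_bound[OF eigen_energy_integrable[OF u]])
       (use V_nonneg in auto)
qed

text \<open>The last claim is the weak form of the equation for \<open>v\<close>, tested with
  \<open>u\<close>; the boundary terms vanish because \<open>u * v'\<close> is integrable. Only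
  \<open>\<nu>\<close> occurs on the right, so exchanging the two functions yields
  orthogonality.\<close>

lemma eigen_pair:
  assumes u: "real_eigen V \<mu> u u'" and v: "real_eigen V \<nu> v v'"
  shows "integrable lebesgue (\<lambda>x. u x * v x)" "integrable lebesgue (\<lambda>x. u' x * v' x)"
    "integrable lebesgue (\<lambda>x. V x * (u x * v x))"
    "(LINT x|lebesgue. u' x * v' x) + (LINT x|lebesgue. V x * (u x * v x)) = \<nu> * (LINT x|lebesgue. u x * v x)"
proof -
  note [measurable] = eigen_integrable(3,4)[OF u] eigen_integrable(3,4)[OF v] V_meas
  have le: "\<bar>a * b\<bar> \<le> a\<^sup>2 + b\<^sup>2" for a b :: real
  proof -
    have "2 * (\<bar>a\<bar> * \<bar>b\<bar>) \<le> \<bar>a\<bar>\<^sup>2 + \<bar>b\<bar>\<^sup>2" using sum_squares_bound[of "\<bar>a\<bar>" "\<bar>b\<bar>"] by simp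
    moreover have "0 \<le> \<bar>a\<bar> * \<bar>b\<bar>" by simp
    ultimately show ?thesis unfolding abs_mult power2_abs by linarith
  qed
  have prod: "integrable lebesgue (\<lambda>x. p x * q x)"
    if "integrable lebesgue (\<lambda>x. (p x)\<^sup>2)" "integrable lebesgue (\<lambda>x. (q x)\<^sup>2)"
      "p \<in> borel_measurable lebesgue" "q \<in> borel_measurable lebesgue" for p q :: "real \<Rightarrow> real"
    by (rule Bochner_Integration.integrable_bound[OF Bochner_Integration.integrable_add[OF that(1,2)]])
       (use that le in auto)
  show iuv: "integrable lebesgue (\<lambda>x. u x * v x)"
    by (rule prod) (use eigen_L2[OF u] eigen_L2[OF v] in auto)
  show iu'v': "integrable lebesgue (\<lambda>x. u' x * v' x)"
    by (rule prod) (use eigen_integrable[OF u] eigen_integrable[OF v] in auto)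
  show iV: "integrable lebesgue (\<lambda>x. V x * (u x * v x))"
  proof (rule Bochner_Integration.integrable_bound[OF Bochner_Integration.integrable_add[OF eigen_integrable(2)[OF u] eigen_integrable(2)[OF v]]])
    show "AE x in lebesgue. norm (V x * (u x * v x)) \<le> norm (V x * (u x)\<^sup>2 + V x * (v x)\<^sup>2)"
    proof (rule AE_I2)
      fix x
      have "V x * \<bar>u x * v x\<bar> \<le> V x * ((u x)\<^sup>2 + (v x)\<^sup>2)" by (intro mult_left_mono le V_nonneg)
      then show "norm (V x * (u x * v x)) \<le> norm (V x * (u x)\<^sup>2 + V x * (v x)\<^sup>2)"
        using V_nonneg[of x] by (simp add: abs_mult distrib_left)
    qed
  qed measurable
  have iF: "integrable lebesgue (\<lambda>x. u x * v' x)"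
    by (rule prod) (use eigen_L2[OF u] eigen_integrable[OF v] in auto)
  have ik: "integrable lebesgue (\<lambda>x. u' x * v' x + V x * (u x * v x) - \<nu> * (u x * v x))"
    by (intro Bochner_Integration.integrable_diff Bochner_Integration.integrable_add integrable_mult_right iuv iu'v' iV)
  have "(LINT x|lebesgue. u' x * v' x + V x * (u x * v x) - \<nu> * (u x * v x)) = 0"
  proof (rule integral_derivative_eq_0[OF iF _ ik])
    show "continuous_on UNIV (\<lambda>x. u x * v' x)"
      by (intro continuous_intros eigen_continuous[OF u] eigen_derivative_continuous[OF v])
    show "((\<lambda>x. u' x * v' x + V x * (u x * v x) - \<nu> * (u x * v x)) has_integral (u y * v' y - u x * v' x)) {x..y}"
      if "x \<le> y" for x y
      using eigen_by_parts[OF v that eigen_derivative[OF u] eigen_derivative_continuous[OF u]]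
      by (simp add: algebra_simps)
  qed
  then show "(LINT x|lebesgue. u' x * v' x) + (LINT x|lebesgue. V x * (u x * v x)) = \<nu> * (LINT x|lebesgue. u x * v x)"
    using iuv iu'v' iV by simp
qed

lemma eigen_orthogonal:
  assumes u: "real_eigen V \<mu> u u'" and v: "real_eigen V \<nu> v v'" and ne: "\<mu> \<noteq> \<nu>"
  shows "(LINT x|lebesgue. u x * v x) = 0"
proof -
  have "\<nu> * (LINT x|lebesgue. u x * v x) = \<mu> * (LINT x|lebesgue. u x * v x)"
    using eigen_pair(4)[OF u v] eigen_pair(4)[OF v u] by (simp add: mult.commute)
  then show ?thesis using ne by simp
qed

text \<open>Pythagoras for the eigencomponents, with weights \<open>c \<mu>\<close> so that powers
  of \<open>\<mu>\<close> can be inserted. Gradient terms and potential terms need not be orthogonal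
  separately; only their sum is, hence the combined last identity.\<close>

lemma eigen_sum_norms:
  assumes \<Lambda>: "finite \<Lambda>" and g: "\<And>\<mu>. \<mu> \<in> \<Lambda> \<Longrightarrow> real_eigen V \<mu> (g \<mu>) (g' \<mu>)"
  shows "integrable lebesgue (\<lambda>x. (\<Sum>\<mu>\<in>\<Lambda>. c \<mu> * g \<mu> x)\<^sup>2)" (is ?A)
    "integrable lebesgue (\<lambda>x. (\<Sum>\<mu>\<in>\<Lambda>. c \<mu> * g' \<mu> x)\<^sup>2)" (is ?B)
    "integrable lebesgue (\<lambda>x. V x * (\<Sum>\<mu>\<in>\<Lambda>. c \<mu> * g \<mu> x)\<^sup>2)" (is ?C)
    "(LINT x|lebesgue. (\<Sum>\<mu>\<in>\<Lambda>. c \<mu> * g \<mu> x)\<^sup>2) = (\<Sum>\<mu>\<in>\<Lambda>. (c \<mu>)\<^sup>2 * (LINT x|lebesgue. (g \<mu> x)\<^sup>2))" (is ?D)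
    "(LINT x|lebesgue. (\<Sum>\<mu>\<in>\<Lambda>. c \<mu> * g' \<mu> x)\<^sup>2) + (LINT x|lebesgue. V x * (\<Sum>\<mu>\<in>\<Lambda>. c \<mu> * g \<mu> x)\<^sup>2)
      = (\<Sum>\<mu>\<in>\<Lambda>. (c \<mu>)\<^sup>2 * (\<mu> * (LINT x|lebesgue. (g \<mu> x)\<^sup>2)))" (is ?E)
proof -
  have sq: "(\<Sum>\<mu>\<in>\<Lambda>. c \<mu> * h \<mu> x)\<^sup>2 = (\<Sum>\<mu>\<in>\<Lambda>. \<Sum>\<nu>\<in>\<Lambda>. (c \<mu> * c \<nu>) * (h \<mu> x * h \<nu> x))" for h :: "real \<Rightarrow> real \<Rightarrow> real" and x
    unfolding power2_eq_square sum_product by (intro sum.cong refl) (simp add: mult_ac)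
  have sqV: "V x * (\<Sum>\<mu>\<in>\<Lambda>. c \<mu> * g \<mu> x)\<^sup>2 = (\<Sum>\<mu>\<in>\<Lambda>. \<Sum>\<nu>\<in>\<Lambda>. (c \<mu> * c \<nu>) * (V x * (g \<mu> x * g \<nu> x)))" for x
    unfolding sq sum_distrib_left by (intro sum.cong refl) (simp add: mult_ac)
  note p = eigen_pair[OF g g]
  show ?A unfolding sq by (intro Bochner_Integration.integrable_sum integrable_mult_right p)
  show ?B unfolding sq by (intro Bochner_Integration.integrable_sum integrable_mult_right p)
  show ?C unfolding sqV by (intro Bochner_Integration.integrable_sum integrable_mult_right p)
  have diag: "(\<Sum>\<mu>\<in>\<Lambda>. \<Sum>\<nu>\<in>\<Lambda>. (c \<mu> * c \<nu>) * (w \<nu> * (LINT x|lebesgue. g \<mu> x * g \<nu> x)))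
      = (\<Sum>\<mu>\<in>\<Lambda>. (c \<mu>)\<^sup>2 * (w \<mu> * (LINT x|lebesgue. (g \<mu> x)\<^sup>2)))" for w :: "real \<Rightarrow> real"
  proof (intro sum.cong refl)
    fix \<mu> assume \<mu>: "\<mu> \<in> \<Lambda>"
    have "(\<Sum>\<nu>\<in>\<Lambda>. (c \<mu> * c \<nu>) * (w \<nu> * (LINT x|lebesgue. g \<mu> x * g \<nu> x)))
        = (\<Sum>\<nu>\<in>\<Lambda>. if \<nu> = \<mu> then (c \<mu>)\<^sup>2 * (w \<mu> * (LINT x|lebesgue. (g \<mu> x)\<^sup>2)) else 0)"
      using eigen_orthogonal[OF g g] \<mu> by (intro sum.cong refl) (auto simp: power2_eq_square)
    then show "(\<Sum>\<nu>\<in>\<Lambda>. (c \<mu> * c \<nu>) * (w \<nu> * (LINT x|lebesgue. g \<mu> x * g \<nu> x)))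
        = (c \<mu>)\<^sup>2 * (w \<mu> * (LINT x|lebesgue. (g \<mu> x)\<^sup>2))"
      using \<Lambda> \<mu> by simp
  qed
  show ?D
    unfolding sq using diag[of "\<lambda>_. 1"] p by simp
  have "(LINT x|lebesgue. (\<Sum>\<mu>\<in>\<Lambda>. c \<mu> * g' \<mu> x)\<^sup>2) + (LINT x|lebesgue. V x * (\<Sum>\<mu>\<in>\<Lambda>. c \<mu> * g \<mu> x)\<^sup>2)
      = (\<Sum>\<mu>\<in>\<Lambda>. \<Sum>\<nu>\<in>\<Lambda>. (c \<mu> * c \<nu>) * (LINT x|lebesgue. g' \<mu> x * g' \<nu> x))
      + (\<Sum>\<mu>\<in>\<Lambda>. \<Sum>\<nu>\<in>\<Lambda>. (c \<mu> * c \<nu>) * (LINT x|lebesgue. V x * (g \<mu> x * g \<nu> x)))"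
    unfolding sqV unfolding sq using p by simp
  also have "\<dots> = (\<Sum>\<mu>\<in>\<Lambda>. \<Sum>\<nu>\<in>\<Lambda>. (c \<mu> * c \<nu>) * (\<nu> * (LINT x|lebesgue. g \<mu> x * g \<nu> x)))"
    unfolding sum.distrib[symmetric] distrib_left[symmetric]
    by (intro sum.cong refl) (simp add: p(4))
  also note diag[of "\<lambda>\<nu>. \<nu>"]
  finally show ?E .
qed

end

section \<open>From single intervals to the whole line\<close>

section \<open>Summation over the intervals\<close>

lemma sum_integral_intervals:
  fixes h :: "real \<Rightarrow> real"
  assumes h: "integrable lebesgue h" "\<And>x. h x \<ge> 0" and a: "a > 0"
  shows "(\<Sum>i<n. integral {v + real i * a..v + real (Suc i) * a} h) = integral {v..v + real n * a} h"
proof (induction n)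
  case (Suc n)
  have "integral {v..v + real n * a} h + integral {v + real n * a..v + real (Suc n) * a} h = integral {v..v + real (Suc n) * a} h"
    using a integral_subinterval_le(1)[OF h]
    by (intro Henstock_Kurzweil_Integration.integral_combine) (auto simp: algebra_simps)
  then show ?case using Suc.IH by simp
qed (simp add: integral_singleton[of v, simplified])

text \<open>Each window consists of 11 cells, and for a fixed position within the window the cells
  overlap only at endpoints as \<open>i\<close> varies.\<close>

lemma sum_integral_overlap:
  fixes h :: "real \<Rightarrow> real"
  assumes h: "integrable lebesgue h" "\<And>x. h x \<ge> 0" and a: "a > 0"
  shows "(\<Sum>i<n. integral {v + real i * a..v + real (i + 11) * a} h) \<le> 11 * (LINT x|lebesgue. h x)"
proof -
  define H where "H i = integral {v + real i * a..v + real (Suc i) * a} h" for i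
  have "integral {v + real i * a..v + real (i + 11) * a} h = (\<Sum>j<11. H (i + j))" for i
  proof -
    have "(\<Sum>j<11. integral {(v + real i * a) + real j * a..(v + real i * a) + real (Suc j) * a} h)
        = integral {v + real i * a..(v + real i * a) + real 11 * a} h"
      by (rule sum_integral_intervals[OF h a])
    moreover have "(v + real i * a) + real j * a = v + real (i + j) * a"
      "(v + real i * a) + real (Suc j) * a = v + real (Suc (i + j)) * a"
      "(v + real i * a) + real 11 * a = v + real (i + 11) * a" for j by (simp_all add: algebra_simps)
    ultimately show ?thesis unfolding H_def by (simp only:)
  qed
  then have "(\<Sum>i<n. integral {v + real i * a..v + real (i + 11) * a} h) = (\<Sum>i<n. \<Sum>j<11. H (i + j))" by simp
  also have "\<dots> = (\<Sum>j<11. \<Sum>i<n. H (i + j))" by (rule sum.swap)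
  also have "\<dots> \<le> (\<Sum>j<11 :: nat. LINT x|lebesgue. h x)"
  proof (rule sum_mono)
    fix j :: nat
    have "(\<Sum>i<n. H (i + j)) = (\<Sum>i<n. integral {(v + real j * a) + real i * a..(v + real j * a) + real (Suc i) * a} h)"
      by (simp add: H_def algebra_simps)
    also have "\<dots> = integral {v + real j * a..(v + real j * a) + real n * a} h"
      by (rule sum_integral_intervals[OF h a])
    also have "\<dots> \<le> (LINT x|lebesgue. h x)" by (rule integral_subinterval_le(2)[OF h])
    finally show "(\<Sum>i<n. H (i + j)) \<le> (LINT x|lebesgue. h x)" .
  qed
  finally show ?thesis by simp
qed

text \<open>Compare \<open>u x\<close> with \<open>u y\<close> for \<open>y\<close> in
  \<open>\<omega>\<close> and average over these \<open>y\<close>: the mass on the thick part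
  controls the mean, and the gradient controls the oscillation.\<close>

lemma poincare_on_thick_interval:
  fixes u u' :: "real \<Rightarrow> real"
  assumes a: "a > 0" and \<delta>: "\<delta> > 0" and du: "\<And>x. (u has_real_derivative u' x) (at x)"
    and u': "continuous_on UNIV u'"
    and \<omega>: "\<omega> \<in> sets lebesgue" "\<delta> * a \<le> measure lebesgue (\<omega> \<inter> {s..s + a})"
  shows "integral {s..s + a} (\<lambda>x. (u x)\<^sup>2)
    \<le> 2 / \<delta> * (LINT x:\<omega> \<inter> {s..s + a}|lebesgue. (u x)\<^sup>2) + 2 * a\<^sup>2 * integral {s..s + a} (\<lambda>x. (u' x)\<^sup>2)"
proof -
  let ?I = "{s..s + a}"
  define Q where "Q = integral ?I (\<lambda>x. (u' x)\<^sup>2)"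
  define w where "w = measure lebesgue (\<omega> \<inter> ?I)"
  define T where "T = (LINT x:\<omega> \<inter> ?I|lebesgue. (u x)\<^sup>2)"
  have cu: "continuous_on X u" for X by (rule DERIV_continuous_on[OF has_field_derivative_at_within[OF du]])
  have cu': "continuous_on X u'" for X by (rule continuous_on_subset[OF u']) simp
  have Q0: "Q \<ge> 0" unfolding Q_def
    by (intro Henstock_Kurzweil_Integration.integral_nonneg integrable_continuous_interval continuous_intros cu') auto
  have w: "w > 0" "\<delta> * a \<le> w" using \<omega>(2) less_le_trans[OF mult_pos_pos[OF \<delta> a] \<omega>(2)] by (simp_all add: w_def)
  have T0: "T \<ge> 0" unfolding T_def set_lebesgue_integral_def by (intro Bochner_Integration.integral_nonneg) auto
  have osc: "(u x - u y)\<^sup>2 \<le> a * Q" if xy: "x \<in> ?I" "y \<in> ?I" for x y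
  proof -
    \<comment> \<open>Cauchy-Schwarz with a free parameter: \<open>q = sqrt (Q / a)\<close> is the
      optimal choice, and for \<open>Q = 0\<close> the parameter is sent to 0.\<close>
    have pq: "\<bar>u x - u y\<bar> \<le> (Q / q + q * a) / 2" if q: "q > 0" for q
    proof -
      have le: "\<bar>u y - u x\<bar> \<le> (Q / q + q * a) / 2" if xy: "s \<le> x" "x \<le> y" "y \<le> s + a" for x y
      proof -
        have ftc: "(u' has_integral (u y - u x)) {x..y}"
          by (rule fundamental_theorem_of_calculus)
             (use xy in \<open>auto simp flip: has_real_derivative_iff_has_vector_derivative intro!: has_field_derivative_at_within[OF du]\<close>)
        have c: "continuous_on X (\<lambda>t. ((u' t)\<^sup>2 / q + q) / 2)" for X by (intro continuous_intros cu') (use q in auto)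
        have "norm (integral {x..y} u') \<le> integral {x..y} (\<lambda>t. ((u' t)\<^sup>2 / q + q) / 2)"
        proof (rule Henstock_Kurzweil_Integration.integral_norm_bound_integral)
          show "norm (u' t) \<le> ((u' t)\<^sup>2 / q + q) / 2" for t
            using sum_squares_bound[of "\<bar>u' t\<bar>" q] q by (simp add: field_simps power2_eq_square)
        qed (use ftc integrable_continuous_interval[OF c] in auto)
        also have "\<dots> \<le> integral ?I (\<lambda>t. ((u' t)\<^sup>2 / q + q) / 2)"
          by (rule integral_subset_le) (use xy q integrable_continuous_interval[OF c] in auto)
        also have "\<dots> = (Q / q + q * a) / 2"
        proof -
          have "((\<lambda>t. ((u' t)\<^sup>2 / q + q) / 2) has_integral (Q / q + q * a) / 2) ?I"
            unfolding Q_def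
            by (intro has_integral_divide has_integral_add integrable_integral integrable_continuous_interval continuous_intros cu')
               (use has_integral_const_real[of q s "s + a"] a in \<open>auto simp: mult.commute\<close>)
          then show ?thesis by (rule integral_unique)
        qed
        finally show ?thesis using ftc by (simp add: integral_unique)
      qed
      show ?thesis using le[of x y] le[of y x] xy by (cases "x \<le> y") (auto simp: abs_minus_commute)
    qed
    show ?thesis
    proof (cases "Q = 0")
      case True
      have "\<bar>u x - u y\<bar> \<le> 0 + e" if "e > 0" for e
        using pq[of "e / a"] True that a by simp
      then have "\<bar>u x - u y\<bar> \<le> 0" by (rule field_le_epsilon)
      then show ?thesis using True by simp
    next
      case False
      define q where "q = sqrt (Q / a)"
      have q: "q > 0" "q\<^sup>2 = Q / a" using False Q0 a by (auto simp: q_def)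
      have "Q = a * q\<^sup>2" using q(2) a by simp
      then have "\<bar>u x - u y\<bar> \<le> a * q" using pq[OF q(1)] q(1) by (simp add: power2_eq_square)
      then have "\<bar>u x - u y\<bar>\<^sup>2 \<le> (a * q)\<^sup>2" by (intro power_mono) auto
      also have "\<dots> = a * Q" using q(2) a by (simp add: power_mult_distrib power2_eq_square[of a])
      finally show ?thesis by simp
    qed
  qed
  have pt: "w * (u x)\<^sup>2 \<le> 2 * T + 2 * a * Q * w" if x: "x \<in> ?I" for x
  proof -
    have si: "set_integrable lebesgue (\<omega> \<inter> ?I) (\<lambda>y. (u y)\<^sup>2)"
      by (rule set_integrable_subset[of _ ?I])
         (use \<omega> in \<open>auto intro!: absolutely_integrable_continuous_real continuous_intros cu\<close>)
    have fm: "\<omega> \<inter> ?I \<in> lmeasurable" by (rule bounded_set_imp_lmeasurable) (use \<omega> in auto)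
    have ci: "integrable lebesgue (\<lambda>y. c * indicator (\<omega> \<inter> ?I) y :: real)" for c
      using fm unfolding fmeasurable_def by (intro integrable_mult_right integrable_real_indicator) auto
    have "w * (u x)\<^sup>2 = (LINT y|lebesgue. (u x)\<^sup>2 * indicator (\<omega> \<inter> ?I) y)"
      using fm by (simp add: w_def)
    also have "\<dots> \<le> (LINT y|lebesgue. 2 * (indicator (\<omega> \<inter> ?I) y *\<^sub>R (u y)\<^sup>2) + (2 * a * Q) * indicator (\<omega> \<inter> ?I) y)"
    proof (rule integral_mono)
      show "integrable lebesgue (\<lambda>y. 2 * (indicator (\<omega> \<inter> ?I) y *\<^sub>R (u y)\<^sup>2) + (2 * a * Q) * indicator (\<omega> \<inter> ?I) y)"
        using si ci by (intro Bochner_Integration.integrable_add integrable_mult_right) (auto simp: set_integrable_def)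
      fix y
      show "(u x)\<^sup>2 * indicator (\<omega> \<inter> ?I) y \<le> 2 * (indicator (\<omega> \<inter> ?I) y *\<^sub>R (u y)\<^sup>2) + (2 * a * Q) * indicator (\<omega> \<inter> ?I) y"
      proof (cases "y \<in> \<omega> \<inter> ?I")
        case True
        have "(u x)\<^sup>2 \<le> 2 * (u y)\<^sup>2 + 2 * (u x - u y)\<^sup>2"
          using zero_le_power2[of "2 * u y - u x"] by (simp add: power2_eq_square algebra_simps)
        then show ?thesis using osc[OF x, of y] True by simp
      qed simp
    qed (rule ci)
    also have "\<dots> = 2 * T + (2 * a * Q) * w"
      using si ci[of "2 * a * Q"] fm by (simp add: T_def w_def set_integrable_def set_lebesgue_integral_def)
    finally show ?thesis by simp
  qed
  have "(u x)\<^sup>2 \<le> 2 / (\<delta> * a) * T + 2 * a * Q" if x: "x \<in> ?I" for x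
  proof -
    have "(u x)\<^sup>2 \<le> 2 * T / w + 2 * a * Q" using pt[OF x] w by (simp add: field_simps)
    also have "2 * T / w \<le> 2 * T / (\<delta> * a)" using w T0 a \<delta> by (intro divide_left_mono) auto
    finally show ?thesis by simp
  qed
  then have "integral ?I (\<lambda>x. (u x)\<^sup>2) \<le> integral ?I (\<lambda>_. 2 / (\<delta> * a) * T + 2 * a * Q)"
    by (intro integral_le integrable_continuous_interval continuous_intros cu)
  also have "\<dots> = a * (2 / (\<delta> * a) * T + 2 * a * Q)" using a by simp
  also have "\<dots> = 2 / \<delta> * T + 2 * a\<^sup>2 * Q" using a \<delta> by (simp add: field_simps power2_eq_square)
  finally show ?thesis by (simp add: T_def Q_def)
qed

section \<open>The estimate for real sums of eigenfunctions\<close>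

text \<open>
  Since \<open>V \<ge> E\<close> for \<open>\<bar>x\<bar> \<ge> r\<close>, the energy inequality bounds \<open>\<integral>\<phi>'\<^sup>2\<close> by \<open>E\<close> times the mass in
  \<open>[-r, r]\<close>. If that mass is a small fraction of the total, \<open>\<phi>\<close> is nearly constant on most intervals
  and a Poincare inequality suffices; otherwise only intervals meeting \<open>[-r, r]\<close> matter, where \<open>V\<close>
  is at most \<open>M\<^sup>2\<close>.
\<close>
lemma (in potential) real_spectral_estimate:
  fixes a \<delta> C :: real
  assumes a: "a > 0" and \<delta>: "\<delta> > 0"
    and loc: "\<And>(V :: real \<Rightarrow> real) g g' \<Lambda> \<omega> s M E B.
      M \<ge> 1 \<Longrightarrow> E \<ge> 1 \<Longrightarrow> E \<le> M\<^sup>2 \<Longrightarrow> V \<in> borel_measurable lebesgue \<Longrightarrow>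
      (\<And>x. x \<in> {s..s + 10 * a} \<Longrightarrow> 0 \<le> V x) \<Longrightarrow> (\<And>x. x \<in> {s..s + 10 * a} \<Longrightarrow> V x \<le> M\<^sup>2) \<Longrightarrow>
      finite \<Lambda> \<Longrightarrow> (\<And>\<mu>. \<mu> \<in> \<Lambda> \<Longrightarrow> \<mu> > 0) \<Longrightarrow>
      (\<And>\<mu> x. \<mu> \<in> \<Lambda> \<Longrightarrow> (g \<mu> has_real_derivative g' \<mu> x) (at x)) \<Longrightarrow>
      (\<And>\<mu> x y. \<mu> \<in> \<Lambda> \<Longrightarrow> x \<le> y \<Longrightarrow> ((\<lambda>t. (V t - \<mu>) * g \<mu> t) has_integral (g' \<mu> y - g' \<mu> x)) {x..y}) \<Longrightarrow>
      B > 0 \<Longrightarrow>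
      (\<And>m. integral {s..s + 10 * a} (\<lambda>x. (\<Sum>\<mu>\<in>\<Lambda>. \<mu> ^ m * g \<mu> x)\<^sup>2) \<le> (B * (2 * E) ^ m)\<^sup>2) \<Longrightarrow>
      (\<And>m. integral {s..s + 10 * a} (\<lambda>x. (\<Sum>\<mu>\<in>\<Lambda>. \<mu> ^ m * g' \<mu> x)\<^sup>2) \<le> (B * (2 * E) ^ m)\<^sup>2) \<Longrightarrow>
      B\<^sup>2 \<le> 240 * a\<^sup>2 * M ^ 4 * integral {s + 9 / 2 * a..s + 11 / 2 * a} (\<lambda>x. (\<Sum>\<mu>\<in>\<Lambda>. g \<mu> x)\<^sup>2) \<Longrightarrow>
      \<omega> \<in> sets lebesgue \<Longrightarrow> \<delta> * a \<le> measure lebesgue (\<omega> \<inter> {s + 9 / 2 * a..s + 11 / 2 * a}) \<Longrightarrow>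
      integral {s + 9 / 2 * a..s + 11 / 2 * a} (\<lambda>x. (\<Sum>\<mu>\<in>\<Lambda>. g \<mu> x)\<^sup>2)
        \<le> exp (C * M) * (LINT x:\<omega> \<inter> {s + 9 / 2 * a..s + 11 / 2 * a}|lebesgue. (\<Sum>\<mu>\<in>\<Lambda>. g \<mu> x)\<^sup>2)"
    and \<omega>: "\<omega> \<in> sets lebesgue" "\<And>s. \<delta> * a \<le> measure lebesgue (\<omega> \<inter> {s..s + a})"
    and M: "M \<ge> 1" and E: "E \<ge> 1" "E \<le> M\<^sup>2" and r: "r \<ge> 0"
    and Vout: "\<And>x. \<bar>x\<bar> \<ge> r \<Longrightarrow> E \<le> V x" and Vin: "\<And>x. \<bar>x\<bar> \<le> r + 7 * a \<Longrightarrow> V x \<le> M\<^sup>2"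
    and \<Lambda>: "finite \<Lambda>" "\<And>\<mu>. \<mu> \<in> \<Lambda> \<Longrightarrow> 0 < \<mu>" "\<And>\<mu>. \<mu> \<in> \<Lambda> \<Longrightarrow> \<mu> \<le> E"
    and g: "\<And>\<mu>. \<mu> \<in> \<Lambda> \<Longrightarrow> real_eigen V \<mu> (g \<mu>) (g' \<mu>)"
  shows "(LINT x|lebesgue. (\<Sum>\<mu>\<in>\<Lambda>. g \<mu> x)\<^sup>2)
    \<le> (4 / \<delta> + 8 * a\<^sup>2 * E * exp (C * M)) * (LINT x:\<omega>|lebesgue. (\<Sum>\<mu>\<in>\<Lambda>. g \<mu> x)\<^sup>2)"
proof -
  define f f' where "f m x = (\<Sum>\<mu>\<in>\<Lambda>. \<mu> ^ m * g \<mu> x)" and "f' m x = (\<Sum>\<mu>\<in>\<Lambda>. \<mu> ^ m * g' \<mu> x)" for m x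
  define \<phi> where "\<phi> x = (\<Sum>\<mu>\<in>\<Lambda>. g \<mu> x)" for x
  have f0: "f 0 = \<phi>" by (simp add: f_def[abs_def] \<phi>_def[abs_def])
  define n where "n \<mu> = (LINT x|lebesgue. (g \<mu> x)\<^sup>2)" for \<mu>
  have n0: "n \<mu> \<ge> 0" for \<mu> unfolding n_def by (intro Bochner_Integration.integral_nonneg) auto
  note sn = eigen_sum_norms[OF \<Lambda>(1) g, where c = "\<lambda>\<mu>. \<mu> ^ m" for m, folded f_def f'_def n_def]
  define N where "N = (LINT x|lebesgue. (\<phi> x)\<^sup>2)"
  have N: "N = (\<Sum>\<mu>\<in>\<Lambda>. n \<mu>)" using sn(4)[of 0] by (simp add: N_def f0)
  have fi: "integrable lebesgue (\<lambda>x. (f m x)\<^sup>2)" and f'i: "integrable lebesgue (\<lambda>x. (f' m x)\<^sup>2)"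
    and Vfi: "integrable lebesgue (\<lambda>x. V x * (f m x)\<^sup>2)" for m
    by (rule sn; assumption)+
  have fN: "(LINT x|lebesgue. (f m x)\<^sup>2) \<le> E ^ (2 * m) * N" for m
  proof -
    have "(LINT x|lebesgue. (f m x)\<^sup>2) = (\<Sum>\<mu>\<in>\<Lambda>. (\<mu> ^ m)\<^sup>2 * n \<mu>)" by (rule sn)
    also have "\<dots> \<le> (\<Sum>\<mu>\<in>\<Lambda>. E ^ (2 * m) * n \<mu>)"
    proof (intro sum_mono mult_right_mono n0)
      fix \<mu> assume "\<mu> \<in> \<Lambda>"
      then have "\<mu> ^ (2 * m) \<le> E ^ (2 * m)" using \<Lambda> by (intro power_mono) (auto intro: less_imp_le)
      then show "(\<mu> ^ m)\<^sup>2 \<le> E ^ (2 * m)" by (simp add: power_mult[symmetric] mult.commute)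
    qed
    finally show ?thesis by (simp add: N sum_distrib_left)
  qed
  have VN: "(LINT x|lebesgue. V x * (f m x)\<^sup>2) \<ge> 0" for m
    by (intro Bochner_Integration.integral_nonneg) (simp add: V_nonneg)
  have energy: "(LINT x|lebesgue. (f' m x)\<^sup>2) + (LINT x|lebesgue. V x * (f m x)\<^sup>2) \<le> E * E ^ (2 * m) * N" for m
  proof -
    have "(LINT x|lebesgue. (f' m x)\<^sup>2) + (LINT x|lebesgue. V x * (f m x)\<^sup>2) = (\<Sum>\<mu>\<in>\<Lambda>. (\<mu> ^ m)\<^sup>2 * (\<mu> * n \<mu>))" by (rule sn)
    also have "\<dots> \<le> (\<Sum>\<mu>\<in>\<Lambda>. E ^ (2 * m) * (E * n \<mu>))"
    proof (intro sum_mono mult_mono)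
      fix \<mu> assume \<mu>: "\<mu> \<in> \<Lambda>"
      then have "\<mu> ^ (2 * m) \<le> E ^ (2 * m)" using \<Lambda> by (intro power_mono) (auto intro: less_imp_le)
      then show "(\<mu> ^ m)\<^sup>2 \<le> E ^ (2 * m)" by (simp add: power_mult[symmetric] mult.commute)
      show "0 \<le> \<mu> * n \<mu>" using \<Lambda>(2)[OF \<mu>] n0[of \<mu>] by simp
    qed (use \<Lambda> n0 E in auto)
    also have "\<dots> = E * E ^ (2 * m) * N" unfolding N sum_distrib_left by (intro sum.cong) simp_all
    finally show ?thesis .
  qed
  have f'N: "(LINT x|lebesgue. (f' m x)\<^sup>2) \<le> E * E ^ (2 * m) * N" for m using energy[of m] VN[of m] by linarith
  have df: "(f m has_real_derivative f' m x) (at x)" for m x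
    unfolding f_def[abs_def] f'_def by (intro DERIV_sum DERIV_cmult eigen_derivative[OF g])
  have cf': "continuous_on X (f' m)" for X m
    unfolding f'_def[abs_def] by (intro continuous_intros eigen_derivative_continuous[OF g])
  define W where "W = (LINT x:\<omega>|lebesgue. (\<phi> x)\<^sup>2)"
  define hw where "hw x = indicator \<omega> x * (\<phi> x)\<^sup>2" for x
  have \<phi>i: "integrable lebesgue (\<lambda>x. (\<phi> x)\<^sup>2)" using fi[of 0] by (simp add: f0)
  have hwi: "integrable lebesgue hw" unfolding hw_def[abs_def]
    using integrable_mult_indicator[OF \<omega>(1) \<phi>i] by simp
  have hw0: "hw x \<ge> 0" for x by (simp add: hw_def)
  have W: "W = (LINT x|lebesgue. hw x)" by (simp add: W_def hw_def set_lebesgue_integral_def)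
  have W0: "W \<ge> 0" unfolding W by (intro Bochner_Integration.integral_nonneg hw0)
  have hwI: "(LINT x:\<omega> \<inter> {x..y}|lebesgue. (\<phi> x)\<^sup>2) = integral {x..y} hw" for x y
  proof -
    have "set_integrable lebesgue {x..y} hw" unfolding set_integrable_def by (intro integrable_mult_indicator hwi) auto
    from set_lebesgue_integral_eq_integral(2)[OF this] show ?thesis
      by (simp add: set_lebesgue_integral_def hw_def indicator_inter_arith mult_ac)
  qed
  define \<rho> where "\<rho> = integral {-r..r} (\<lambda>x. (\<phi> x)\<^sup>2)"
  have \<rho>0: "\<rho> \<ge> 0" unfolding \<rho>_def
    by (intro Henstock_Kurzweil_Integration.integral_nonneg integral_subinterval_le(1)[OF \<phi>i]) auto
  have grad: "(LINT x|lebesgue. (f' 0 x)\<^sup>2) \<le> E * \<rho>"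
  proof -
    have "(LINT x|lebesgue. (f' 0 x)\<^sup>2) \<le> E * N - (LINT x|lebesgue. V x * (\<phi> x)\<^sup>2)"
      using energy[of 0] by (simp add: f0)
    also have "\<dots> = (LINT x|lebesgue. E * (\<phi> x)\<^sup>2 - V x * (\<phi> x)\<^sup>2)"
      using \<phi>i Vfi[of 0] by (simp add: N_def f0)
    also have "\<dots> \<le> (LINT x|lebesgue. E * (indicator {-r..r} x *\<^sub>R (\<phi> x)\<^sup>2))"
    proof (rule integral_mono)
      show "integrable lebesgue (\<lambda>x. E * (\<phi> x)\<^sup>2 - V x * (\<phi> x)\<^sup>2)"
        using \<phi>i Vfi[of 0] by (simp add: f0)
      show "integrable lebesgue (\<lambda>x. E * (indicator {-r..r} x *\<^sub>R (\<phi> x)\<^sup>2))"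
        by (intro integrable_mult_right integrable_mult_indicator \<phi>i) auto
      fix x
      show "E * (\<phi> x)\<^sup>2 - V x * (\<phi> x)\<^sup>2 \<le> E * (indicator {-r..r} x *\<^sub>R (\<phi> x)\<^sup>2)"
      proof (cases "x \<in> {-r..r}")
        case True
        then show ?thesis using V_nonneg[of x] by simp
      next
        case False
        then have "E \<le> V x" by (intro Vout) auto
        then show ?thesis using False mult_right_mono[of E "V x" "(\<phi> x)\<^sup>2"] by simp
      qed
    qed
    also have "\<dots> = E * \<rho>"
    proof -
      have "set_integrable lebesgue {-r..r} (\<lambda>x. (\<phi> x)\<^sup>2)" unfolding set_integrable_def by (intro integrable_mult_indicator \<phi>i) auto
      from set_lebesgue_integral_eq_integral(2)[OF this] show ?thesis
        by (simp add: set_lebesgue_integral_def \<rho>_def)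
    qed
    finally show ?thesis .
  qed
  have poincare: "N \<le> 2 / \<delta> * W + 2 * a\<^sup>2 * (E * \<rho>)"
    unfolding N_def
  proof (rule integrable_of_bounded_integrals(2))
    fix k :: nat
    obtain K :: nat where K: "real k / a \<le> real K" using real_arch_simple by blast
    then have Ka: "real k \<le> real K * a" using a by (simp add: field_simps)
    define v where "v = - (real K * a)"
    have ve: "v + real (2 * K) * a = real K * a" by (simp add: v_def algebra_simps)
    have "integral {- real k..real k} (\<lambda>x. (\<phi> x)\<^sup>2) \<le> integral {v..v + real (2 * K) * a} (\<lambda>x. (\<phi> x)\<^sup>2)"
      unfolding ve by (rule integral_subset_le) (use Ka integral_subinterval_le(1)[OF \<phi>i] in \<open>auto simp: v_def\<close>)
    also have "\<dots> = (\<Sum>i<2 * K. integral {v + real i * a..v + real (Suc i) * a} (\<lambda>x. (\<phi> x)\<^sup>2))"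
      by (rule sum_integral_intervals[symmetric, OF \<phi>i _ a]) simp
    also have "\<dots> \<le> (\<Sum>i<2 * K. 2 / \<delta> * integral {v + real i * a..v + real (Suc i) * a} hw
        + 2 * a\<^sup>2 * integral {v + real i * a..v + real (Suc i) * a} (\<lambda>x. (f' 0 x)\<^sup>2))"
    proof (rule sum_mono)
      fix i
      have e: "v + real (Suc i) * a = (v + real i * a) + a" by (simp add: algebra_simps)
      show "integral {v + real i * a..v + real (Suc i) * a} (\<lambda>x. (\<phi> x)\<^sup>2) \<le> 2 / \<delta> * integral {v + real i * a..v + real (Suc i) * a} hw
        + 2 * a\<^sup>2 * integral {v + real i * a..v + real (Suc i) * a} (\<lambda>x. (f' 0 x)\<^sup>2)"
        unfolding hwI[symmetric] e
        by (rule poincare_on_thick_interval[OF a \<delta> df[of 0, unfolded f0] cf' \<omega>])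
    qed
    also have "\<dots> = 2 / \<delta> * integral {v..v + real (2 * K) * a} hw + 2 * a\<^sup>2 * integral {v..v + real (2 * K) * a} (\<lambda>x. (f' 0 x)\<^sup>2)"
      unfolding sum.distrib sum_distrib_left[symmetric]
      by (simp only: sum_integral_intervals[OF hwi hw0 a] sum_integral_intervals[OF f'i[of 0] zero_le_power2 a])
    also have "\<dots> \<le> 2 / \<delta> * W + 2 * a\<^sup>2 * (E * \<rho>)"
      unfolding W using \<delta> order_trans[OF integral_subinterval_le(2)[OF f'i[of 0] zero_le_power2] grad]
      by (intro add_mono mult_left_mono integral_subinterval_le(2)[OF hwi hw0]) auto
    finally show "integral {- real k..real k} (\<lambda>x. (\<phi> x)\<^sup>2) \<le> 2 / \<delta> * W + 2 * a\<^sup>2 * (E * \<rho>)" .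
  qed (use integral_subinterval_le(1)[OF \<phi>i] in auto)
  define T where "T = exp (C * M)"
  \<comment> \<open>Either the gradient term of the Poincare bound is at most \<open>N / 2\<close>
    and is absorbed, or \<open>\<rho>\<close> is at least \<open>N / (4 * a\<^sup>2 * E)\<close> and
    it suffices to bound \<open>\<rho>\<close>.\<close>
  have "N \<le> (4 / \<delta> + 8 * a\<^sup>2 * E * T) * W"
  proof (cases "2 * a\<^sup>2 * (E * \<rho>) \<le> N / 2")
    case True
    moreover have "4 / \<delta> * W = 2 * (2 / \<delta> * W)" by simp
    ultimately have "N \<le> 4 / \<delta> * W" using poincare by linarith
    moreover have "0 \<le> 8 * a\<^sup>2 * E * T * W" using E W0 by (simp add: T_def)
    ultimately show ?thesis unfolding distrib_right by linarith
  next
    case False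
    \<comment> \<open>Cells of length \<open>a\<close> are to cover \<open>{-r..r}\<close> with an
      overshoot of at most \<open>a\<close> on either side.\<close>
    obtain K :: nat where K: "r \<le> real K * a" "real K * a \<le> r + a"
    proof -
      define K where "K = nat \<lceil>r / a\<rceil>"
      have "r / a \<le> real K" "real K \<le> r / a + 1" using r a by (auto simp: K_def of_nat_nat)
      then show ?thesis using that[of K] a by (simp add: field_simps)
    qed
    define v where "v = - (real K * a)"
    have ve: "v + real (2 * K) * a = real K * a" by (simp add: v_def algebra_simps)
    \<comment> \<open>The i-th cell becomes the middle tenth of the window
      \<open>{s i..s i + 10 * a}\<close>, as the local estimate assumes.\<close>
    define s where "s i = v + real i * a - 9 / 2 * a" for i
    have sI: "s i + 9 / 2 * a = v + real i * a" "s i + 11 / 2 * a = v + real (Suc i) * a" for i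
      by (simp_all add: s_def field_simps)
    define h where "h m x = (f m x)\<^sup>2 + (f' m x)\<^sup>2" for m x
    have hi: "integrable lebesgue (h m)" for m unfolding h_def[abs_def] by (intro Bochner_Integration.integrable_add fi f'i)
    have h0: "h m x \<ge> 0" for m x by (simp add: h_def)
    have hN: "(LINT x|lebesgue. h m x) \<le> (1 + E) * E ^ (2 * m) * N" for m
      using fN[of m] f'N[of m] fi f'i by (simp add: h_def[abs_def] algebra_simps)
    define J where "J i m = integral {s i..s i + 10 * a} (h m)" for i m
    have J0: "J i m \<ge> 0" for i m unfolding J_def
      by (intro Henstock_Kurzweil_Integration.integral_nonneg integral_subinterval_le(1)[OF hi h0] h0)
    define b where "b m = (1 + E) * N * (1 / 4) ^ m" for m :: nat
    have scale: "E ^ (2 * m) / (2 * E) ^ (2 * m) = (1 / 4) ^ m" for m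
    proof -
      have "E ^ (2 * m) / (2 * E) ^ (2 * m) = (E / (2 * E)) ^ (2 * m)" by (simp add: power_divide)
      also have "E / (2 * E) = 1 / 2" using E by simp
      finally show ?thesis by (simp add: power_mult power_divide)
    qed
    have J_le: "J i m / (2 * E) ^ (2 * m) \<le> b m" for i m
    proof -
      have "J i m \<le> (1 + E) * E ^ (2 * m) * N"
        unfolding J_def by (rule order_trans[OF integral_subinterval_le(2)[OF hi h0] hN])
      then have "J i m / (2 * E) ^ (2 * m) \<le> (1 + E) * E ^ (2 * m) * N / (2 * E) ^ (2 * m)"
        using E by (intro divide_right_mono) auto
      also have "\<dots> = (1 + E) * N * (E ^ (2 * m) / (2 * E) ^ (2 * m))" by simp
      finally show ?thesis unfolding b_def scale .
    qed
    have b_sum: "summable b" "suminf b = 4 / 3 * (1 + E) * N"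
    proof -
      have "(\<lambda>m. (1 / 4 :: real) ^ m) sums (1 / (1 - 1 / 4))" by (rule geometric_sums) simp
      from sums_mult[OF this, of "(1 + E) * N"] show "summable b" "suminf b = 4 / 3 * (1 + E) * N"
        by (auto simp: b_def[abs_def] sums_iff)
    qed
    have Js: "summable (\<lambda>m. J i m / (2 * E) ^ (2 * m))" for i
      by (rule summable_comparison_test'[OF b_sum(1), of 0]) (use J_le J0 in auto)
    \<comment> \<open>Since every term is at most the sum, \<open>sqrt (d i)\<close> can serve as
      the \<open>B\<close> of the local estimate for all \<open>m\<close> simultaneously.\<close>
    define d where "d i = (\<Sum>m. J i m / (2 * E) ^ (2 * m))" for i
    have Jd: "J i m \<le> d i * (2 * E) ^ (2 * m)" for i m
    proof -
      have "sum (\<lambda>m. J i m / (2 * E) ^ (2 * m)) {m} \<le> d i"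
        unfolding d_def by (rule sum_le_suminf[OF Js]) (use J0 in auto)
      moreover have "(2 * E) ^ (2 * m) > 0" using E by simp
      ultimately show ?thesis by (simp add: divide_le_eq)
    qed
    \<comment> \<open>The windows start half a cell off the grid, so each is enlarged to 11 full
      cells; the overlap gives 11 and the geometric series with ratio \<open>1 / 4\<close> gives
      \<open>4 / 3\<close>.\<close>
    have d_total: "(\<Sum>i<2 * K. d i) \<le> 44 / 3 * (1 + E) * N"
    proof -
      have "(\<Sum>i<2 * K. d i) = (\<Sum>m. \<Sum>i<2 * K. J i m / (2 * E) ^ (2 * m))"
        unfolding d_def by (rule suminf_sum[symmetric]) (rule Js)
      also have "\<dots> \<le> (\<Sum>m. 11 * b m)"
      proof (rule suminf_le)
        fix m
        have "(\<Sum>i<2 * K. J i m) \<le> (\<Sum>i<2 * K. integral {(v - 5 * a) + real i * a..(v - 5 * a) + real (i + 11) * a} (h m))"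
          unfolding J_def
          by (intro sum_mono integral_subset_le integral_subinterval_le(1)[OF hi h0] h0)
             (use a h0 in \<open>auto simp: s_def field_simps\<close>)
        also have "\<dots> \<le> 11 * (LINT x|lebesgue. h m x)" by (rule sum_integral_overlap[OF hi h0 a])
        also have "\<dots> \<le> 11 * ((1 + E) * E ^ (2 * m) * N)" by (intro mult_left_mono hN) simp
        finally have "(\<Sum>i<2 * K. J i m) / (2 * E) ^ (2 * m) \<le> 11 * ((1 + E) * E ^ (2 * m) * N) / (2 * E) ^ (2 * m)"
          using E by (intro divide_right_mono) auto
        also have "\<dots> = 11 * ((1 + E) * N * (E ^ (2 * m) / (2 * E) ^ (2 * m)))" by simp
        finally show "(\<Sum>i<2 * K. J i m / (2 * E) ^ (2 * m)) \<le> 11 * b m"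
          unfolding scale b_def by (simp add: sum_divide_distrib)
      qed (intro summable_sum Js summable_mult b_sum)+
      also have "\<dots> = 44 / 3 * (1 + E) * N" using suminf_mult[OF b_sum(1), of 11] unfolding b_sum(2) by simp
      finally show ?thesis .
    qed
    \<comment> \<open>Chosen so that all exceptional cells together contribute at most
      \<open>N / (8 * a\<^sup>2 * E)\<close> to \<open>\<rho>\<close>, half of the lower bound for
      \<open>\<rho>\<close> in this case.\<close>
    define \<tau> where "\<tau> = 1 / (8 * a\<^sup>2 * E * (44 / 3 * (1 + E)))"
    have \<tau>: "\<tau> > 0" using a E by (simp add: \<tau>_def)
    \<comment> \<open>A cell is exceptional if its mass is at most the fraction
      \<open>\<tau>\<close> of \<open>d i\<close>. On every other cell the hypothesis on
      \<open>B\<close> in the local estimate holds, because \<open>1 / \<tau>\<close> is at most a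
      multiple of \<open>M ^ 4\<close>.\<close>
    have local: "integral {v + real i * a..v + real (Suc i) * a} (\<lambda>x. (\<phi> x)\<^sup>2)
        \<le> \<tau> * d i + T * integral {v + real i * a..v + real (Suc i) * a} hw" if i: "i < 2 * K" for i
    proof (cases "integral {v + real i * a..v + real (Suc i) * a} (\<lambda>x. (\<phi> x)\<^sup>2) \<le> \<tau> * d i")
      case True
      moreover have "0 \<le> T * integral {v + real i * a..v + real (Suc i) * a} hw"
        unfolding T_def by (intro mult_nonneg_nonneg Henstock_Kurzweil_Integration.integral_nonneg integral_subinterval_le(1)[OF hwi hw0] hw0) auto
      ultimately show ?thesis by linarith
    next
      case not_le: False
      have d0: "d i \<ge> 0" using Jd[of i 0] J0[of i 0] by simp
      have "integral {v + real i * a..v + real (Suc i) * a} (\<lambda>x. (\<phi> x)\<^sup>2) \<le> J i 0"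
      proof -
        have "integral {v + real i * a..v + real (Suc i) * a} (\<lambda>x. (\<phi> x)\<^sup>2) \<le> integral {s i..s i + 10 * a} (\<lambda>x. (\<phi> x)\<^sup>2)"
          by (intro integral_subset_le integral_subinterval_le(1)[OF \<phi>i]) (use a in \<open>auto simp: s_def algebra_simps\<close>)
        also have "\<dots> \<le> J i 0" unfolding J_def
          by (intro integral_le integral_subinterval_le(1)[OF \<phi>i] integral_subinterval_le(1)[OF hi h0]) (auto simp: h_def f0)
        finally show ?thesis .
      qed
      then have "d i > 0" using not_le Jd[of i 0] d0 \<tau> by (cases "d i = 0") auto
      define B where "B = sqrt (d i)"
      have B: "B > 0" "B\<^sup>2 = d i" using \<open>d i > 0\<close> by (auto simp: B_def)
      have BE: "(B * (2 * E) ^ m)\<^sup>2 = d i * (2 * E) ^ (2 * m)" for m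
        unfolding power_mult_distrib B(2) by (simp only: power_mult[symmetric] mult.commute[of m 2] power_mult_distrib)
      have "integral {s i + 9 / 2 * a..s i + 11 / 2 * a} (\<lambda>x. (\<Sum>\<mu>\<in>\<Lambda>. g \<mu> x)\<^sup>2)
        \<le> exp (C * M) * (LINT x:\<omega> \<inter> {s i + 9 / 2 * a..s i + 11 / 2 * a}|lebesgue. (\<Sum>\<mu>\<in>\<Lambda>. g \<mu> x)\<^sup>2)"
      proof (rule loc[OF M E V_meas V_nonneg _ \<Lambda>(1,2) eigen_derivative[OF g] eigen_integral[OF g] B(1) _ _ _ \<omega>(1)])
        fix x assume x: "x \<in> {s i..s i + 10 * a}"
        have "real i * a \<le> 2 * (real K * a) - a"
        proof -
          have "real i \<le> real (2 * K) - 1" using i by linarith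
          then show ?thesis using a mult_right_mono[of "real i" "real (2 * K) - 1" a] by (simp add: left_diff_distrib)
        qed
        moreover have "0 \<le> real i * a" using a by simp
        moreover have "- (real K * a) + real i * a - 9 / 2 * a \<le> x" "x \<le> - (real K * a) + real i * a - 9 / 2 * a + 10 * a"
          using x by (auto simp: s_def v_def)
        \<comment> \<open>The windows leave \<open>{-r..r}\<close> by at most
          \<open>11 / 2 * a\<close>: \<open>a\<close> from the cover and \<open>9 / 2 * a\<close>
          from the window beyond its cell. The margin \<open>7 * a\<close> accommodates
          this.\<close>
        ultimately have "\<bar>x\<bar> \<le> r + 7 * a"
          using K a by linarith
        then show "V x \<le> M\<^sup>2" by (rule Vin)
      next
        fix m
        have "integral {s i..s i + 10 * a} (\<lambda>x. (f m x)\<^sup>2) \<le> J i m"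
          unfolding J_def by (intro integral_le integral_subinterval_le(1)[OF fi] integral_subinterval_le(1)[OF hi h0]) (auto simp: h_def)
        then show "integral {s i..s i + 10 * a} (\<lambda>x. (\<Sum>\<mu>\<in>\<Lambda>. \<mu> ^ m * g \<mu> x)\<^sup>2) \<le> (B * (2 * E) ^ m)\<^sup>2"
          unfolding BE f_def[symmetric] using Jd[of i m] by linarith
        have "integral {s i..s i + 10 * a} (\<lambda>x. (f' m x)\<^sup>2) \<le> J i m"
          unfolding J_def by (intro integral_le integral_subinterval_le(1)[OF f'i] integral_subinterval_le(1)[OF hi h0]) (auto simp: h_def)
        then show "integral {s i..s i + 10 * a} (\<lambda>x. (\<Sum>\<mu>\<in>\<Lambda>. \<mu> ^ m * g' \<mu> x)\<^sup>2) \<le> (B * (2 * E) ^ m)\<^sup>2"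
          unfolding BE f'_def[symmetric] using Jd[of i m] by linarith
      next
        have e: "s i + 11 / 2 * a = (s i + 9 / 2 * a) + a" by (simp add: field_simps)
        show "\<delta> * a \<le> measure lebesgue (\<omega> \<inter> {s i + 9 / 2 * a..s i + 11 / 2 * a})"
          unfolding e by (rule \<omega>(2))
      next
        define Y where "Y = integral {s i + 9 / 2 * a..s i + 11 / 2 * a} (\<lambda>x. (\<phi> x)\<^sup>2)"
        have "\<tau> * d i < Y" using not_le unfolding Y_def sI by linarith
        then have "d i \<le> Y / \<tau>" using \<tau> by (simp add: field_simps)
        also have "Y / \<tau> = (8 * 44 / 3) * a\<^sup>2 * (E * (1 + E)) * Y" by (simp add: \<tau>_def)
        \<comment> \<open>The exact factor \<open>8 * 44 / 3 * 2\<close> is a little below 235 and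
          is rounded up to 240.\<close>
        also have "\<dots> \<le> 240 * a\<^sup>2 * M ^ 4 * Y"
        proof (rule mult_right_mono)
          have "E * (1 + E) \<le> M\<^sup>2 * (2 * M\<^sup>2)" using E by (intro mult_mono) auto
          also have "\<dots> = 2 * M ^ 4" by (simp add: power4_eq_xxxx power2_eq_square)
          finally have "(8 * 44 / 3) * a\<^sup>2 * (E * (1 + E)) \<le> (8 * 44 / 3) * a\<^sup>2 * (2 * M ^ 4)" by (intro mult_left_mono) auto
          also have "\<dots> \<le> 240 * a\<^sup>2 * M ^ 4" by simp
          finally show "(8 * 44 / 3) * a\<^sup>2 * (E * (1 + E)) \<le> 240 * a\<^sup>2 * M ^ 4" .
          show "0 \<le> Y" unfolding Y_def
            by (intro Henstock_Kurzweil_Integration.integral_nonneg integral_subinterval_le(1)[OF \<phi>i]) auto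
        qed
        finally show "B\<^sup>2 \<le> 240 * a\<^sup>2 * M ^ 4 * integral {s i + 9 / 2 * a..s i + 11 / 2 * a} (\<lambda>x. (\<Sum>\<mu>\<in>\<Lambda>. g \<mu> x)\<^sup>2)"
          unfolding B(2) by (simp add: Y_def \<phi>_def)
      qed
      then have "integral {v + real i * a..v + real (Suc i) * a} (\<lambda>x. (\<phi> x)\<^sup>2) \<le> T * integral {v + real i * a..v + real (Suc i) * a} hw"
        unfolding sI \<phi>_def[symmetric] hwI T_def .
      then show ?thesis using mult_nonneg_nonneg[of \<tau> "d i"] \<tau> d0 by linarith
    qed
    have "\<rho> \<le> integral {v..v + real (2 * K) * a} (\<lambda>x. (\<phi> x)\<^sup>2)"
      unfolding \<rho>_def ve by (rule integral_subset_le) (use K integral_subinterval_le(1)[OF \<phi>i] in \<open>auto simp: v_def\<close>)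
    also have "\<dots> = (\<Sum>i<2 * K. integral {v + real i * a..v + real (Suc i) * a} (\<lambda>x. (\<phi> x)\<^sup>2))"
      by (rule sum_integral_intervals[symmetric, OF \<phi>i _ a]) simp
    also have "\<dots> \<le> (\<Sum>i<2 * K. \<tau> * d i + T * integral {v + real i * a..v + real (Suc i) * a} hw)"
      by (intro sum_mono local) simp
    also have "\<dots> = \<tau> * (\<Sum>i<2 * K. d i) + T * integral {v..v + real (2 * K) * a} hw"
      unfolding sum.distrib sum_distrib_left[symmetric] by (simp only: sum_integral_intervals[OF hwi hw0 a])
    also have "\<dots> \<le> \<tau> * (44 / 3 * (1 + E) * N) + T * W"
      unfolding W using \<tau>
      by (intro add_mono mult_left_mono d_total integral_subinterval_le(2)[OF hwi hw0]) (auto simp: T_def)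
    also have "\<tau> * (44 / 3 * (1 + E) * N) = N / (8 * a\<^sup>2 * E)"
      using E by (simp add: \<tau>_def)
    finally have \<rho>_le: "\<rho> \<le> N / (8 * a\<^sup>2 * E) + T * W" .
    have pos: "8 * a\<^sup>2 * E > 0" using a E by simp
    have "8 * a\<^sup>2 * E * \<rho> \<le> 8 * a\<^sup>2 * E * (N / (8 * a\<^sup>2 * E) + T * W)"
      using pos by (intro mult_left_mono \<rho>_le) simp
    also have "\<dots> = N + 8 * a\<^sup>2 * E * T * W" using a E by (simp add: distrib_left)
    finally have "8 * a\<^sup>2 * E * \<rho> \<le> N + 8 * a\<^sup>2 * E * T * W" .
    moreover have "8 * a\<^sup>2 * E * \<rho> = 4 * (2 * a\<^sup>2 * (E * \<rho>))" by simp
    ultimately have "N \<le> 8 * a\<^sup>2 * E * T * W" using False by linarith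
    moreover have "0 \<le> 4 / \<delta> * W" using \<delta> W0 by simp
    ultimately show ?thesis unfolding distrib_right by linarith
  qed
  then show ?thesis by (simp add: N_def W_def T_def \<phi>_def)
qed

section \<open>From complex to real eigenfunctions\<close>

context potential
begin

lemma real_eigen_add:
  assumes u: "real_eigen V \<mu> u u'" and v: "real_eigen V \<mu> v v'"
  shows "real_eigen V \<mu> (\<lambda>x. u x + v x) (\<lambda>x. u' x + v' x)"
  unfolding real_eigen_def
proof (intro conjI allI impI)
  show "((\<lambda>x. u x + v x) has_real_derivative u' x + v' x) (at x)" for x
    by (intro DERIV_add eigen_derivative[OF u] eigen_derivative[OF v])
  show "((\<lambda>t. (V t - \<mu>) * (u t + v t)) has_integral (u' y + v' y - (u' x + v' x))) {x..y}" if "x \<le> y" for x y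
    using has_integral_add[OF eigen_integral[OF u that] eigen_integral[OF v that]] by (simp add: algebra_simps)
  have "integrable lebesgue (\<lambda>x. (u x)\<^sup>2 + (v x)\<^sup>2 + 2 * (u x * v x))"
    by (intro Bochner_Integration.integrable_add integrable_mult_right eigen_L2[OF u] eigen_L2[OF v] eigen_pair(1)[OF u v])
  then show "integrable lebesgue (\<lambda>x. (u x + v x)\<^sup>2)" by (simp add: power2_sum mult.assoc)
qed

lemma real_eigen_sum:
  assumes "finite A" "\<And>i. i \<in> A \<Longrightarrow> real_eigen V \<mu> (u i) (u' i)"
  shows "real_eigen V \<mu> (\<lambda>x. \<Sum>i\<in>A. u i x) (\<lambda>x. \<Sum>i\<in>A. u' i x)"
  using assms
proof (induction A)
  case empty
  then show ?case by (simp add: real_eigen_def)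
next
  case (insert i A)
  then have "real_eigen V \<mu> (\<lambda>x. u i x + (\<Sum>i\<in>A. u i x)) (\<lambda>x. u' i x + (\<Sum>i\<in>A. u' i x))"
    by (intro real_eigen_add) auto
  then show ?case using insert.hyps by simp
qed

text \<open>\<open>V\<close> is real, so taking real parts commutes with the equation, and an
  equation valid almost everywhere suffices for the integrated form. The factor \<open>c\<close>
  serves both for coefficients and for passing from real to imaginary parts.\<close>

lemma real_eigen_Re:
  assumes f: "f \<in> eigenspace V \<mu>"
  obtains u' where "real_eigen V \<mu> (\<lambda>x. Re (c * f x)) u'"
proof -
  obtain g where sf: "square_integrable f" and g: "has_second_derivative f g"
    and ae: "AE x in lebesgue. complex_of_real \<mu> * f x = - g x + complex_of_real (V x) * f x"
    using f by (auto simp: eigenspace_def schroedinger_graph_def)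
  obtain f' where f': "\<And>x. (f has_vector_derivative f' x) (at x)"
    and gi: "\<And>s t. s \<le> t \<Longrightarrow> (g has_integral (f' t - f' s)) {s..t}"
    using g by (auto simp: has_second_derivative_def)
  have bl: "bounded_linear (\<lambda>z. Re (c * z))"
    by (intro bounded_linear_compose[OF bounded_linear_Re bounded_linear_mult_right])
  obtain Z where Z: "Z \<in> null_sets lebesgue" "{x \<in> space lebesgue. \<not> complex_of_real \<mu> * f x = - g x + complex_of_real (V x) * f x} \<subseteq> Z"
    using ae by (auto simp: eventually_ae_filter)
  have nZ: "negligible Z" using Z(1) by (simp add: negligible_iff_null_sets)
  have eq: "complex_of_real (V x - \<mu>) * f x = g x" if "x \<notin> Z" for x
  proof -
    have "complex_of_real \<mu> * f x = - g x + complex_of_real (V x) * f x" using Z(2) that by auto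
    then show ?thesis by (simp add: algebra_simps)
  qed
  have "real_eigen V \<mu> (\<lambda>x. Re (c * f x)) (\<lambda>x. Re (c * f' x))"
    unfolding real_eigen_def
  proof (intro conjI allI impI)
    show "((\<lambda>x. Re (c * f x)) has_real_derivative Re (c * f' x)) (at x)" for x
      using bounded_linear.has_vector_derivative[OF bl f'] by (simp add: has_real_derivative_iff_has_vector_derivative)
    fix x y :: real assume xy: "x \<le> y"
    have "((\<lambda>t. complex_of_real (V t - \<mu>) * f t) has_integral (f' y - f' x)) {x..y}"
      by (rule has_integral_spike[OF nZ _ gi[OF xy]]) (use eq in auto)
    from has_integral_linear[OF this bl]
    show "((\<lambda>t. (V t - \<mu>) * Re (c * f t)) has_integral (Re (c * f' y) - Re (c * f' x))) {x..y}"
      by (simp add: o_def algebra_simps)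
  next
    have [measurable]: "f \<in> borel_measurable lebesgue" and i: "integrable lebesgue (\<lambda>x. (cmod (f x))\<^sup>2)"
      using sf by (auto simp: square_integrable_def)
    show "integrable lebesgue (\<lambda>x. (Re (c * f x))\<^sup>2)"
    proof (rule Bochner_Integration.integrable_bound[OF integrable_mult_right[OF i, of "(cmod c)\<^sup>2"]])
      show "AE x in lebesgue. norm ((Re (c * f x))\<^sup>2) \<le> norm ((cmod c)\<^sup>2 * (cmod (f x))\<^sup>2)"
      proof (rule AE_I2)
        fix x
        have "\<bar>Re (c * f x)\<bar>\<^sup>2 \<le> (cmod (c * f x))\<^sup>2" by (intro power_mono abs_Re_le_cmod) auto
        then show "norm ((Re (c * f x))\<^sup>2) \<le> norm ((cmod c)\<^sup>2 * (cmod (f x))\<^sup>2)"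
          by (simp add: norm_mult power_mult_distrib)
      qed
    qed measurable
  qed
  then show ?thesis by (rule that)
qed

text \<open>Terms with equal eigenvalue are collected, so that the remaining components belong to
  distinct eigenvalues and hence are orthogonal.\<close>

lemma spectral_range_Re:
  assumes \<phi>: "\<phi> \<in> spectral_range V E" and V0: "\<And>x. v0 \<le> V x"
  obtains \<Lambda> g g' where "finite \<Lambda>" "\<And>\<mu>. \<mu> \<in> \<Lambda> \<Longrightarrow> v0 \<le> \<mu> \<and> \<mu> \<le> E"
    "\<And>\<mu>. \<mu> \<in> \<Lambda> \<Longrightarrow> real_eigen V \<mu> (g \<mu>) (g' \<mu>)" "\<And>x. Re (d * \<phi> x) = (\<Sum>\<mu>\<in>\<Lambda>. g \<mu> x)"
proof -
  obtain F c where F: "finite F" "F \<subseteq> (\<Union>\<mu>\<in>{..E}. eigenspace V \<mu>)" and \<phi>_eq: "\<phi> = (\<lambda>x. \<Sum>f\<in>F. c f * f x)"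
    using \<phi> by (auto simp: spectral_range_def)
  have "\<forall>f\<in>F. \<exists>\<mu>. \<mu> \<le> E \<and> f \<in> eigenspace V \<mu>" using F(2) by blast
  then obtain m where m: "\<And>f. f \<in> F \<Longrightarrow> m f \<le> E" "\<And>f. f \<in> F \<Longrightarrow> f \<in> eigenspace V (m f)"
    using bchoice[of F "\<lambda>f \<mu>. \<mu> \<le> E \<and> f \<in> eigenspace V \<mu>"] by auto
  have "\<forall>f\<in>F. \<exists>u'. real_eigen V (m f) (\<lambda>x. Re ((d * c f) * f x)) u'"
  proof
    fix f assume "f \<in> F"
    from real_eigen_Re[OF m(2)[OF this], of "d * c f"] show "\<exists>u'. real_eigen V (m f) (\<lambda>x. Re ((d * c f) * f x)) u'" by auto
  qed
  then obtain u' where u': "\<And>f. f \<in> F \<Longrightarrow> real_eigen V (m f) (\<lambda>x. Re ((d * c f) * f x)) (u' f)"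
    using bchoice[of F "\<lambda>f u'. real_eigen V (m f) (\<lambda>x. Re ((d * c f) * f x)) u'"] by auto
  define g g' where "g \<mu> x = (\<Sum>f\<in>{f \<in> F. m f = \<mu>}. Re ((d * c f) * f x))" and "g' \<mu> x = (\<Sum>f\<in>{f \<in> F. m f = \<mu>}. u' f x)" for \<mu> x
  have re: "real_eigen V \<mu> (g \<mu>) (g' \<mu>)" for \<mu>
    unfolding g_def[abs_def] g'_def[abs_def] by (rule real_eigen_sum) (use F u' in auto)
  \<comment> \<open>The zero function lies in every eigenspace, so a vanishing component may carry
    any label, even a negative one. Such components are removed; one of positive norm satisfies
    \<open>v0 \<le> \<mu>\<close> by the energy identity.\<close>
  define \<Lambda> where "\<Lambda> = {\<mu> \<in> m ` F. (LINT x|lebesgue. (g \<mu> x)\<^sup>2) \<noteq> 0}"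
  have fin: "finite (m ` F)" using F by simp
  have "Re (d * \<phi> x) = (\<Sum>\<mu>\<in>\<Lambda>. g \<mu> x)" for x
  proof -
    have "Re (d * \<phi> x) = (\<Sum>f\<in>F. Re ((d * c f) * f x))"
      by (simp add: \<phi>_eq sum_distrib_left mult.assoc Re_sum)
    also have "\<dots> = (\<Sum>\<mu>\<in>m ` F. g \<mu> x)" unfolding g_def by (rule sum.image_gen[OF F(1)])
    also have "\<dots> = (\<Sum>\<mu>\<in>\<Lambda>. g \<mu> x)"
    proof (rule sum.mono_neutral_right[OF fin])
      show "\<forall>\<mu>\<in>m ` F - \<Lambda>. g \<mu> x = 0"
        using continuous_integral_square_eq_0[OF eigen_continuous[OF re] eigen_L2[OF re]] by (auto simp: \<Lambda>_def)
    qed (auto simp: \<Lambda>_def)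
    finally show ?thesis .
  qed
  moreover have "v0 \<le> \<mu> \<and> \<mu> \<le> E" if \<mu>: "\<mu> \<in> \<Lambda>" for \<mu>
  proof
    show "\<mu> \<le> E" using \<mu> m by (auto simp: \<Lambda>_def)
    define n where "n = (LINT x|lebesgue. (g \<mu> x)\<^sup>2)"
    have n: "n > 0"
    proof -
      have "n \<ge> 0" unfolding n_def by (intro Bochner_Integration.integral_nonneg) auto
      moreover have "n \<noteq> 0" using \<mu> by (simp add: \<Lambda>_def n_def)
      ultimately show ?thesis by simp
    qed
    have "v0 * n = (LINT x|lebesgue. v0 * (g \<mu> x)\<^sup>2)" by (simp add: n_def)
    also have "\<dots> \<le> (LINT x|lebesgue. V x * (g \<mu> x)\<^sup>2)"
      by (intro integral_mono integrable_mult_right eigen_L2[OF re] eigen_integrable(2)[OF re] mult_right_mono V0) auto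
    also have "\<dots> \<le> (LINT x|lebesgue. g' \<mu> x * g' \<mu> x) + (LINT x|lebesgue. V x * (g \<mu> x * g \<mu> x))"
      by (simp add: power2_eq_square Bochner_Integration.integral_nonneg)
    also have "\<dots> = \<mu> * n" using eigen_pair(4)[OF re re] by (simp add: n_def power2_eq_square)
    finally show "v0 \<le> \<mu>" using n by simp
  qed
  moreover have "finite \<Lambda>" using fin by (simp add: \<Lambda>_def)
  ultimately show ?thesis using that[of \<Lambda> g g'] re by blast
qed

end

section \<open>Choice of the energy scale and the final estimate\<close>

section \<open>Uniformity of the growth condition\<close>

text \<open>
  A diagonal argument: if no fixed dilation \<open>1 + \<epsilon>\<close> worked, slowly decreasing \<open>\<epsilon>\<close> along a sequence
  of bad energies would give a function \<open>\<eta>\<close> that tends to \<open>0\<close> and violates the hypothesis.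
\<close>
lemma uniform_dilation:
  fixes \<Psi> \<rho> :: "real \<Rightarrow> real" and p :: real
  assumes h: "\<And>\<eta> :: real \<Rightarrow> real. (\<eta> \<longlongrightarrow> 0) at_top \<Longrightarrow> (\<lambda>E. \<Psi> (\<rho> E * (1 + \<eta> E))) \<in> O[at_top](\<lambda>E. E powr p)"
  obtains \<epsilon> C E0 where "\<epsilon> > 0" "C > 0" "\<And>E. E \<ge> E0 \<Longrightarrow> \<Psi> (\<rho> E * (1 + \<epsilon>)) \<le> C * E powr p"
proof -
  \<comment> \<open>The dilation and the constant are governed by the same index, so one
    \<open>n\<close> that is not bad for all large energies provides both.\<close>
  define bad where "bad n E \<longleftrightarrow> real n * E powr p < \<Psi> (\<rho> E * (1 + 1 / real (Suc n)))" for n E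
  have "\<exists>n E0. \<forall>E\<ge>E0. \<not> bad n E"
  proof (rule ccontr)
    assume "\<not> ?thesis"
    then have ex: "\<exists>E\<ge>E0. bad n E" for n E0 by blast
    \<comment> \<open>Increments of at least 1 make \<open>X\<close> strictly increasing, so that
      \<open>\<eta>\<close> is well defined at the bad energies; \<open>real n \<le> X n\<close>
      sends these energies to infinity.\<close>
    have "\<exists>X :: nat \<Rightarrow> real. \<forall>n. (bad n (X n) \<and> real n \<le> X n) \<and> X n + 1 \<le> X (Suc n)"
    proof (rule dependent_nat_choice)
      show "\<exists>x. bad 0 x \<and> real 0 \<le> x" using ex[of 0 0] by auto
      show "\<exists>y. (bad (Suc n) y \<and> real (Suc n) \<le> y) \<and> x + 1 \<le> y" for x n
        using ex[of "max (real (Suc n)) (x + 1)" "Suc n"] by auto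
    qed
    then obtain X where X: "\<And>n. bad n (X n)" "\<And>n. real n \<le> X n" "\<And>n. X n + 1 \<le> X (Suc n)" by blast
    have "strict_mono X" by (rule strict_mono_Suc_iff[THEN iffD2]) (use X(3) less_le_trans[OF less_add_one] in blast)
    then have inj: "inj X" by (rule strict_mono_imp_inj_on)
    define \<eta> where "\<eta> E = (if E \<in> range X then 1 / real (Suc (inv X E)) else 0)" for E
    have \<eta>X: "\<eta> (X n) = 1 / real (Suc n)" for n using inj by (simp add: \<eta>_def)
    have "(\<eta> \<longlongrightarrow> 0) at_top"
    proof (rule tendstoI)
      fix e :: real assume e: "e > 0"
      obtain N where N: "1 / real (Suc N) < e" using e by (metis nat_approx_posE)
      show "\<forall>\<^sub>F E in at_top. dist (\<eta> E) 0 < e"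
        using eventually_gt_at_top[of "X N"]
      proof eventually_elim
        case (elim E)
        show ?case
        proof (cases "E \<in> range X")
          case True
          then obtain n where n: "E = X n" by auto
          have "N < n" using elim \<open>strict_mono X\<close> n by (simp add: strict_mono_less)
          then have "1 / real (Suc n) \<le> 1 / real (Suc N)" by (intro divide_left_mono) auto
          then show ?thesis using N by (simp add: n \<eta>X)
        qed (simp add: \<eta>_def e)
      qed
    qed
    from landau_o.bigE[OF h[OF this]] obtain C where C: "C > 0" "\<forall>\<^sub>F E in at_top. norm (\<Psi> (\<rho> E * (1 + \<eta> E))) \<le> C * norm (E powr p)" by blast
    then obtain E0 where E0: "\<And>E. E \<ge> E0 \<Longrightarrow> norm (\<Psi> (\<rho> E * (1 + \<eta> E))) \<le> C * norm (E powr p)"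
      by (auto simp: eventually_at_top_linorder)
    obtain n :: nat where n: "max E0 C \<le> real n" using real_arch_simple by blast
    have "E0 \<le> X n" using n X(2)[of n] by simp
    from E0[OF this] have "\<Psi> (\<rho> (X n) * (1 + 1 / real (Suc n))) \<le> C * X n powr p" unfolding \<eta>X by simp
    also have "\<dots> \<le> real n * X n powr p" using n by (intro mult_right_mono) auto
    finally show False using X(1)[of n] by (simp add: bad_def)
  qed
  then obtain n E0 where nE: "\<And>E. E \<ge> E0 \<Longrightarrow> \<not> bad n E" by blast
  show ?thesis
  proof (rule that[of "1 / real (Suc n)" "real n + 1" E0])
    fix E assume "E \<ge> E0"
    then have "\<Psi> (\<rho> E * (1 + 1 / real (Suc n))) \<le> real n * E powr p" using nE by (simp add: bad_def not_less)
    also have "\<dots> \<le> (real n + 1) * E powr p" by (intro mult_right_mono) auto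
    finally show "\<Psi> (\<rho> E * (1 + 1 / real (Suc n))) \<le> (real n + 1) * E powr p" .
  qed auto
qed

section \<open>The spectral inequality\<close>

lemma thick_set_delta_le_1:
  assumes "thick_set a \<delta> \<omega>" shows "\<delta> \<le> 1"
proof -
  have a: "a > 0" and \<omega>: "\<omega> \<in> sets lebesgue" and t: "\<delta> * a \<le> measure lebesgue (\<omega> \<inter> {0..0 + a})"
    using assms unfolding thick_set_def by (auto dest: spec[of _ 0])
  have "measure lebesgue (\<omega> \<inter> {0..0 + a}) \<le> measure lebesgue {0..0 + a}"
    by (rule measure_mono_fmeasurable) (use \<omega> in auto)
  moreover have "measure lebesgue {0..0 + a} = a" using a by simp
  ultimately have "\<delta> * a \<le> 1 * a" using t by linarith
  then show ?thesis using a by (simp only: mult_le_cancel_right_pos)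
qed

text \<open>For \<open>\<delta> = 1\<close> the factor \<open>\<bar>ln \<delta>\<bar>\<close> is 0,
  so the refined claim must hold with constant 1 and cannot come from the general estimate.
  Countably many intervals of length \<open>a\<close> cover the line, and each misses only a null
  set.\<close>

lemma thick_set_1_full:
  assumes "thick_set a 1 \<omega>" shows "AE x in lebesgue. x \<in> \<omega>"
proof -
  have a: "a > 0" and \<omega>: "\<omega> \<in> sets lebesgue" and t: "\<And>s. a \<le> measure lebesgue (\<omega> \<inter> {s..s + a})"
    using assms unfolding thick_set_def by auto
  define P where "P k = {real_of_int k * a..real_of_int k * a + a}" for k
  have null: "P k - \<omega> \<in> null_sets lebesgue" for k
  proof -
    have fm: "P k \<in> lmeasurable" "\<omega> \<inter> P k \<in> lmeasurable"
      unfolding P_def by (auto intro!: bounded_set_imp_lmeasurable simp: \<omega>)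
    have "measure lebesgue (P k - \<omega> \<inter> P k) = measure lebesgue (P k) - measure lebesgue (\<omega> \<inter> P k)"
      by (rule measurable_measure_Diff[OF fm(1)]) (use fm in auto)
    also have "\<dots> \<le> 0" using t[of "real_of_int k * a"] a by (simp add: P_def)
    finally have "measure lebesgue (P k - \<omega> \<inter> P k) = 0" using measure_nonneg[of lebesgue "P k - \<omega> \<inter> P k"] by linarith
    moreover have "P k - \<omega> \<inter> P k \<in> lmeasurable" using fm by (rule fmeasurable.Diff)
    moreover have "P k - \<omega> \<inter> P k = P k - \<omega>" by auto
    ultimately show ?thesis by (simp add: negligible_iff_null_sets[symmetric] negligible_iff_measure0)
  qed
  have cover: "- \<omega> \<subseteq> (\<Union>k. P k - \<omega>)"
  proof
    fix x assume "x \<in> - \<omega>"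
    have "real_of_int \<lfloor>x / a\<rfloor> \<le> x / a" "x / a \<le> real_of_int \<lfloor>x / a\<rfloor> + 1" by linarith+
    then have "real_of_int \<lfloor>x / a\<rfloor> * a \<le> x" "x \<le> (real_of_int \<lfloor>x / a\<rfloor> + 1) * a"
      using a by (simp_all only: pos_le_divide_eq pos_divide_le_eq)
    then have "x \<in> P \<lfloor>x / a\<rfloor>" by (simp add: P_def distrib_right)
    then show "x \<in> (\<Union>k. P k - \<omega>)" using \<open>x \<in> - \<omega>\<close> by blast
  qed
  have "(\<Union>k. P k - \<omega>) \<in> null_sets lebesgue" by (rule null_sets_UN') (use null in auto)
  then have "AE x in lebesgue. x \<notin> (\<Union>k. P k - \<omega>)" by (rule AE_not_in)
  then show ?thesis by eventually_elim (use cover in blast)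
qed

lemma spectral_range_measurable:
  assumes "\<phi> \<in> spectral_range V E" shows "\<phi> \<in> borel_measurable lebesgue"
proof -
  obtain F c where F: "F \<subseteq> (\<Union>\<mu>\<in>{..E}. eigenspace V \<mu>)" and \<phi>: "\<phi> = (\<lambda>x. \<Sum>f\<in>F. c f * f x)"
    using assms by (auto simp: spectral_range_def)
  have "f \<in> borel_measurable lebesgue" if f: "f \<in> F" for f
  proof -
    obtain \<mu> where "f \<in> eigenspace V \<mu>" using F f by blast
    then show ?thesis by (simp add: eigenspace_def schroedinger_graph_def square_integrable_def)
  qed
  then show ?thesis unfolding \<phi> by (intro borel_measurable_sum borel_measurable_times borel_measurable_const)
qed

lemma spectral_range_mono:
  assumes "E \<le> E'" shows "spectral_range V E \<subseteq> spectral_range V E'"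
proof -
  have "(\<Union>\<mu>\<in>{..E}. eigenspace V \<mu>) \<subseteq> (\<Union>\<mu>\<in>{..E'}. eigenspace V \<mu>)" by (rule UN_mono) (use assms in auto)
  then show ?thesis unfolding spectral_range_def by (intro Collect_mono ex_mono conj_mono) auto
qed

lemma L2norm_on_AE_full:
  assumes \<phi>: "\<phi> \<in> borel_measurable lebesgue" and \<omega>: "\<omega> \<in> sets lebesgue" "AE x in lebesgue. x \<in> \<omega>"
  shows "L2norm_on UNIV \<phi> = L2norm_on \<omega> \<phi>"
proof -
  have "(LINT x:UNIV|lebesgue. (cmod (\<phi> x))\<^sup>2) = (LINT x:\<omega>|lebesgue. (cmod (\<phi> x))\<^sup>2)"
    unfolding set_lebesgue_integral_def
  proof (rule integral_cong_AE)
    show "AE x in lebesgue. indicator UNIV x *\<^sub>R (cmod (\<phi> x))\<^sup>2 = indicator \<omega> x *\<^sub>R (cmod (\<phi> x))\<^sup>2"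
      using \<omega>(2) by eventually_elim simp
  qed (use \<phi> \<omega>(1) in measurable)
  then show ?thesis by (simp add: L2norm_on_def)
qed

text \<open>Both squared norms split into those of the real parts of \<phi> and of - i \<phi>, each
  of which is a real sum of eigenfunctions. The prefactor is pushed into the exponent by means of
  \<open>M \<ge> 1\<close> and E <= M^2 <= exp (2 M).\<close>

lemma (in potential) complex_spectral_estimate:
  fixes a \<delta> v0 :: real
  assumes a: "a > 0" and \<delta>: "\<delta> > 0" "\<delta> \<le> 1" and v0: "v0 > 0" "\<And>x. v0 \<le> V x"
    and \<omega>: "\<omega> \<in> sets lebesgue" "\<And>s. \<delta> * a \<le> measure lebesgue (\<omega> \<inter> {s..s + a})"
  obtains C where "C \<ge> 0" "\<And>M E r \<phi>. M \<ge> 1 \<Longrightarrow> E \<ge> 1 \<Longrightarrow> E \<le> M\<^sup>2 \<Longrightarrow> r \<ge> 0 \<Longrightarrow>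
    (\<And>x. \<bar>x\<bar> \<ge> r \<Longrightarrow> E \<le> V x) \<Longrightarrow> (\<And>x. \<bar>x\<bar> \<le> r + 7 * a \<Longrightarrow> V x \<le> M\<^sup>2) \<Longrightarrow> \<phi> \<in> spectral_range V E \<Longrightarrow>
    L2norm_on UNIV \<phi> \<le> exp (C * M) * L2norm_on \<omega> \<phi>"
proof -
  have D: "0 < 240 * a\<^sup>2" using a by simp
  show ?thesis
  proof (rule local_estimate[OF a \<delta> D], goal_cases)
    case (1 C)
    note loc = 1
    define q where "q = 4 / \<delta> + 8 * a\<^sup>2"
    \<comment> \<open>The summand 2 pays for \<open>E \<le> (exp M)\<^sup>2\<close>; halving
      \<open>Q\<close> below accounts for the square root in the norm.\<close>
    define Q where "Q = q + 2 + \<bar>C\<bar>"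
    have q: "q \<ge> 0" using \<delta> by (simp add: q_def)
    show ?thesis
    proof (rule that[of "Q / 2"])
      show "Q / 2 \<ge> 0" using q by (simp add: Q_def)
      fix M E r \<phi>
      assume M: "M \<ge> 1" and E: "E \<ge> 1" "E \<le> M\<^sup>2" and r: "r \<ge> 0"
        and Vout: "\<And>x. \<bar>x\<bar> \<ge> r \<Longrightarrow> E \<le> V x" and Vin: "\<And>x. \<bar>x\<bar> \<le> r + 7 * a \<Longrightarrow> V x \<le> M\<^sup>2"
        and \<phi>: "\<phi> \<in> spectral_range V E"
      have part: "integrable lebesgue (\<lambda>x. (Re (d * \<phi> x))\<^sup>2) \<and> (LINT x|lebesgue. (Re (d * \<phi> x))\<^sup>2)
          \<le> (4 / \<delta> + 8 * a\<^sup>2 * E * exp (C * M)) * (LINT x:\<omega>|lebesgue. (Re (d * \<phi> x))\<^sup>2)" for d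
      proof (rule spectral_range_Re[OF \<phi> v0(2), where d = d], goal_cases)
        case (1 \<Lambda> g g')
        note \<Lambda> = 1(1,2) and g = 1(3) and eq = 1(4)
        have "integrable lebesgue (\<lambda>x. (\<Sum>\<mu>\<in>\<Lambda>. g \<mu> x)\<^sup>2)"
          using eigen_sum_norms(1)[OF \<Lambda>(1) g, where c = "\<lambda>_. 1"] by simp
        moreover have "(LINT x|lebesgue. (\<Sum>\<mu>\<in>\<Lambda>. g \<mu> x)\<^sup>2)
            \<le> (4 / \<delta> + 8 * a\<^sup>2 * E * exp (C * M)) * (LINT x:\<omega>|lebesgue. (\<Sum>\<mu>\<in>\<Lambda>. g \<mu> x)\<^sup>2)"
        proof (rule real_spectral_estimate[OF a \<delta>(1) loc \<omega> M E r Vout Vin \<Lambda>(1) _ _ g])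
          show "0 < \<mu>" "\<mu> \<le> E" if "\<mu> \<in> \<Lambda>" for \<mu> using \<Lambda>(2)[OF that] v0(1) by auto
        qed
        ultimately show ?thesis unfolding eq ..
      qed
      have Re: "integrable lebesgue (\<lambda>x. (Re (\<phi> x))\<^sup>2)" and Im: "integrable lebesgue (\<lambda>x. (Im (\<phi> x))\<^sup>2)"
        using part[of 1] part[of "- \<i>"] by auto
      have sRe: "set_integrable lebesgue \<omega> (\<lambda>x. (Re (\<phi> x))\<^sup>2)" and sIm: "set_integrable lebesgue \<omega> (\<lambda>x. (Im (\<phi> x))\<^sup>2)"
        unfolding set_integrable_def by (intro integrable_mult_indicator \<omega> Re Im)+
      define W where "W = (LINT x:\<omega>|lebesgue. (cmod (\<phi> x))\<^sup>2)"
      define N where "N = (LINT x|lebesgue. (cmod (\<phi> x))\<^sup>2)"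
      have W: "W = (LINT x:\<omega>|lebesgue. (Re (\<phi> x))\<^sup>2) + (LINT x:\<omega>|lebesgue. (Im (\<phi> x))\<^sup>2)"
        unfolding W_def cmod_power2 by (rule set_integral_add(2)[OF sRe sIm])
      have "N = (LINT x|lebesgue. (Re (\<phi> x))\<^sup>2) + (LINT x|lebesgue. (Im (\<phi> x))\<^sup>2)"
        unfolding N_def cmod_power2 by (rule Bochner_Integration.integral_add[OF Re Im])
      also have "\<dots> \<le> (4 / \<delta> + 8 * a\<^sup>2 * E * exp (C * M)) * W"
        unfolding W distrib_left using part[of 1] part[of "- \<i>"] by (intro add_mono) auto
      also have "\<dots> \<le> exp (Q * M) * W"
      proof (rule mult_right_mono)
        have 1: "1 \<le> E * exp (\<bar>C\<bar> * M)" using mult_mono[of 1 E 1 "exp (\<bar>C\<bar> * M)"] E M by simp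
        have "C * M \<le> \<bar>C\<bar> * M" using M by (intro mult_right_mono) auto
        then have "8 * a\<^sup>2 * E * exp (C * M) \<le> 8 * a\<^sup>2 * E * exp (\<bar>C\<bar> * M)" using E by (intro mult_left_mono) auto
        moreover have "4 / \<delta> * 1 \<le> 4 / \<delta> * (E * exp (\<bar>C\<bar> * M))" using \<delta> by (intro mult_left_mono 1) simp
        ultimately have "4 / \<delta> + 8 * a\<^sup>2 * E * exp (C * M) \<le> q * (E * exp (\<bar>C\<bar> * M))"
          by (simp add: q_def algebra_simps)
        also have "\<dots> \<le> exp (q * M) * ((exp M)\<^sup>2 * exp (\<bar>C\<bar> * M))"
        proof (intro mult_mono)
          have "q * 1 \<le> q * M" using q M by (intro mult_left_mono)
          then show "q \<le> exp (q * M)" using exp_ge_add_one_self[of "q * M"] by linarith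
          have "M\<^sup>2 \<le> (exp M)\<^sup>2" using exp_ge_add_one_self[of M] M by (intro power_mono) linarith+
          then show "E \<le> (exp M)\<^sup>2" using E by linarith
        qed (use E in auto)
        also have "\<dots> = exp (Q * M)"
          unfolding power2_eq_square exp_add[symmetric] by (rule arg_cong[of _ _ exp]) (simp add: Q_def algebra_simps)
        finally show "4 / \<delta> + 8 * a\<^sup>2 * E * exp (C * M) \<le> exp (Q * M)" .
        show "0 \<le> W" unfolding W_def set_lebesgue_integral_def by (intro Bochner_Integration.integral_nonneg) auto
      qed
      finally have "sqrt N \<le> sqrt (exp (Q * M) * W)" by simp
      also have "exp (Q * M) = (exp (Q / 2 * M))\<^sup>2" by (simp add: power2_eq_square exp_add[symmetric])
      finally show "L2norm_on UNIV \<phi> \<le> exp (Q / 2 * M) * L2norm_on \<omega> \<phi>"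
        by (simp add: L2norm_on_def N_def W_def real_sqrt_mult set_lebesgue_integral_def)
    qed
  qed
qed

text \<open>A nonzero component has energy at least \<open>v0\<close> times its mass, so none
  survives. This disposes of energies near 0, where \<open>E powr \<kappa>\<close> leaves no room in
  the exponent.\<close>

lemma spectral_range_below:
  assumes "\<And>x. v0 \<le> V x" "potential V" "E < v0" "\<phi> \<in> spectral_range V E"
  shows "\<phi> x = 0"
proof -
  interpret potential V by fact
  have "Re (d * \<phi> x) = 0" for d
  proof (rule spectral_range_Re[OF assms(4,1), where d = d], goal_cases)
    case (1 \<Lambda> g g')
    have "\<Lambda> = {}" using 1(2) assms(3) by fastforce
    then show ?case using 1(4) by simp
  qed
  from this[of 1] this[of "- \<i>"] show ?thesis by (simp add: complex_eq_iff)
qed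

text \<open>\<open>inv_into {0..} \<Phi>\<close> is the inverse function on the image
  \<open>{\<Phi> 0..}\<close> and unspecified below it, which does not affect a statement about
  large energies.\<close>

theorem theorem1:
  fixes \<Phi> \<Psi> V :: "real \<Rightarrow> real" and \<kappa> a \<delta> :: real and \<omega> :: "real set"
  assumes "\<And>t. t \<ge> 0 \<Longrightarrow> \<Phi> t > 0" and "\<And>t. t \<ge> 0 \<Longrightarrow> \<Psi> t > 0"
    and "strict_mono_on {0..} \<Phi>" and "strict_mono_on {0..} \<Psi>"
    and "filterlim \<Phi> at_top at_top" and "filterlim \<Psi> at_top at_top"
    and "\<Phi> ` {0..} = {\<Phi> 0..}"
    and "V \<in> borel_measurable lebesgue"
    and "\<And>x. \<Phi> \<bar>x\<bar> \<le> V x" and "\<And>x. V x \<le> \<Psi> \<bar>x\<bar>"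
    and "\<kappa> > 0"
    and "\<And>\<beta>. \<beta> > 0 \<Longrightarrow> \<exists>C. \<forall>x::real. \<Phi> \<bar>x\<bar> \<le> C * exp (\<beta> * \<bar>x\<bar>)"
    and "\<And>\<eta> :: real \<Rightarrow> real. (\<eta> \<longlongrightarrow> 0) at_top \<Longrightarrow>
           (\<lambda>E. \<Psi> (inv_into {0..} \<Phi> E * (1 + \<eta> E))) \<in> O[at_top](\<lambda>E. E powr (2 * \<kappa>))"
    and "thick_set a \<delta> \<omega>"
  shows "(\<exists>C. \<forall>E>0. \<forall>\<phi>\<in>spectral_range V E.
            L2norm_on UNIV \<phi> \<le> exp (C * E powr \<kappa>) * L2norm_on \<omega> \<phi>) \<and>
         (\<exists>C\<^sub>0>0. \<forall>E>0. \<forall>\<phi>\<in>spectral_range V E.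
            L2norm_on UNIV \<phi> \<le> exp ((C\<^sub>0 * a * \<bar>ln \<delta>\<bar>) * E powr \<kappa>) * L2norm_on \<omega> \<phi>)"
proof -
  note \<Phi>_pos = assms(1) and \<Phi>_mono = assms(3) and \<Psi>_mono = assms(4) and \<Phi>_range = assms(7)
    and V_meas = assms(8) and V_lower = assms(9) and V_upper = assms(10) and \<kappa> = assms(11)
  have a: "a > 0" and \<delta>: "\<delta> > 0" "\<delta> \<le> 1" and \<omega>: "\<omega> \<in> sets lebesgue"
    and thick: "\<And>s. \<delta> * a \<le> measure lebesgue (\<omega> \<inter> {s..s + a})"
    using assms(14) thick_set_delta_le_1[OF assms(14)] by (auto simp: thick_set_def)
  have \<Phi>_le: "\<Phi> s \<le> \<Phi> t" and \<Psi>_le: "\<Psi> s \<le> \<Psi> t" if "0 \<le> s" "s \<le> t" for s t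
    using that strict_mono_on_leD[OF \<Phi>_mono, of s t] strict_mono_on_leD[OF \<Psi>_mono, of s t] by auto
  have v0: "\<Phi> 0 > 0" "\<Phi> 0 \<le> V x" for x
    using \<Phi>_pos[of 0] \<Phi>_le[of 0 "\<bar>x\<bar>"] V_lower[of x] by auto
  have pot: "potential V"
  proof
    show "0 \<le> V x" for x using v0(1) v0(2)[of x] by linarith
    show "\<exists>C. \<forall>x. \<bar>x\<bar> \<le> R \<longrightarrow> V x \<le> C" for R
    proof (intro exI allI impI)
      fix x :: real assume "\<bar>x\<bar> \<le> R"
      then show "V x \<le> \<Psi> (max R 0)" using V_upper[of x] \<Psi>_le[of "\<bar>x\<bar>" "max R 0"] by simp
    qed
  qed (rule V_meas)
  interpret potential V by fact
  obtain C1 where C1: "C1 \<ge> 0" and est: "\<And>M E r \<phi>. M \<ge> 1 \<Longrightarrow> E \<ge> 1 \<Longrightarrow> E \<le> M\<^sup>2 \<Longrightarrow> r \<ge> 0 \<Longrightarrow>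
    (\<And>x. \<bar>x\<bar> \<ge> r \<Longrightarrow> E \<le> V x) \<Longrightarrow> (\<And>x. \<bar>x\<bar> \<le> r + 7 * a \<Longrightarrow> V x \<le> M\<^sup>2) \<Longrightarrow> \<phi> \<in> spectral_range V E \<Longrightarrow>
    L2norm_on UNIV \<phi> \<le> exp (C1 * M) * L2norm_on \<omega> \<phi>"
    using complex_spectral_estimate[OF a \<delta> v0 \<omega> thick] by blast
  define r where "r E = inv_into {0..} \<Phi> E" for E
  have r: "0 \<le> r E" "\<Phi> (r E) = E" if "\<Phi> 0 \<le> E" for E
  proof -
    have "E \<in> \<Phi> ` {0..}" using \<Phi>_range that by simp
    then show "0 \<le> r E" "\<Phi> (r E) = E"
      using inv_into_into[of E \<Phi> "{0..}"] f_inv_into_f[of E \<Phi> "{0..}"] by (auto simp: r_def)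
  qed
  obtain \<epsilon> C2 E1 where \<epsilon>: "\<epsilon> > 0" and C2: "C2 > 0"
    and E1: "\<And>E. E \<ge> E1 \<Longrightarrow> \<Psi> (r E * (1 + \<epsilon>)) \<le> C2 * E powr (2 * \<kappa>)"
    using uniform_dilation[of \<Psi> r "2 * \<kappa>"] assms(13) unfolding r_def by blast
  \<comment> \<open>Once \<open>r E\<close> exceeds this radius, the dilation by
    \<open>1 + \<epsilon>\<close> covers the fixed margin \<open>7 * a\<close> that the windows
    need.\<close>
  define t0 where "t0 = 7 * a / \<epsilon>"
  have t0: "t0 \<ge> 0" using a \<epsilon> by (simp add: t0_def)
  define E0 where "E0 = Max {1, \<Phi> 0, E1, \<Phi> t0}"
  have E0: "E0 \<ge> 1" "E0 \<ge> \<Phi> 0" "E0 \<ge> E1" "E0 \<ge> \<Phi> t0" by (simp_all add: E0_def)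
  define K where "K = C1 * sqrt C2"
  have K: "K \<ge> 0" using C1 C2 by (simp add: K_def)
  have large: "L2norm_on UNIV \<phi> \<le> exp (K * E powr \<kappa>) * L2norm_on \<omega> \<phi>"
    if E: "E \<ge> E0" and \<phi>: "\<phi> \<in> spectral_range V E" for E \<phi>
  proof -
    have E': "E \<ge> 1" "\<Phi> 0 \<le> E" "E \<ge> E1" "\<Phi> t0 \<le> E" using E E0 by linarith+
    note rE = r[OF E'(2)]
    have "t0 \<le> r E"
    proof (rule ccontr)
      assume "\<not> t0 \<le> r E"
      then have "\<Phi> (r E) < \<Phi> t0" using strict_mono_onD[OF \<Phi>_mono, of "r E" t0] rE t0 by simp
      then show False using E' rE by simp
    qed
    then have 7: "r E + 7 * a \<le> r E * (1 + \<epsilon>)" using \<epsilon> by (simp add: t0_def field_simps)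
    define M where "M = sqrt C2 * E powr \<kappa>"
    have M2: "M\<^sup>2 = C2 * E powr (2 * \<kappa>)"
      using C2 by (simp add: M_def power_mult_distrib powr_add[symmetric] power2_eq_square[of "E powr \<kappa>"])
    have Vin: "V x \<le> M\<^sup>2" if "\<bar>x\<bar> \<le> r E + 7 * a" for x
      using V_upper[of x] \<Psi>_le[of "\<bar>x\<bar>" "r E * (1 + \<epsilon>)"] that 7 E1[OF E'(3)] unfolding M2 by linarith
    have Vout: "E \<le> V x" if "r E \<le> \<bar>x\<bar>" for x
      using \<Phi>_le[OF rE(1) that] V_lower[of x] rE(2) by linarith
    \<comment> \<open>At |x| = r E the lower and the upper bound for \<open>V\<close> both apply, so
      \<open>E \<le> M\<^sup>2\<close> is a consequence of the growth condition, and with it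
      \<open>M \<ge> 1\<close>.\<close>
    have EM: "E \<le> M\<^sup>2" using Vout[of "r E"] Vin[of "r E"] rE(1) a by simp
    have "1\<^sup>2 \<le> M\<^sup>2" using EM E' by simp
    moreover have "M \<ge> 0" using C2 by (simp add: M_def)
    ultimately have "M \<ge> 1" using power2_le_imp_le[of 1 M] by simp
    from est[OF this E'(1) EM rE(1) Vout Vin \<phi>] show ?thesis by (simp add: K_def M_def mult.assoc)
  qed
  have nn: "L2norm_on \<omega> \<phi> \<ge> 0" for \<phi>
    unfolding L2norm_on_def set_lebesgue_integral_def by (intro real_sqrt_ge_zero Bochner_Integration.integral_nonneg) auto
  \<comment> \<open>Between \<open>\<Phi> 0\<close> and \<open>E0\<close> the estimate at energy
    \<open>E0\<close> is used; there \<open>E powr \<kappa>\<close> is at least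
    \<open>\<Phi> 0 powr \<kappa>\<close>, and the quotient makes up for the loss.\<close>
  define C where "C = K * max 1 (E0 powr \<kappa> / \<Phi> 0 powr \<kappa>)"
  have C: "K * 1 \<le> C" "K * (E0 powr \<kappa> / \<Phi> 0 powr \<kappa>) \<le> C"
    unfolding C_def using K by (intro mult_left_mono; simp)+
  have main: "L2norm_on UNIV \<phi> \<le> exp (C * E powr \<kappa>) * L2norm_on \<omega> \<phi>"
    if E: "E > 0" and \<phi>: "\<phi> \<in> spectral_range V E" for E \<phi>
  proof -
    consider "E \<ge> E0" | "\<Phi> 0 \<le> E" "E \<le> E0" | "E < \<Phi> 0" by linarith
    then show ?thesis
    proof cases
      case 1
      have "exp (K * E powr \<kappa>) \<le> exp (C * E powr \<kappa>)" using C(1) by (simp add: mult_right_mono)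
      then have "exp (K * E powr \<kappa>) * L2norm_on \<omega> \<phi> \<le> exp (C * E powr \<kappa>) * L2norm_on \<omega> \<phi>"
        by (rule mult_right_mono[OF _ nn])
      with large[OF 1 \<phi>] show ?thesis by linarith
    next
      case 2
      have "K * E0 powr \<kappa> = K * (E0 powr \<kappa> / \<Phi> 0 powr \<kappa>) * \<Phi> 0 powr \<kappa>" using v0(1) by simp
      also have "\<dots> \<le> C * E powr \<kappa>"
        using C K 2 v0(1) \<kappa> by (intro mult_mono powr_mono2) auto
      finally have "exp (K * E0 powr \<kappa>) * L2norm_on \<omega> \<phi> \<le> exp (C * E powr \<kappa>) * L2norm_on \<omega> \<phi>"
        by (intro mult_right_mono nn) simp
      moreover have "\<phi> \<in> spectral_range V E0" using spectral_range_mono[OF 2(2)] \<phi> by (rule subsetD)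
      ultimately show ?thesis using large[OF order_refl, of \<phi>] by linarith
    next
      case 3
      then have "\<phi> x = 0" for x using spectral_range_below[OF v0(2) pot _ \<phi>] by simp
      then show ?thesis by (simp add: L2norm_on_def)
    qed
  qed
  have "\<exists>C\<^sub>0>0. \<forall>E>0. \<forall>\<phi>\<in>spectral_range V E.
    L2norm_on UNIV \<phi> \<le> exp ((C\<^sub>0 * a * \<bar>ln \<delta>\<bar>) * E powr \<kappa>) * L2norm_on \<omega> \<phi>"
  proof (cases "\<delta> = 1")
    case True
    then have "L2norm_on UNIV \<phi> = L2norm_on \<omega> \<phi>" if "\<phi> \<in> spectral_range V E" for E \<phi>
      using L2norm_on_AE_full[OF spectral_range_measurable[OF that] \<omega>] thick_set_1_full assms(14) by blast
    then show ?thesis using True by (intro exI[of _ 1]) simp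
  next
    case False
    then have l: "a * \<bar>ln \<delta>\<bar> > 0" using a \<delta> by (intro mult_pos_pos) auto
    \<comment> \<open>\<open>max C 1\<close> stands in for \<open>C\<close> because the witness must
      be positive, while \<open>C\<close> may be 0.\<close>
    show ?thesis
    proof (intro exI[of _ "max C 1 / (a * \<bar>ln \<delta>\<bar>)"] conjI allI impI ballI)
      show "0 < max C 1 / (a * \<bar>ln \<delta>\<bar>)" using l by (intro divide_pos_pos) auto
      fix E \<phi> assume E: "0 < E" "\<phi> \<in> spectral_range V E"
      have eq: "max C 1 / (a * \<bar>ln \<delta>\<bar>) * a * \<bar>ln \<delta>\<bar> = max C 1"
        unfolding mult.assoc using l by (simp only: nonzero_eq_divide_eq[symmetric] less_imp_neq[THEN not_sym] not_False_eq_True times_divide_eq_left nonzero_mult_div_cancel_right)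
      have "exp (C * E powr \<kappa>) * L2norm_on \<omega> \<phi> \<le> exp (max C 1 * E powr \<kappa>) * L2norm_on \<omega> \<phi>"
        by (intro mult_right_mono nn) (simp add: mult_right_mono)
      then show "L2norm_on UNIV \<phi> \<le> exp (max C 1 / (a * \<bar>ln \<delta>\<bar>) * a * \<bar>ln \<delta>\<bar> * E powr \<kappa>) * L2norm_on \<omega> \<phi>"
        unfolding eq using main[OF E] by linarith
    qed
  qed
  then show ?thesis using main by blast
qed

end
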